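(* Let $c\ge1$ be an integer and let $$\mathcal{B}_{c,1}=\big\{x_{m_1}(z,t)_{r_1}x_{m_2}(z,t)_{r_2}\cdots x_{m_k}(z,t)_{r_k}\mathbf 1\,:\, r_1,\dots,r_{k-1}\leq -2,\ r_k\leq -1,\ 1\leq m_j\leq c,\ j=1,\dots,k,\ k\in\mathbb{Z}_{\geq 0}\big\}\subset V_{c,1}.$$ The set $\left\{a(z,t)|_{t=1}\,:\,a(z,t)\in\mathcal{B}_{c,1}\right\}$ is linearly independent.
   Context: Operators. Let $\mathbb F=\mathbb C(q^{1/2})$ and $\mathsf q=q^2$. For an $\mathbb F$-vector space $L$, $L((z_1,\dots,z_m))$ is the space of formal Laurent series with coefficients in $L$ and exponents bounded below in each variable; $\mathcal E(L)=\operatorname{Hom}(L,L((z)))$, $\mathcal E(L)_t=\mathcal E(L)\otimes\mathbb F[t]$; $a(z)\otimes t^\alpha$ is homogeneous of weight $\alpha$. Evaluation at $t=1$ is the linear map $a(z)\otimes g(t)\mapsto a(z)\otimes g(1)$. $[r]_{\mathsf q}=(\mathsf q^r-1)/(\mathsf q-1)$, with corresponding factorials $[r]_{\mathsf q}!$ and binomials $\binom ml_{\mathsf q}=[m]_{\mathsf q}\cdots[m-l+1]_{\mathsf q}/[l]_{\mathsf q}!$. The $\mathsf q$-derivative is $a^{[1]}(z)=\frac{a(z\mathsf q)-a(z)}{z(\mathsf q-1)}$, $a^{[r]}$ its $r$-th iterate. $\mathbb F[z]_0=\{p\in\mathbb F[z]:p(1)=1,\ p(\mathsf q^n)\ne0\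 \forall n\in\mathbb Z_{\ge0}\}$. A sequence $(a_1(z)\otimes t^{\alpha_1},\dots,a_m(z)\otimes t^{\alpha_m})$ is quasi-commutative if for some $p\in\mathbb F[z]_0$ the series $\bigl(\prod_{i<j}p(z_j/z_i)\bigr)a_1(z_1)a_2(z_2\mathsf q^{\alpha_1})\cdots a_m(z_m\mathsf q^{\alpha_1+\cdots+\alpha_{m-1}})$ lies in $\operatorname{Hom}(L,L((z_1,\dots,z_m)))$; a sequence of general elements is quasi-commutative if all choices of homogeneous components are. For a quasi-commutative pair and $r\ge0$, $(a(z)\otimes t^\alpha)_{-r-1}(b(z)\otimes t^\beta)=\lim_{z_1\to z}\frac{p(z/z_1)}{[r]_{\mathsf q}!}a^{[r]}(z_1)b(z\mathsf q^{\alpha+r})\otimes t^{\alpha+\beta+r}$, with $p\in\mathbb F[z]_0$ any polynomial such that $p(z/z_1)a^{[r]}(z_1)b(z\mathsf q^{\alpha+r})\in\operatorname{Hom}(L,L((z_1,z)))$ (the limit means setting $z_1=z$; the result is independent of $p$); for $r<0$ the product is $0$; extend bilinearly. $Y(a,z_0)b=\sum_r(a_rb)z_0^{-r-1}$; $\mathbf 1=1\otimes1$ (identity operator tensor $1$). Iterated products are nested to the right. A graded nonlocal $\mathsf q$-vertex algebra is a $\mathbb Z$-graded space $V=\coprod_uV_{(u)}$ with a linear map $Y(\cdot,z_0):V\to(\operatorname{End}V)[[z_0^{\pm1}]]$, $Y(a,z_0)=\sum_ra_rz_0^{-r-1}$, and $\mathbf 1\in V$ such that: $a_rb=0$ for $r\gg0$;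 $Y(\mathbf 1,z_0)=1_V$; $Y(a,z_0)\mathbf 1\in V[[z_0]]$ has constant term $a$; $a_rV_{(s)}\subseteq V_{(s+u-r-1)}$ for $a\in V_{(u)}$; and for $a\in V_{(u)}$, $b,c\in V$, $r,s\in\mathbb Z$: $(a_rb)_sc=\sum_{l\ge0}\binom{l-r-1}{l}_{\mathsf q}\mathsf q^{(s+l+1)(r-u+1)}a_{r-l}(b_{s+l}c)$ (this is $Y(a,z_0+z_2)Y(b,z_2\mathsf q^u)c=Y(Y(a,z_0)b,z_2)c$ with $z_2z_0=\mathsf qz_0z_2$). A graded nonlocal $\mathsf q$-vertex algebra $V\subseteq\mathcal E(L)_t$ is a subspace whose pairs are quasi-commutative, containing $\mathbf 1$, closed under all products, satisfying these axioms with $Y(a,z_0)b=\sum_{r\in\mathbb Z}(a_rb)z_0^{-r-1}$ formed from the products $a_rb$ of quasi-commutative pairs in $\mathcal E(L)_t$, with $\mathbf 1=1\otimes1$ (identity operator of $L$ tensor $1$), and with $V_{(u)}=\{a(z)\otimes t^u\in V\}$. The module $L$ for $U_q(\widehat{\mathfrak{sl}}_2)$. Let $[r]=(q^r-q^{-r})/(q-q^{-1})$. $M(1)$ is the polynomial algebra over $\mathbb F$ in $a(-r)$, $r\ge1$; $a(-r)$ acts by multiplication and $a(r)$, $r\ge1$, as the derivation with $[a(r),a(-s)]=\delta_{rs}\frac{[2r][r]}{r}$. Let $Q=\mathbb Z\alpha_1$, $(\alpha_1,\alpha_1)=2$, $\mathbb C\{Q\}$ its group algebra (scalars extended to $\mathbb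 F$) with basis $e^\beta$, $z^{\partial_{\alpha_1}}e^\beta=z^{(\alpha_1,\beta)}e^\beta$, $Ke^\beta=q^{(\alpha_1,\beta)}e^\beta$. On $L_0=M(1)\otimes\mathbb C\{Q\}$ (the Frenkel–Jing module of highest weight $\Lambda_0$) put $$x^+(z)=\exp\Bigl(\sum_{r\ge1}\tfrac{q^{-r/2}}{[r]}a(-r)z^r\Bigr)\exp\Bigl(-\sum_{r\ge1}\tfrac{q^{-r/2}}{[r]}a(r)z^{-r}\Bigr)\otimes e^{\alpha_1}z^{\partial_{\alpha_1}},\quad \phi(z)=K^{-1}\exp\Bigl(-(q-q^{-1})\sum_{r\ge1}a(-r)z^r\Bigr).$$ On $L=(L_0)^{\otimes c}$ the current $x(z)=x_1^+(z)\in\mathcal E(L)$ acts (Drinfeld coproduct) by $$x(z)=\sum_{l=1}^c\phi(zq^{1/2})\otimes\phi(zq^{3/2})\otimes\cdots\otimes\phi(zq^{l-3/2})\otimes x^+(zq^{l-1})\otimes1^{\otimes(c-l)}.$$ $V_{c,1}\subseteq\mathcal E(L)_t$ is the smallest graded nonlocal $\mathsf q$-vertex algebra containing $x(z)\otimes t$ (it exists). For $m\ge1$, $x_m(z,t)=\underbrace{(x(z)\otimes t)_{-1}\cdots(x(z)\otimes t)_{-1}}_{m}\mathbf 1\in V_{c,1}$. For $k=0$ the monomial in $\mathcal B_{c,1}$ is $\mathbf 1$. *)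

theory Defs
  imports
    "HOL-Computational_Algebra.Computational_Algebra"
    "HOL-Library.Cardinality"
    "HOL-Library.Poly_Mapping"
    "HOL-Library.Function_Algebras"
    "HOL-Library.Product_Plus"
begin

section \<open>The ground field\<close>

text \<open>The field $\mathbb F = \mathbb C(q^{1/2})$; its indeterminate is \<open>qh\<close> $= q^{1/2}$.\<close>

type_synonym qfield = "complex poly fract"

definition qh :: qfield where "qh = Fract [:0, 1:] 1"

definition qq :: qfield where "qq = qh ^ 2"

definition sq :: qfield where "sq = qq ^ 2"

definition qnum :: "nat \<Rightarrow> qfield"
  where "qnum r = (qq ^ r - inverse (qq ^ r)) / (qq - inverse qq)"

definition sqint :: "int \<Rightarrow> qfield"
  where "sqint r = (sq powi r - 1) / (sq - 1)"

definition sqfact :: "nat \<Rightarrow> qfield"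
  where "sqfact r = (\<Prod>i=1..r. sqint (int i))"

definition sqbinom :: "int \<Rightarrow> nat \<Rightarrow> qfield"
  where "sqbinom m l = (\<Prod>i<l. sqint (m - int i)) / sqfact l"


section \<open>Vector spaces, currents and polynomials in $t$\<close>

text \<open>The $\mathbb F$-vector space with basis \<open>'b\<close> is \<open>'b \<Rightarrow>\<^sub>0 qfield\<close>.\<close>

definition fscale :: "qfield \<Rightarrow> ('b \<Rightarrow>\<^sub>0 qfield) \<Rightarrow> ('b \<Rightarrow>\<^sub>0 qfield)"
  where "fscale k v = Poly_Mapping.map ((*) k) v"

lemma lookup_fscale [simp]: "Poly_Mapping.lookup (fscale k v) b = k * Poly_Mapping.lookup v b"
  by (simp add: fscale_def Poly_Mapping.map.rep_eq when_def)

interpretation fvec: vector_space "fscale :: qfield \<Rightarrow> ('b \<Rightarrow>\<^sub>0 qfield) \<Rightarrow> _"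
  by unfold_locales (rule poly_mapping_eqI; simp add: lookup_add algebra_simps)+

definition lin_ext :: "('b \<Rightarrow> ('d \<Rightarrow>\<^sub>0 qfield)) \<Rightarrow> ('b \<Rightarrow>\<^sub>0 qfield) \<Rightarrow> ('d \<Rightarrow>\<^sub>0 qfield)"
  where "lin_ext f v = (\<Sum>b\<in>Poly_Mapping.keys v. fscale (Poly_Mapping.lookup v b) (f b))"

text \<open>
  A family of maps $a(z) = \sum_n a_n z^n$ on \<open>L = ('b \<Rightarrow>\<^sub>0 qfield)\<close> is the function \<open>a\<close> for which
  \<open>a v n\<close> is the coefficient of $z^n$ in $a(z)v$.  The set \<open>currents\<close> is
  $\mathcal E(L) = \mathrm{Hom}(L, L((z)))$.
\<close>

type_synonym 'b fseries = "('b \<Rightarrow>\<^sub>0 qfield) \<Rightarrow> int \<Rightarrow> ('b \<Rightarrow>\<^sub>0 qfield)"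

definition currents :: "'b fseries set"
  where "currents = {a. (\<forall>n. Vector_Spaces.linear fscale fscale (\<lambda>v. a v n)) \<and>
                        (\<forall>v. \<exists>N. \<forall>n<N. a v n = 0)}"

definition cscale :: "qfield \<Rightarrow> 'b fseries \<Rightarrow> 'b fseries"
  where "cscale k a = (\<lambda>v n. fscale k (a v n))"

interpretation cvec: vector_space "cscale :: qfield \<Rightarrow> 'b fseries \<Rightarrow> _"
  by unfold_locales
    (simp_all add: cscale_def fun_eq_iff fvec.scale_right_distrib fvec.scale_left_distrib)

definition one_current :: "'b fseries"
  where "one_current = (\<lambda>v n. if n = 0 then v else 0)"

text \<open>\<open>dilate k a\<close> is $a(kz)$.\<close>

definition dilate :: "qfield \<Rightarrow> 'b fseries \<Rightarrow> 'b fseries"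
  where "dilate k a = (\<lambda>v n. fscale (k powi n) (a v n))"

text \<open>
  The $\mathsf q$-derivative $(a(z\mathsf q) - a(z)) / (z(\mathsf q - 1))$: its coefficient of $z^n$ is
  $(\mathsf q^{n+1} - 1)/(\mathsf q - 1)$ times that of $z^{n+1}$ in $a(z)$.
\<close>

definition sqderiv :: "'b fseries \<Rightarrow> 'b fseries"
  where "sqderiv a = (\<lambda>v n. fscale (inverse (sq - 1)) (dilate sq a v (n + 1) - a v (n + 1)))"

text \<open>
  $\mathcal E(L)_t = \mathcal E(L) \otimes \mathbb F[t]$ consists of the polynomials in $t$ with
  coefficients in $\mathcal E(L)$; $a(z) \otimes t^\alpha$ is \<open>monom a \<alpha>\<close>.
\<close>

definition currents_t :: "'b fseries poly set"
  where "currents_t = {A. \<forall>\<alpha>. coeff A \<alpha> \<in> currents}"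

definition tscale :: "qfield \<Rightarrow> 'b fseries poly \<Rightarrow> 'b fseries poly"
  where "tscale k A = map_poly (cscale k) A"

lemma coeff_tscale [simp]: "coeff (tscale k A) n = cscale k (coeff A n)"
  unfolding tscale_def by (rule coeff_map_poly) simp

interpretation tvec: vector_space "tscale :: qfield \<Rightarrow> 'b fseries poly \<Rightarrow> _"
  by unfold_locales
    (rule poly_eqI; simp add: cvec.scale_right_distrib cvec.scale_left_distrib)+

definition eval_t1 :: "'b fseries poly \<Rightarrow> 'b fseries"
  where "eval_t1 A = (\<Sum>\<alpha>\<le>degree A. coeff A \<alpha>)"


section \<open>Quasi-commutativity and products\<close>

text \<open>$\mathbb F[z]_0$\<close>

definition polys0 :: "qfield poly set"
  where "polys0 = {p. poly p 1 = 1 \<and> (\<forall>n::nat. poly p (sq ^ n) \<noteq> 0)}"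

text \<open>
  \<open>reg p a b v n\<^sub>1 n\<^sub>2\<close> is the coefficient of $z_1^{n_1} z_2^{n_2}$ in $p(z_2/z_1) a(z_1) b(z_2) v$.
\<close>

definition reg :: "qfield poly \<Rightarrow> 'b fseries \<Rightarrow> 'b fseries \<Rightarrow>
    ('b \<Rightarrow>\<^sub>0 qfield) \<Rightarrow> int \<Rightarrow> int \<Rightarrow> ('b \<Rightarrow>\<^sub>0 qfield)"
  where "reg p a b v n1 n2 =
    (\<Sum>k\<le>degree p. fscale (coeff p k) (a (b v (n2 - int k)) (n1 + int k)))"

text \<open>
  $p(z_2/z_1) a(z_1) b(z_2) \in \mathrm{Hom}(L, L((z_1,z_2)))$.  Linearity in \<open>v\<close> is automatic for
  \<open>a, b \<in> currents\<close>.
\<close>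

definition regular :: "qfield poly \<Rightarrow> 'b fseries \<Rightarrow> 'b fseries \<Rightarrow> bool"
  where "regular p a b \<longleftrightarrow>
    (\<forall>v. \<exists>N. \<forall>n1 n2. n1 < N \<or> n2 < N \<longrightarrow> reg p a b v n1 n2 = 0)"

definition qc_hom :: "'b fseries \<Rightarrow> nat \<Rightarrow> 'b fseries \<Rightarrow> bool"
  where "qc_hom a \<alpha> b \<longleftrightarrow> (\<exists>p\<in>polys0. regular p a (dilate (sq ^ \<alpha>) b))"

definition quasi_commutative :: "'b fseries poly \<Rightarrow> 'b fseries poly \<Rightarrow> bool"
  where "quasi_commutative A B \<longleftrightarrow> (\<forall>\<alpha> \<beta>. qc_hom (coeff A \<alpha>) \<alpha> (coeff B \<beta>))"

text \<open>
  \<open>prod_hom r a \<alpha> b\<close> is the coefficient of $t^{\alpha+\beta+r}$ in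
  $(a(z)\otimes t^\alpha)_{-r-1}(b(z)\otimes t^\beta)$, for $r \ge 0$.  Setting $z_1 = z$ in
  a series in $L((z_1,z))$ sums, for every $n$, the finitely many nonzero coefficients of
  $z_1^{i} z^{n-i}$.  On pairs that are not quasi-commutative the value is unspecified.
\<close>

definition prod_hom :: "nat \<Rightarrow> 'b fseries \<Rightarrow> nat \<Rightarrow> 'b fseries \<Rightarrow> 'b fseries"
  where "prod_hom r a \<alpha> b =
    (let a' = (sqderiv ^^ r) a; b' = dilate (sq ^ (\<alpha> + r)) b;
         p = (SOME p. p \<in> polys0 \<and> regular p a' b')
     in (\<lambda>v n. fscale (inverse (sqfact r)) (Sum_any (\<lambda>i. reg p a' b' v i (n - i)))))"

text \<open>\<open>cprod A n B\<close> is $A_n B$.\<close>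

definition cprod :: "'b fseries poly \<Rightarrow> int \<Rightarrow> 'b fseries poly \<Rightarrow> 'b fseries poly"
  where "cprod A n B =
    (if 0 \<le> n then 0
     else let r = nat (- n - 1) in
       (\<Sum>\<alpha>\<le>degree A. \<Sum>\<beta>\<le>degree B.
          monom (prod_hom r (coeff A \<alpha>) \<alpha> (coeff B \<beta>)) (\<alpha> + \<beta> + r)))"

definition one_t :: "'b fseries poly"
  where "one_t = monom one_current 0"


section \<open>Graded nonlocal $\mathsf q$-vertex algebras\<close>

text \<open>\<open>prd a r b\<close> is $a_r b$, so that $Y(a,z_0)b = \sum_r (a_r b) z_0^{-r-1}$.\<close>

locale graded_nonlocal_qva = vector_space scale
  for scale :: "qfield \<Rightarrow> 'w::ab_group_add \<Rightarrow> 'w" +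
  fixes V :: "'w set"
    and gr :: "int \<Rightarrow> 'w set"
    and prd :: "'w \<Rightarrow> int \<Rightarrow> 'w \<Rightarrow> 'w"
    and vac :: 'w
  assumes subspace_V: "subspace V"
    and subspace_gr: "\<And>u. subspace (gr u)"
    and gr_subset: "\<And>u. gr u \<subseteq> V"
    and direct_sum: "\<And>a. a \<in> V \<Longrightarrow>
      \<exists>!f. finite {u. f u \<noteq> 0} \<and> (\<forall>u. f u \<in> gr u) \<and> a = Sum_any f"
    and prd_closed: "\<And>a b r. a \<in> V \<Longrightarrow> b \<in> V \<Longrightarrow> prd a r b \<in> V"
    and prd_add_left: "\<And>a a' b r. a \<in> V \<Longrightarrow> a' \<in> V \<Longrightarrow> b \<in> V \<Longrightarrow>
      prd (a + a') r b = prd a r b + prd a' r b"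
    and prd_scale_left: "\<And>k a b r. a \<in> V \<Longrightarrow> b \<in> V \<Longrightarrow>
      prd (scale k a) r b = scale k (prd a r b)"
    and prd_add_right: "\<And>a b b' r. a \<in> V \<Longrightarrow> b \<in> V \<Longrightarrow> b' \<in> V \<Longrightarrow>
      prd a r (b + b') = prd a r b + prd a r b'"
    and prd_scale_right: "\<And>k a b r. a \<in> V \<Longrightarrow> b \<in> V \<Longrightarrow>
      prd a r (scale k b) = scale k (prd a r b)"
    and vac_in: "vac \<in> V"
    and truncation: "\<And>a b. a \<in> V \<Longrightarrow> b \<in> V \<Longrightarrow> \<exists>R. \<forall>r\<ge>R. prd a r b = 0"
    and vacuum: "\<And>b r. b \<in> V \<Longrightarrow> prd vac r b = (if r = -1 then b else 0)"
    and creation: "\<And>a. a \<in> V \<Longrightarrow> prd a (-1) vac = a"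
    and creation_reg: "\<And>a r. a \<in> V \<Longrightarrow> 0 \<le> r \<Longrightarrow> prd a r vac = 0"
    and grading: "\<And>a b r s u. a \<in> gr u \<Longrightarrow> b \<in> gr s \<Longrightarrow> prd a r b \<in> gr (s + u - r - 1)"
    and associativity: "\<And>a b c r s u. a \<in> gr u \<Longrightarrow> b \<in> V \<Longrightarrow> c \<in> V \<Longrightarrow>
      prd (prd a r b) s c =
        Sum_any (\<lambda>l::nat.
          scale (sqbinom (int l - r - 1) l * sq powi ((s + int l + 1) * (r - u + 1)))
            (prd a (r - int l) (prd b (s + int l) c)))"

text \<open>
  $V_{(u)} = \{a(z) \otimes t^u \in V\}$, which is zero for negative $u$.
\<close>

definition tgrade :: "'b fseries poly set \<Rightarrow> int \<Rightarrow> 'b fseries poly set"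
  where "tgrade V u = {A \<in> V. \<forall>\<alpha>. coeff A \<alpha> \<noteq> 0 \<longrightarrow> int \<alpha> = u}"

definition is_qva_of_currents :: "'b fseries poly set \<Rightarrow> bool"
  where "is_qva_of_currents V \<longleftrightarrow>
    V \<subseteq> currents_t \<and> (\<forall>A\<in>V. \<forall>B\<in>V. quasi_commutative A B) \<and>
    graded_nonlocal_qva tscale V (tgrade V) cprod one_t"


section \<open>The Frenkel--Jing module\<close>

text \<open>
  $L_0 = M(1) \otimes \mathbb C\{Q\}$ has the basis of all $\prod_{r\ge1} a(-r)^{\mu_r} \otimes e^{k\alpha_1}$,
  indexed by \<open>(\<mu>, k)\<close>; the variable $a(-r)$ has index \<open>r - 1\<close> in \<open>\<mu>\<close>.  The multiplication of
  \<open>L0\<close> provided by \<open>Poly_Mapping\<close> is that of the algebra $M(1) \otimes \mathbb F[Q]$.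
\<close>

type_synonym L0_basis = "(nat \<Rightarrow>\<^sub>0 nat) \<times> int"
type_synonym L0 = "L0_basis \<Rightarrow>\<^sub>0 qfield"

text \<open>\<open>heis_neg r\<close> and \<open>heis_pos r\<close> are the actions of $a(-r)$ and $a(r)$, for $r \ge 1$.\<close>

definition heis_neg :: "nat \<Rightarrow> L0 \<Rightarrow> L0"
  where "heis_neg r v = Poly_Mapping.single (Poly_Mapping.single (r - 1) 1, 0) 1 * v"

definition heis_pos :: "nat \<Rightarrow> L0 \<Rightarrow> L0"
  where "heis_pos r = lin_ext (\<lambda>(\<mu>, k).
    Poly_Mapping.single (\<mu> - Poly_Mapping.single (r - 1) 1, k)
      (of_nat (Poly_Mapping.lookup \<mu> (r - 1)) * (qnum (2 * r) * qnum r / of_nat r)))"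

text \<open>
  \<open>heis_pos r\<close> is determined by its linearity and the next two facts: it kills $1 \otimes e^\beta$ and
  satisfies $[a(r), a(-s)] = \delta_{rs} [2r][r]/r$ (stated on basis vectors).
\<close>

lemma heis_pos_single:
  "heis_pos r (Poly_Mapping.single (\<mu>, k) c) =
    Poly_Mapping.single (\<mu> - Poly_Mapping.single (r - 1) 1, k)
      (c * (of_nat (Poly_Mapping.lookup \<mu> (r - 1)) * (qnum (2 * r) * qnum r / of_nat r)))"
  by (cases "c = 0") (auto simp: heis_pos_def lin_ext_def lookup_single when_def intro!: poly_mapping_eqI)

lemma heis_pos_vacuum: "heis_pos r (Poly_Mapping.single (0, k) c) = 0"
  by (simp add: heis_pos_single)

lemma heis_commutator:
  assumes "1 \<le> r" "1 \<le> s" and b_def: "b = Poly_Mapping.single (\<mu>, k) 1"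
  shows "heis_pos r (heis_neg s b) - heis_neg s (heis_pos r b) =
    (if r = s then fscale (qnum (2 * r) * qnum r / of_nat r) b else 0)"
proof (cases "r = s")
  case True
  have 1: "Poly_Mapping.single (r - 1) 1 + (\<mu> - Poly_Mapping.single (r - 1) 1) = \<mu>"
    if "Poly_Mapping.lookup \<mu> (r - 1) \<noteq> 0"
    using that by (intro poly_mapping_eqI) (auto simp: lookup_add lookup_minus lookup_single when_def)
  show ?thesis
    using 1 True
    by (cases "Poly_Mapping.lookup \<mu> (r - 1) = 0")
      (auto simp: b_def heis_neg_def heis_pos_single mult_single lookup_add lookup_minus
        lookup_single when_def algebra_simps add_divide_distrib intro!: poly_mapping_eqI)
next
  case False
  then have ne: "s - 1 \<noteq> r - 1"
    using assms(1,2) by linarith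
  have 1: "Poly_Mapping.single (s - 1) 1 + \<mu> - Poly_Mapping.single (r - 1) 1 =
      Poly_Mapping.single (s - 1) 1 + (\<mu> - Poly_Mapping.single (r - 1) 1)"
    using ne by (intro poly_mapping_eqI) (auto simp: lookup_add lookup_minus lookup_single when_def)
  show ?thesis
    using False ne unfolding b_def heis_neg_def
    by (simp add: heis_pos_single mult_single 1[simplified] lookup_add lookup_single when_def)
qed

text \<open>
  \<open>opexp A n\<close> is the coefficient of $w^n$ in $\exp(\sum_{r\ge1} A_r w^r)$, for operators $A_r$;
  \<open>opser_pow A k n\<close> is that in the \<open>k\<close>-th power of $\sum_{r\ge1} A_r w^r$.
\<close>

primrec opser_pow ::
  "(nat \<Rightarrow> ('b \<Rightarrow>\<^sub>0 qfield) \<Rightarrow> ('b \<Rightarrow>\<^sub>0 qfield)) \<Rightarrow> nat \<Rightarrow> nat \<Rightarrow> ('b \<Rightarrow>\<^sub>0 qfield) \<Rightarrow> ('b \<Rightarrow>\<^sub>0 qfield)"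
where
  "opser_pow A 0 n v = (if n = 0 then v else 0)"
| "opser_pow A (Suc k) n v = (\<Sum>r=1..n. A r (opser_pow A k (n - r) v))"

definition opexp ::
  "(nat \<Rightarrow> ('b \<Rightarrow>\<^sub>0 qfield) \<Rightarrow> ('b \<Rightarrow>\<^sub>0 qfield)) \<Rightarrow> nat \<Rightarrow> ('b \<Rightarrow>\<^sub>0 qfield) \<Rightarrow> ('b \<Rightarrow>\<^sub>0 qfield)"
  where "opexp A n v = (\<Sum>k\<le>n. fscale (inverse (of_nat (fact k))) (opser_pow A k n v))"

text \<open>$1 \otimes e^{\alpha_1} z^{\partial_{\alpha_1}}$; recall $(\alpha_1, k\alpha_1) = 2k$.\<close>

definition lattice_current :: "L0_basis fseries"
  where "lattice_current v n = lin_ext (\<lambda>(\<mu>, k).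
    if n = 2 * k then Poly_Mapping.single (\<mu>, k + 1) 1 else 0) v"

definition K_inv :: "L0 \<Rightarrow> L0"
  where "K_inv = lin_ext (\<lambda>(\<mu>, k). Poly_Mapping.single (\<mu>, k) (qq powi (- (2 * k))))"

text \<open>
  The coefficient of $z^n$ collects the terms $z^{i} z^{-j} z^{l}$ with $i = n + j - l \ge 0$ from
  the creation part, the annihilation part and \<open>lattice_current\<close>; only finitely many are nonzero
  on a given vector.
\<close>

definition xplus :: "L0_basis fseries"
  where "xplus v n = Sum_any (\<lambda>(j::nat, l::int).
    if 0 \<le> n + int j - l then
      opexp (\<lambda>r u. fscale (inverse (qh ^ r) / qnum r) (heis_neg r u)) (nat (n + int j - l))
        (opexp (\<lambda>r u. fscale (- (inverse (qh ^ r) / qnum r)) (heis_pos r u)) j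
          (lattice_current v l))
    else 0)"

definition phi :: "L0_basis fseries"
  where "phi v n =
    (if 0 \<le> n then
       K_inv (opexp (\<lambda>r u. fscale (- (qq - inverse qq)) (heis_neg r u)) (nat n) v)
     else 0)"


section \<open>The tensor power and the algebra generated by $x(z) \otimes t$\<close>

text \<open>
  The factors of the tensor power are indexed by a finite nonempty linear order \<open>'c\<close>, so
  $c$ is \<open>CARD('c)\<close>, and $L = (L_0)^{\otimes c}$ has the basis of all $\bigotimes_i b_i$, $b_i$ in the
  basis of $L_0$.  The factor in position $l \in \{1,\dots,c\}$ has \<open>rank\<close> $l - 1$.
\<close>

type_synonym 'c Lc_basis = "'c \<Rightarrow> L0_basis"

definition rank :: "'c::{finite,linorder} \<Rightarrow> nat"
  where "rank i = card {j. j < i}"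

text \<open>
  The matrix entry of $A_1(z) \otimes \cdots \otimes A_c(z)$ at basis tensors is the product in
  $\mathbb F((z))$ of the matrix entries of the factors.
\<close>

definition mat_entry :: "'b fseries \<Rightarrow> 'b \<Rightarrow> 'b \<Rightarrow> qfield fls"
  where "mat_entry a b' b = Abs_fls (\<lambda>n. Poly_Mapping.lookup (a (Poly_Mapping.single b 1) n) b')"

definition tensor_current :: "('c::finite \<Rightarrow> 'b fseries) \<Rightarrow> ('c \<Rightarrow> 'b) fseries"
  where "tensor_current A v n = lin_ext (\<lambda>b.
    Abs_poly_mapping (\<lambda>b'. fls_nth (\<Prod>i\<in>UNIV. mat_entry (A i) (b' i) (b i)) n)) v"

definition x_current :: "'c::{finite,linorder} Lc_basis fseries"
  where "x_current = (\<Sum>l\<in>UNIV. tensor_current (\<lambda>i.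
    if i < l then dilate (qh ^ (2 * rank i + 1)) phi
    else if i = l then dilate (qq ^ rank l) xplus
    else one_current))"

definition x_t :: "'c::{finite,linorder} Lc_basis fseries poly"
  where "x_t = monom x_current 1"

text \<open>$V_{c,1}$; the properties of \<open>is_qva_of_currents\<close> are preserved by nonempty intersections.\<close>

definition V_c1 :: "'c::{finite,linorder} Lc_basis fseries poly set"
  where "V_c1 = \<Inter>{V. is_qva_of_currents V \<and> x_t \<in> V}"

definition x_m :: "nat \<Rightarrow> 'c::{finite,linorder} Lc_basis fseries poly"
  where "x_m m = (cprod x_t (-1) ^^ m) one_t"

text \<open>The list \<open>[(m\<^sub>1, r\<^sub>1), \<dots>, (m\<^sub>k, r\<^sub>k)]\<close> encodes $x_{m_1}(z,t)_{r_1} \cdots x_{m_k}(z,t)_{r_k}\mathbf 1$.\<close>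

definition x_monomial :: "(nat \<times> int) list \<Rightarrow> 'c::{finite,linorder} Lc_basis fseries poly"
  where "x_monomial ms = foldr (\<lambda>(m, r). cprod (x_m m) r) ms one_t"

definition B_c1 :: "'c::{finite,linorder} Lc_basis fseries poly set"
  where "B_c1 = {x_monomial ms | ms.
    (\<forall>(m, r)\<in>set ms. 1 \<le> m \<and> m \<le> CARD('c)) \<and>
    (\<forall>(m, r)\<in>set (butlast ms). r \<le> -2) \<and>
    (ms \<noteq> [] \<longrightarrow> snd (last ms) \<le> -1)}"

end

theory Submission
  imports Defs
begin

text \<open>
  The space $L$ is an algebra (polynomials in the $a(-r)$ over a group algebra), and $x(z)$ is a sum of $c$ vertex operators
  $v \mapsto E(z) S_z(v)$, where $E(z)$ is the exponential of a linear form in the $a(-r)$ times an $e^\beta$,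
  and $S_z$ is an algebra homomorphism (the exponential of a derivation, composed with $z^\partial$ and $K$).
  As $S_z(E(w))$ is $E(w)$ times a power of $z$ and a rational function of $w/z$, the limits
  $X_a(z)$ of $x(z\mathsf q^{a_1}) \cdots x(z\mathsf q^{a_N})$, $a_1 < \dots < a_N$, exist.

  A monomial is a linear combination of $z^{-s} X_a(z)$ with $s$ fixed. The runs of consecutive numbers
  in the term $a$ of least sum have the lengths $m_j$, and the gaps between them and $s$ give the $r_j$.
  On the vacuum, $X_a(z)$ is a sum over labels $l_1, \dots, l_N \in \{1, \dots, c\}$ of multiples of
  exponentials which specialize to $\exp(\epsilon T z)$, $\epsilon = \sum_j l_j \mathsf q^{a_j}$. Now $\epsilon$
  determines $a$ and the labels, so the exponentials are independent, and the multiple is nonzero if the labels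
  decrease along every run, which is possible because $m_j \le c$.
\<close>

unbundle fps_syntax

abbreviation lookup :: "('b \<Rightarrow>\<^sub>0 'a::zero) \<Rightarrow> 'b \<Rightarrow> 'a"
  where "lookup \<equiv> Poly_Mapping.lookup"

abbreviation Fsingle :: "'b \<Rightarrow> qfield \<Rightarrow> ('b \<Rightarrow>\<^sub>0 qfield)"
  where "Fsingle \<equiv> Poly_Mapping.single"

section \<open>Ring homomorphisms as a predicate\<close>

definition ring_hom :: "('r::ring_1 \<Rightarrow> 's::ring_1) \<Rightarrow> bool"
  where "ring_hom f \<longleftrightarrow> f 1 = 1 \<and> (\<forall>x y. f (x + y) = f x + f y) \<and> (\<forall>x y. f (x * y) = f x * f y)"

lemma
  assumes "ring_hom f"
  shows ring_hom_1: "f 1 = 1" and ring_hom_add: "f (x + y) = f x + f y"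
    and ring_hom_mult: "f (x * y) = f x * f y" and ring_hom_0: "f 0 = 0"
proof -
  show 1: "f 1 = 1" "f (x + y) = f x + f y" "f (x * y) = f x * f y" for x y
    using assms by (auto simp: ring_hom_def)
  show "f 0 = 0"
    using 1(2)[of 0 0] by simp
qed

lemma ring_hom_sum:
  assumes "ring_hom f"
  shows "f (sum g A) = (\<Sum>i\<in>A. f (g i))"
  by (induction A rule: infinite_finite_induct) (simp_all add: ring_hom_0[OF assms] ring_hom_add[OF assms])

lemma ring_hom_prod:
  fixes f :: "'r::comm_ring_1 \<Rightarrow> 's::comm_ring_1"
  assumes "ring_hom f"
  shows "f (prod g A) = (\<Prod>i\<in>A. f (g i))"
  by (induction A rule: infinite_finite_induct) (simp_all add: ring_hom_1[OF assms] ring_hom_mult[OF assms])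

lemma ring_hom_of_nat: "ring_hom f \<Longrightarrow> f (of_nat n) = of_nat n"
  by (induction n) (simp_all add: ring_hom_0 ring_hom_1 ring_hom_add)

lemma ring_hom_power: "ring_hom f \<Longrightarrow> f (x ^ n) = f x ^ n"
  by (induction n) (simp_all add: ring_hom_1 ring_hom_mult)

lemma ring_hom_comp: "ring_hom f \<Longrightarrow> ring_hom g \<Longrightarrow> ring_hom (\<lambda>x. f (g x))"
  by (simp add: ring_hom_def)

lemma ring_hom_fls_const: "ring_hom (fls_const :: 'r::comm_ring_1 \<Rightarrow> 'r fls)"
  by (simp add: ring_hom_def fls_plus_const)

lemma ring_hom_fps_to_fls: "ring_hom (fps_to_fls :: 'r::comm_ring_1 fps \<Rightarrow> 'r fls)"
  by (simp add: ring_hom_def fls_times_fps_to_fls)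

lemma ring_hom_single: "ring_hom (Fsingle (0::'b::comm_monoid_add))"
  by (simp add: ring_hom_def single_add mult_single)

section \<open>Formal series\<close>

text \<open>Any lower bounds of the supports will do as summation limits. Hence the bounds of
  \<open>F\<close> and \<open>G\<close> still serve after their coefficients have been mapped, when
  the subdegrees may have grown.\<close>

lemma fls_times_nth_between:
  fixes f g :: "'a::comm_ring_1 fls"
  assumes f: "\<And>i. i < M \<Longrightarrow> f $$ i = 0" and g: "\<And>i. i < N \<Longrightarrow> g $$ i = 0"
  shows "(f * g) $$ n = (\<Sum>i=M..n - N. f $$ i * g $$ (n - i))"
proof -
  have fm: "f = fls_shift (- M) (fps_to_fls (Abs_fps (\<lambda>i. f $$ (int i + M))))"
    using f by (intro fls_eqI) auto
  have gm: "g = fls_shift (- N) (fps_to_fls (Abs_fps (\<lambda>i. g $$ (int i + N))))"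
    using g by (intro fls_eqI) auto
  have "(f * g) $$ n = (fps_to_fls (Abs_fps (\<lambda>i. f $$ (int i + M)) * Abs_fps (\<lambda>i. g $$ (int i + N)))) $$ (n - M - N)"
    by (subst fm, subst gm) (simp add: fls_shifted_times_simps fls_times_fps_to_fls algebra_simps)
  also have "\<dots> = (\<Sum>i=M..n - N. f $$ i * g $$ (n - i))"
  proof (cases "n - M - N < 0")
    case False
    then have "(\<Sum>i=M..n - N. f $$ i * g $$ (n - i)) =
        (\<Sum>i=0..nat (n - M - N). f $$ (int i + M) * g $$ (n - (int i + M)))"
      by (intro sum.reindex_bij_witness[of _ "\<lambda>i. int i + M" "\<lambda>i. nat (i - M)"]) auto
    with False show ?thesis
      by (auto simp: fps_mult_nth algebra_simps of_nat_diff intro!: sum.cong)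
  qed auto
  finally show ?thesis .
qed

text \<open>Taking for \<open>f\<close> an operator with values in Laurent series in $z_1$ produces
  nested series: applied to $b(z_2)v$ it gives $a(z_1)b(z_2)v$, with $z_2$ as the outer
  variable.\<close>

definition map_fls :: "('r::zero \<Rightarrow> 's::zero) \<Rightarrow> 'r fls \<Rightarrow> 's fls"
  where "map_fls f F = Abs_fls (\<lambda>n. f (F $$ n))"

lemma map_fls_nth: "f 0 = 0 \<Longrightarrow> map_fls f F $$ n = f (F $$ n)"
  unfolding map_fls_def by (rule nth_Abs_fls_lower_bound[of "fls_subdegree F"]) simp

lemma ring_hom_map_fls:
  fixes f :: "'r::comm_ring_1 \<Rightarrow> 's::comm_ring_1"
  assumes "ring_hom f"
  shows "ring_hom (map_fls f)"
proof -
  note f0 = ring_hom_0[OF assms]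
  have "map_fls f (F * G) = map_fls f F * map_fls f G" for F G
  proof (rule fls_eqI)
    fix n
    have "(map_fls f F * map_fls f G) $$ n = (\<Sum>i=fls_subdegree F..n - fls_subdegree G. f (F $$ i) * f (G $$ (n - i)))"
      by (subst fls_times_nth_between[of "fls_subdegree F" _ "fls_subdegree G"]) (auto simp: map_fls_nth f0)
    also have "\<dots> = f ((F * G) $$ n)"
      by (subst fls_times_nth_between[of "fls_subdegree F" F "fls_subdegree G"])
        (auto simp: ring_hom_sum[OF assms] ring_hom_mult[OF assms])
    finally show "map_fls f (F * G) $$ n = (map_fls f F * map_fls f G) $$ n"
      by (simp add: map_fls_nth f0)
  qed
  then show ?thesis
    using assms by (auto simp: ring_hom_def map_fls_nth f0 intro!: fls_eqI)
qed

definition map_fps :: "('r \<Rightarrow> 's) \<Rightarrow> 'r fps \<Rightarrow> 's fps"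
  where "map_fps f F = Abs_fps (\<lambda>n. f (F $ n))"

lemma map_fps_nth [simp]: "map_fps f F $ n = f (F $ n)"
  by (simp add: map_fps_def)

lemma map_fls_fps_to_fls: "f 0 = 0 \<Longrightarrow> map_fls f (fps_to_fls F) = fps_to_fls (map_fps f F)"
  by (rule fls_eqI) (simp add: map_fls_nth)

lemma ring_hom_map_fps:
  fixes f :: "'r::comm_ring_1 \<Rightarrow> 's::comm_ring_1"
  assumes "ring_hom f"
  shows "ring_hom (map_fps f)"
  using assms by (auto simp: ring_hom_def fps_eq_iff fps_mult_nth ring_hom_sum[OF assms] ring_hom_0[OF assms])

section \<open>Exponentials\<close>

text \<open>\<open>is_exp g E\<close> says that $E(z) = \exp(\sum_{r\ge1} g_r z^r)$, by means of the equation
  $z E' = (\sum_r r g_r z^r) E$.\<close>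

definition is_exp :: "(nat \<Rightarrow> 'r::comm_ring_1) \<Rightarrow> 'r fps \<Rightarrow> bool"
  where "is_exp g E \<longleftrightarrow> E $ 0 = 1 \<and> fps_X * fps_deriv E = Abs_fps (\<lambda>r. of_nat r * g r) * E"

text \<open>Comparison of coefficients. The recursion on the right is also the one that
  \<open>opexp\<close> satisfies.\<close>

lemma is_exp_iff:
  "is_exp g E \<longleftrightarrow> E $ 0 = 1 \<and> (\<forall>n. of_nat n * E $ n = (\<Sum>r=1..n. of_nat r * g r * E $ (n - r)))"
proof -
  have *: "(fps_X * fps_deriv E) $ n = of_nat n * E $ n" for n
    by (cases n) simp_all
  have **: "(Abs_fps (\<lambda>r. of_nat r * g r) * E) $ n = (\<Sum>r=1..n. of_nat r * g r * E $ (n - r))" for n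
  proof -
    have "{0..n} = insert 0 {1..n}" by auto
    then show ?thesis by (simp add: fps_mult_nth)
  qed
  show ?thesis
    unfolding is_exp_def by (simp only: fps_eq_iff * **)
qed

lemma is_exp_0: "is_exp (\<lambda>_. 0) 1"
  by (simp add: is_exp_def fps_eq_iff fps_mult_nth)

lemma is_exp_mult:
  assumes "is_exp g E" "is_exp h F"
  shows "is_exp (\<lambda>r. g r + h r) (E * F)"
proof -
  have "Abs_fps (\<lambda>r. of_nat r * (g r + h r)) = Abs_fps (\<lambda>r. of_nat r * g r) + Abs_fps (\<lambda>r. of_nat r * h r)"
    by (simp add: fps_eq_iff algebra_simps)
  then show ?thesis
    using assms by (simp add: is_exp_def algebra_simps)
qed

lemma is_exp_prod:
  assumes "finite A" "\<And>i. i \<in> A \<Longrightarrow> is_exp (g i) (E i)"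
  shows "is_exp (\<lambda>r. \<Sum>i\<in>A. g i r) (\<Prod>i\<in>A. E i)"
  using assms by (induction A) (auto simp: is_exp_0 intro: is_exp_mult)

text \<open>The recursion determines $n E_n$ from the earlier coefficients. The coefficient rings
  used later are not fields, so invertibility of the positive integers is a hypothesis.\<close>

lemma is_exp_unique:
  fixes E F :: "'r::comm_ring_1 fps"
  assumes inv: "\<And>n::nat. 0 < n \<Longrightarrow> \<exists>y::'r. y * of_nat n = 1"
    and E: "is_exp g E" and F: "is_exp g F"
  shows "E = F"
proof (rule fps_ext)
  fix n
  show "E $ n = F $ n"
  proof (induction n rule: less_induct)
    case (less n)
    show ?case
    proof (cases "n = 0")
      case False
      then obtain y :: 'r where y: "y * of_nat n = 1" using inv by blast
      have "of_nat n * E $ n = of_nat n * F $ n"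
        using E F less by (auto simp: is_exp_iff intro!: sum.cong)
      then have "y * of_nat n * E $ n = y * of_nat n * F $ n"
        by (simp add: mult.assoc)
      then show ?thesis by (simp add: y)
    qed (use E F in \<open>simp add: is_exp_iff\<close>)
  qed
qed

lemma is_exp_hom:
  assumes "ring_hom f" "is_exp g E"
  shows "is_exp (\<lambda>r. f (g r)) (map_fps f E)"
  unfolding is_exp_iff
proof safe
  show "map_fps f E $ 0 = 1"
    using assms by (simp add: is_exp_iff ring_hom_1)
  fix n
  have "of_nat n * f (E $ n) = f (of_nat n * E $ n)"
    by (simp add: ring_hom_mult[OF assms(1)] ring_hom_of_nat[OF assms(1)])
  also have "\<dots> = f (\<Sum>r=1..n. of_nat r * g r * E $ (n - r))"
    using assms(2) unfolding is_exp_iff by metis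
  also have "\<dots> = (\<Sum>r=1..n. of_nat r * f (g r) * f (E $ (n - r)))"
    by (simp add: ring_hom_sum[OF assms(1)] ring_hom_mult[OF assms(1)] ring_hom_of_nat[OF assms(1)])
  finally show "of_nat n * map_fps f E $ n = (\<Sum>r=1..n. of_nat r * f (g r) * map_fps f E $ (n - r))"
    by simp
qed

text \<open>Substitution of $kz$ for $z$. The scalar \<open>k\<close> may be any ring element; $k =
  z_1^{-1}$ later turns a series in $z_2$ into one in $z_2/z_1$.\<close>

lemma is_exp_dilate:
  assumes "is_exp g E"
  shows "is_exp (\<lambda>r. k ^ r * g r) (Abs_fps (\<lambda>n. k ^ n * E $ n))"
  unfolding is_exp_iff
proof safe
  show "Abs_fps (\<lambda>n. k ^ n * E $ n) $ 0 = 1"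
    using assms by (simp add: is_exp_iff)
  fix n
  have "of_nat n * (k ^ n * E $ n) = k ^ n * (of_nat n * E $ n)"
    by (simp add: ac_simps)
  also have "\<dots> = k ^ n * (\<Sum>r=1..n. of_nat r * g r * E $ (n - r))"
    using assms unfolding is_exp_iff by metis
  also have "\<dots> = (\<Sum>r=1..n. of_nat r * (k ^ r * g r) * (k ^ (n - r) * E $ (n - r)))"
    unfolding sum_distrib_left
  proof (rule sum.cong[OF refl])
    fix r assume "r \<in> {1..n}"
    then have "k ^ n = k ^ r * k ^ (n - r)"
      by (simp flip: power_add)
    then show "k ^ n * (of_nat r * g r * E $ (n - r)) = of_nat r * (k ^ r * g r) * (k ^ (n - r) * E $ (n - r))"
      by (simp add: ac_simps)
  qed
  finally show "of_nat n * Abs_fps (\<lambda>n. k ^ n * E $ n) $ n =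
      (\<Sum>r=1..n. of_nat r * (k ^ r * g r) * Abs_fps (\<lambda>n. k ^ n * E $ n) $ (n - r))"
    by simp
qed

section \<open>Two variables\<close>

text \<open>$c z_1^a z_2^b$; the outer variable is $z_2$.\<close>

definition mono2 :: "'r::comm_ring_1 \<Rightarrow> int \<Rightarrow> int \<Rightarrow> 'r fls fls"
  where "mono2 c a b = fls_shift (- b) (fls_const (fls_shift (- a) (fls_const c)))"

definition mono1 :: "'r::comm_ring_1 \<Rightarrow> int \<Rightarrow> 'r fls"
  where "mono1 c a = fls_shift (- a) (fls_const c)"

lemma mono1_nth: "mono1 c a $$ n = (if n = a then c else 0)"
  by (simp add: mono1_def)

lemma mono1_mult: "mono1 c a * mono1 c' a' = mono1 (c * c') (a + a')"
  by (simp add: mono1_def fls_shifted_times_simps algebra_simps)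

lemma times_mono1_nth: "(F * mono1 c a) $$ n = F $$ (n - a) * c"
  by (simp add: mono1_def fls_shifted_times_simps)

lemma mono1_times_nth: "(mono1 c a * F) $$ n = c * F $$ (n - a)"
  by (simp add: mono1_def fls_shifted_times_simps)

lemma mono2_nth: "mono2 c a b $$ n2 $$ n1 = (if n1 = a \<and> n2 = b then c else 0)"
  by (simp add: mono2_def)

lemma times_mono2_nth: "(F * mono2 c a b) $$ n2 $$ n1 = F $$ (n2 - b) $$ (n1 - a) * c"
  by (simp add: mono2_def fls_shifted_times_simps)

lemma mono2_mult: "mono2 c a b * mono2 c' a' b' = mono2 (c * c') (a + a') (b + b')"
  by (intro fls_eqI) (simp add: times_mono2_nth mono2_nth)

lemma mono1_1: "mono1 1 0 = 1"
  by (intro fls_eqI) (simp add: mono1_nth)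

text \<open>Laurent polynomials in $z_1, z_2$ and their restriction to the diagonal.\<close>

inductive lpoly2 :: "'r::comm_ring_1 fls fls \<Rightarrow> 'r fls \<Rightarrow> bool" where
  lpoly2_zero: "lpoly2 0 0"
| lpoly2_mono: "lpoly2 (mono2 c a b) (mono1 c (a + b))"
| lpoly2_add: "lpoly2 F f \<Longrightarrow> lpoly2 G g \<Longrightarrow> lpoly2 (F + G) (f + g)"

lemma lpoly2_mult:
  assumes "lpoly2 F f" "lpoly2 G g"
  shows "lpoly2 (F * G) (f * g)"
  using assms(2)
proof (induction G g)
  case (lpoly2_mono c a b)
  from assms(1) show ?case
  proof (induction F f)
    case (lpoly2_mono c' a' b')
    have "mono1 c' (a' + b') * mono1 c (a + b) = mono1 (c' * c) ((a' + a) + (b' + b))"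
      by (simp add: mono1_mult ac_simps)
    then show ?case
      by (simp only: mono2_mult lpoly2.lpoly2_mono)
  qed (auto simp: algebra_simps intro: lpoly2.intros)
qed (auto simp: algebra_simps intro: lpoly2.intros)

lemma lpoly2_sum:
  assumes "finite A" "\<And>i. i \<in> A \<Longrightarrow> lpoly2 (F i) (f i)"
  shows "lpoly2 (sum F A) (sum f A)"
  using assms by (induction A) (auto intro: lpoly2.intros)

lemma lpoly2_monoI: "F = mono2 c a b \<Longrightarrow> f = mono1 c (a + b) \<Longrightarrow> lpoly2 F f"
  by (simp add: lpoly2_mono)

text \<open>Expresses that \<open>F\<close> lies in $L((z_1,z_2))$ and that setting $z_1 = z_2$
  gives \<open>f\<close>. In the nested ring the exponents of $z_1$ need not have a common lower
  bound, so the first conjunct is a real restriction.\<close>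

definition diag :: "'r::comm_ring_1 fls fls \<Rightarrow> 'r fls \<Rightarrow> bool"
  where "diag F f \<longleftrightarrow> (\<exists>N. \<forall>n1 n2. n1 < N \<or> n2 < N \<longrightarrow> F $$ n2 $$ n1 = 0) \<and>
    (\<forall>n. Sum_any (\<lambda>i. F $$ (n - i) $$ i) = f $$ n)"

lemma finite_diag:
  fixes f :: "int \<Rightarrow> int \<Rightarrow> 'a::zero"
  assumes "\<And>n1 n2. n1 < N \<or> n2 < N \<Longrightarrow> f n1 n2 = 0"
  shows "finite {i. f i (n - i) \<noteq> 0}"
proof (rule finite_subset)
  show "{i. f i (n - i) \<noteq> 0} \<subseteq> {N..n - N}"
    using assms by (auto simp: not_less[symmetric])
qed simp

lemma diag_zero: "diag 0 0"
  by (simp add: diag_def)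

lemma diag_add:
  assumes "diag F f" "diag G g"
  shows "diag (F + G) (f + g)"
proof -
  obtain N where N: "\<And>n1 n2. n1 < N \<or> n2 < N \<Longrightarrow> F $$ n2 $$ n1 = 0"
    using assms(1) unfolding diag_def by blast
  obtain M where M: "\<And>n1 n2. n1 < M \<or> n2 < M \<Longrightarrow> G $$ n2 $$ n1 = 0"
    using assms(2) unfolding diag_def by blast
  have "(F + G) $$ n2 $$ n1 = 0" if "n1 < min N M \<or> n2 < min N M" for n1 n2
    using that N M by auto
  moreover have "Sum_any (\<lambda>i. (F + G) $$ (n - i) $$ i) = (f + g) $$ n" for n
    using Sum_any.distrib[OF finite_diag[of N "\<lambda>n1 n2. F $$ n2 $$ n1", OF N]
        finite_diag[of M "\<lambda>n1 n2. G $$ n2 $$ n1", OF M]] assms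
    by (simp add: diag_def)
  ultimately show ?thesis
    unfolding diag_def by blast
qed

lemma Sum_any_shift: "Sum_any (\<lambda>i::int. f (i - a)) = Sum_any f"
proof -
  have "bij (\<lambda>i::int. i - a)"
    by (rule o_bij[of "\<lambda>i. i + a"]) (auto simp: fun_eq_iff)
  then show ?thesis
    using Sum_any.reindex_cong[of "\<lambda>i. i - a" f "\<lambda>i. f (i - a)"] by (simp add: comp_def)
qed

lemma diag_times_mono2:
  assumes "diag F f"
  shows "diag (F * mono2 c a b) (f * mono1 c (a + b))"
proof -
  obtain N where N: "\<And>n1 n2. n1 < N \<or> n2 < N \<Longrightarrow> F $$ n2 $$ n1 = 0"
    using assms(1) unfolding diag_def by blast
  have "(F * mono2 c a b) $$ n2 $$ n1 = 0" if "n1 < N - \<bar>a\<bar> - \<bar>b\<bar> \<or> n2 < N - \<bar>a\<bar> - \<bar>b\<bar>" for n1 n2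
  proof -
    have "n1 - a < N \<or> n2 - b < N" using that by linarith
    then show ?thesis using N[of "n1 - a" "n2 - b"] by (simp add: times_mono2_nth)
  qed
  moreover have "Sum_any (\<lambda>i. (F * mono2 c a b) $$ (n - i) $$ i) = (f * mono1 c (a + b)) $$ n" for n
  proof -
    have "Sum_any (\<lambda>i. (F * mono2 c a b) $$ (n - i) $$ i) = Sum_any (\<lambda>i. F $$ ((n - a - b) - (i - a)) $$ (i - a) * c)"
      by (simp add: times_mono2_nth algebra_simps)
    also have "\<dots> = Sum_any (\<lambda>i. F $$ ((n - a - b) - i) $$ i * c)"
      by (rule Sum_any_shift)
    also have "\<dots> = Sum_any (\<lambda>i. F $$ ((n - a - b) - i) $$ i) * c"
      by (rule Sum_any_left_distrib[symmetric, OF finite_diag[of N "\<lambda>n1 n2. F $$ n2 $$ n1", OF N]])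
    also have "Sum_any (\<lambda>i. F $$ ((n - a - b) - i) $$ i) = f $$ (n - a - b)"
      using assms unfolding diag_def by blast
    finally show ?thesis
      by (simp add: times_mono1_nth diff_diff_eq)
  qed
  ultimately show ?thesis
    unfolding diag_def by blast
qed

text \<open>By linearity from monomials, which merely translate the support and the
  antidiagonals.\<close>

lemma diag_times_lpoly2:
  assumes "diag F f" "lpoly2 G g"
  shows "diag (F * G) (f * g)"
  using assms(2,1)
  by (induction G g) (auto simp: distrib_left diag_zero intro: diag_add diag_times_mono2)

text \<open>The product $A(z_1)B(z_2)$ of power series has nonnegative exponents, and its
  antidiagonal sums are those of the Cauchy product.\<close>

lemma diag_fps:
  "diag (fls_const (fps_to_fls A) * fps_to_fls (map_fps fls_const B)) (fps_to_fls (A * B))"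
proof -
  have nth: "(fls_const (fps_to_fls A) * fps_to_fls (map_fps fls_const B)) $$ n2 $$ n1 =
      (if 0 \<le> n1 \<and> 0 \<le> n2 then A $ nat n1 * B $ nat n2 else 0)" for n1 n2
    by (simp add: fls_mult_const_nth)
  have "Sum_any (\<lambda>i. (fls_const (fps_to_fls A) * fps_to_fls (map_fps fls_const B)) $$ (n - i) $$ i)
      = fps_to_fls (A * B) $$ n" for n
  proof -
    have "Sum_any (\<lambda>i. if 0 \<le> i \<and> 0 \<le> n - i then A $ nat i * B $ nat (n - i) else 0) =
        (\<Sum>i\<in>{0..n}. if 0 \<le> i \<and> 0 \<le> n - i then A $ nat i * B $ nat (n - i) else 0)"
      by (rule Sum_any.expand_superset) auto
    also have "\<dots> = (\<Sum>i\<in>{0..n}. A $ nat i * B $ nat (n - i))"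
      by (intro sum.cong) auto
    also have "\<dots> = fps_to_fls (A * B) $$ n"
    proof (cases "n < 0")
      case False
      have "(\<Sum>i\<in>{0..n}. A $ nat i * B $ nat (n - i)) = (\<Sum>i=0..nat n. A $ i * B $ (nat n - i))"
        using False
        by (intro sum.reindex_bij_witness[of _ int nat]) (auto simp: nat_diff_distrib)
      then show ?thesis using False by (simp add: fps_mult_nth)
    qed simp
    finally show ?thesis by (simp only: nth)
  qed
  moreover have "\<exists>N. \<forall>n1 n2. n1 < N \<or> n2 < N \<longrightarrow>
      (fls_const (fps_to_fls A) * fps_to_fls (map_fps fls_const B)) $$ n2 $$ n1 = 0"
    by (rule exI[of _ 0]) (auto simp: nth)
  ultimately show ?thesis
    unfolding diag_def by blast
qed

section \<open>Algebra homomorphisms\<close>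

text \<open>The $\mathbb F$-algebra structure of the target is the ring homomorphism \<open>c\<close>.\<close>

definition alg_hom :: "(qfield \<Rightarrow> 'r) \<Rightarrow> (('b::comm_monoid_add \<Rightarrow>\<^sub>0 qfield) \<Rightarrow> 'r::comm_ring_1) \<Rightarrow> bool"
  where "alg_hom c h \<longleftrightarrow> ring_hom h \<and> (\<forall>k. h (Fsingle 0 k) = c k)"

lemma alg_hom_ring_hom: "alg_hom c h \<Longrightarrow> ring_hom h"
  by (simp add: alg_hom_def)

lemma alg_hom_scalar: "alg_hom c h \<Longrightarrow> h (Fsingle 0 k) = c k"
  by (simp add: alg_hom_def)

lemma fscale_eq_mult: "fscale k v = Fsingle 0 k * v"
  by (simp add: fscale_def mult_map_scale_conv_mult)

lemma fscale_mult_fscale: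
  fixes u v :: "'b::comm_monoid_add \<Rightarrow>\<^sub>0 qfield"
  shows "fscale k u * fscale l v = fscale (k * l) (u * v)"
proof -
  have "Fsingle 0 (k * l) = (Fsingle 0 k * Fsingle 0 l :: 'b \<Rightarrow>\<^sub>0 qfield)"
    by (simp add: mult_single)
  then show ?thesis
    by (simp add: fscale_eq_mult ac_simps)
qed

lemma fscale_Fsingle [simp]: "fscale k (Fsingle b x) = Fsingle b (k * x)"
  by (rule poly_mapping_eqI) (simp add: lookup_single when_def)

lemma alg_hom_fscale: "alg_hom c h \<Longrightarrow> h (fscale k v) = c k * h v"
  by (simp add: fscale_eq_mult ring_hom_mult[OF alg_hom_ring_hom] alg_hom_scalar)

lemma sum_single_superset:
  fixes v :: "'b \<Rightarrow>\<^sub>0 'a::comm_monoid_add"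
  assumes "finite A" "Poly_Mapping.keys v \<subseteq> A"
  shows "v = (\<Sum>b\<in>A. Poly_Mapping.single b (lookup v b))"
proof (rule poly_mapping_eqI)
  fix k
  have "(\<Sum>b\<in>A. lookup v b when b = k) = (lookup v k when k \<in> A)"
    using assms(1) by (simp add: when_def)
  also have "\<dots> = lookup v k"
    using assms(2) by (auto simp: when_def in_keys_iff)
  finally show "lookup v k = lookup (\<Sum>b\<in>A. Poly_Mapping.single b (lookup v b)) k"
    by (simp add: lookup_sum lookup_single)
qed

lemma single_induct [case_names single add]:
  fixes P :: "('b \<Rightarrow>\<^sub>0 'a::comm_monoid_add) \<Rightarrow> bool"
  assumes "\<And>b k. P (Poly_Mapping.single b k)" "\<And>u v. P u \<Longrightarrow> P v \<Longrightarrow> P (u + v)"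
  shows "P v"
proof -
  have "P (\<Sum>b\<in>A. Poly_Mapping.single b (f b))" if "finite A" for A f
    \<comment> \<open>The case of zero is the single term with coefficient 0 at an arbitrary
      index.\<close>
    using that by (induction A) (use assms(1)[of undefined 0] in \<open>auto simp: assms\<close>)
  then show ?thesis
    by (subst sum_single_superset[OF finite_keys order_refl, of v]) simp
qed

definition hom_ext :: "(qfield \<Rightarrow> 'r::comm_ring_1) \<Rightarrow> ('b \<Rightarrow> 'r) \<Rightarrow> ('b \<Rightarrow>\<^sub>0 qfield) \<Rightarrow> 'r"
  where "hom_ext c m v = (\<Sum>b\<in>Poly_Mapping.keys v. c (lookup v b) * m b)"

lemma hom_ext_superset:
  assumes "ring_hom c" "finite A" "Poly_Mapping.keys v \<subseteq> A"
  shows "hom_ext c m v = (\<Sum>b\<in>A. c (lookup v b) * m b)"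
  unfolding hom_ext_def
  by (rule sum.mono_neutral_left) (use assms in \<open>auto simp: in_keys_iff ring_hom_0\<close>)

lemma hom_ext_single: "ring_hom c \<Longrightarrow> hom_ext c m (Fsingle b k) = c k * m b"
  by (simp add: hom_ext_def ring_hom_0)

lemma hom_ext_add:
  assumes "ring_hom c"
  shows "hom_ext c m (u + v) = hom_ext c m u + hom_ext c m v"
proof -
  let ?A = "Poly_Mapping.keys u \<union> Poly_Mapping.keys v"
  have "hom_ext c m w = (\<Sum>b\<in>?A. c (lookup w b) * m b)"
    if "Poly_Mapping.keys w \<subseteq> ?A" for w
    using that by (intro hom_ext_superset assms) auto
  note * = this
  show ?thesis
    using keys_add[of u v]
    by (simp add: * lookup_add ring_hom_add[OF assms] distrib_right sum.distrib)
qed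

text \<open>Universal property of the monoid algebra: the product of finitely supported functions is
  convolution, so multiplicativity on basis elements suffices.\<close>

lemma alg_hom_hom_ext:
  assumes c: "ring_hom c" and m0: "m 0 = 1" and madd: "\<And>a b. m (a + b) = m a * m b"
  shows "alg_hom c (hom_ext c m)"
proof -
  have "hom_ext c m (u * v) = hom_ext c m u * hom_ext c m v" for u v
  proof (induction u rule: single_induct)
    case (single b k)
    show ?case
      by (induction v rule: single_induct)
        (simp_all add: mult_single hom_ext_single[OF c] hom_ext_add[OF c] madd ring_hom_mult[OF c] algebra_simps)
  qed (simp add: hom_ext_add[OF c] algebra_simps)
  moreover have "hom_ext c m (Fsingle 0 k) = c k" for k
    by (simp add: hom_ext_single[OF c] m0)
  ultimately show ?thesis
    using c by (auto simp: alg_hom_def ring_hom_def hom_ext_add simp flip: single_one)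
qed

section \<open>Dilation of Laurent series\<close>

definition fls_dilate :: "qfield \<Rightarrow> ('b \<Rightarrow>\<^sub>0 qfield) fls \<Rightarrow> ('b \<Rightarrow>\<^sub>0 qfield) fls"
  where "fls_dilate k F = Abs_fls (\<lambda>n. fscale (k powi n) (F $$ n))"

lemma fls_dilate_nth [simp]: "fls_dilate k F $$ n = fscale (k powi n) (F $$ n)"
  unfolding fls_dilate_def by (rule nth_Abs_fls_lower_bound[of "fls_subdegree F"]) simp

lemma ring_hom_fls_dilate:
  assumes "k \<noteq> 0"
  shows "ring_hom (fls_dilate k :: ('b::comm_monoid_add \<Rightarrow>\<^sub>0 qfield) fls \<Rightarrow> _)"
proof -
  have "fls_dilate k (F * G) = fls_dilate k F * fls_dilate k G" for F G :: "('b \<Rightarrow>\<^sub>0 qfield) fls"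
  proof (rule fls_eqI)
    fix n
    have "(fls_dilate k F * fls_dilate k G) $$ n =
        (\<Sum>i=fls_subdegree F..n - fls_subdegree G. fscale (k powi i) (F $$ i) * fscale (k powi (n - i)) (G $$ (n - i)))"
      by (subst fls_times_nth_between[of "fls_subdegree F" _ "fls_subdegree G"]) auto
    also have "\<dots> = (\<Sum>i=fls_subdegree F..n - fls_subdegree G. fscale (k powi n) (F $$ i * G $$ (n - i)))"
    proof (rule sum.cong[OF refl])
      fix i
      have "k powi n = k powi i * k powi (n - i)"
        using assms by (simp flip: power_int_add)
      then show "fscale (k powi i) (F $$ i) * fscale (k powi (n - i)) (G $$ (n - i)) =
          fscale (k powi n) (F $$ i * G $$ (n - i))"
        by (simp add: fscale_mult_fscale)
    qed
    also have "\<dots> = fscale (k powi n) ((F * G) $$ n)"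
      by (subst fls_times_nth_between[of "fls_subdegree F" F "fls_subdegree G"])
        (auto simp: fscale_eq_mult sum_distrib_left)
    finally show "fls_dilate k (F * G) $$ n = (fls_dilate k F * fls_dilate k G) $$ n"
      by simp
  qed
  moreover have "fls_dilate k (F + G) = fls_dilate k F + fls_dilate k G" for F G :: "('b \<Rightarrow>\<^sub>0 qfield) fls"
    by (rule fls_eqI) (simp add: fvec.scale_right_distrib)
  moreover have "fls_dilate k 1 = (1 :: ('b \<Rightarrow>\<^sub>0 qfield) fls)"
    by (rule fls_eqI) (simp add: fls_one_nth)
  ultimately show ?thesis
    by (simp add: ring_hom_def)
qed

lemma fls_dilate_mono1: "fls_dilate k (mono1 c n) = mono1 (fscale (k powi n) c) n"
  by (rule fls_eqI) (simp add: mono1_nth)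

section \<open>The quantum parameter\<close>

text \<open>Characteristic zero makes the positive integers invertible in the ground field, as the
  exponentials require.\<close>

instance fract :: ("{idom,ring_char_0}") field_char_0
proof
  have "of_nat n = to_fract (of_nat n :: 'a)" for n
    by (induction n) simp_all
  then show "inj (of_nat :: nat \<Rightarrow> 'a fract)"
    by (simp add: inj_def)
qed

lemma qh_eq: "qh = to_fract [:0, 1:]"
  by (simp add: qh_def to_fract_def)

lemma qh_power: "qh ^ n = to_fract (monom 1 n)"
proof -
  have "to_fract p ^ n = to_fract (p ^ n)" for p :: "complex poly"
    by (induction n) simp_all
  then show ?thesis
    by (simp add: qh_eq monom_altdef)
qed

lemma qh_nonzero [simp]: "qh \<noteq> 0"
  by (simp add: qh_eq)

lemma qq_nonzero [simp]: "qq \<noteq> 0"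
  by (simp add: qq_def)

lemma sq_nonzero [simp]: "sq \<noteq> 0"
  by (simp add: sq_def)

lemma sq_power: "sq ^ n = to_fract (monom 1 (4 * n))"
  using qh_power[of "4 * n"] by (simp add: sq_def qq_def flip: power_mult)

lemma sq_power_neq_1: "0 < n \<Longrightarrow> sq ^ n \<noteq> 1"
proof -
  assume n: "0 < n"
  have "to_fract (monom 1 (4 * n)) \<noteq> to_fract (1 :: complex poly)"
    using n by (simp only: to_fract_eq_iff) (metis degree_1 degree_monom_eq mult_eq_0_iff neq0_conv one_neq_zero zero_neq_numeral)
  then show ?thesis by (simp add: sq_power)
qed

lemma sq_neq_1 [simp]: "sq \<noteq> 1"
  using sq_power_neq_1[of 1] by simp

section \<open>Exponentials of operators\<close>

lemma opser_pow_eq_0: "n < k \<Longrightarrow> (\<And>r. A r 0 = 0) \<Longrightarrow> opser_pow A k n v = 0"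
  by (induction k arbitrary: n) (auto intro!: sum.neutral)

lemma opser_pow_zero: "(\<And>r. A r 0 = 0) \<Longrightarrow> opser_pow A k n 0 = 0"
  by (induction k arbitrary: n) auto

lemma opexp_zero: "(\<And>r. A r 0 = 0) \<Longrightarrow> opexp A n 0 = 0"
  by (simp add: opexp_def opser_pow_zero)

lemma opexp_0: "opexp A 0 v = v"
  by (simp add: opexp_def)

lemma sum_triangle_swap:
  fixes f :: "nat \<Rightarrow> nat \<Rightarrow> 'a::comm_monoid_add"
  shows "(\<Sum>r=1..n. \<Sum>s=1..n - r. f r s) = (\<Sum>s=1..n. \<Sum>r=1..n - s. f r s)"
  by (subst (1 2) sum.Sigma; simp)
    (rule sum.reindex_bij_witness[of _ prod.swap prod.swap]; auto)

context
  fixes A :: "nat \<Rightarrow> ('b \<Rightarrow>\<^sub>0 qfield) \<Rightarrow> ('b \<Rightarrow>\<^sub>0 qfield)"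
  assumes add: "\<And>r u v. A r (u + v) = A r u + A r v"
    and scale: "\<And>r k u. A r (fscale k u) = fscale k (A r u)"
    and comm: "\<And>r s u. 1 \<le> r \<Longrightarrow> 1 \<le> s \<Longrightarrow> A r (A s u) = A s (A r u)"
begin

lemma opser_A0: "A r 0 = 0"
  using scale[of r 0 0] by simp

lemma opser_Asum: "A r (sum f I) = (\<Sum>i\<in>I. A r (f i))"
  by (induction I rule: infinite_finite_induct) (simp_all add: opser_A0 add)

lemma opser_pow_rec:
  "fscale (of_nat n) (opser_pow A (Suc k) n v) =
    fscale (of_nat (Suc k)) (\<Sum>r=1..n. fscale (of_nat r) (A r (opser_pow A k (n - r) v)))"
proof (induction k arbitrary: n)
  case 0
  have "fscale (of_nat n) (A r (if n - r = 0 then v else 0)) = fscale (of_nat r) (A r (if n - r = 0 then v else 0))"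
    if "r \<in> {1..n}" for r
    using that by (cases "r = n") (auto simp: opser_A0)
  then have "(\<Sum>r=1..n. fscale (of_nat n) (A r (if n - r = 0 then v else 0))) =
      (\<Sum>r=1..n. fscale (of_nat r) (A r (if n - r = 0 then v else 0)))"
    by (rule sum.cong[OF refl])
  then show ?case
    by (simp add: fvec.scale_sum_right)
next
  case (Suc k)
  let ?P = "\<lambda>k n. opser_pow A k n v"
  have "fscale (of_nat n) (?P (Suc (Suc k)) n) = (\<Sum>r=1..n. fscale (of_nat n) (A r (?P (Suc k) (n - r))))"
    by (simp only: opser_pow.simps fvec.scale_sum_right)
  \<comment> \<open>The Leibniz rule: $n = r + (n-r)$ distributes the degree over the two
    factors.\<close>
  also have "\<dots> = (\<Sum>r=1..n. fscale (of_nat r) (A r (?P (Suc k) (n - r)))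
      + A r (fscale (of_nat (n - r)) (?P (Suc k) (n - r))))"
    by (intro sum.cong) (auto simp: scale of_nat_diff simp flip: fvec.scale_left_distrib)
  also have "\<dots> = (\<Sum>r=1..n. fscale (of_nat r) (A r (?P (Suc k) (n - r))))
      + (\<Sum>r=1..n. A r (fscale (of_nat (Suc k)) (\<Sum>s=1..n - r. fscale (of_nat s) (A s (?P k (n - r - s))))))"
    by (simp only: Suc.IH sum.distrib)
  also have "(\<Sum>r=1..n. A r (fscale (of_nat (Suc k)) (\<Sum>s=1..n - r. fscale (of_nat s) (A s (?P k (n - r - s)))))) =
      fscale (of_nat (Suc k)) (\<Sum>r=1..n. \<Sum>s=1..n - r. fscale (of_nat s) (A r (A s (?P k (n - r - s)))))"
    by (simp only: scale opser_Asum fvec.scale_sum_right)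
  also have "(\<Sum>r=1..n. \<Sum>s=1..n - r. fscale (of_nat s) (A r (A s (?P k (n - r - s))))) =
      (\<Sum>s=1..n. \<Sum>r=1..n - s. fscale (of_nat s) (A r (A s (?P k (n - r - s)))))"
    by (rule sum_triangle_swap)
  \<comment> \<open>Here commutativity enters: the differentiated factor moves to the front.\<close>
  also have "\<dots> = (\<Sum>s=1..n. fscale (of_nat s) (A s (\<Sum>r=1..n - s. A r (?P k (n - s - r)))))"
    by (intro sum.cong refl) (auto simp: opser_Asum fvec.scale_sum_right comm add.commute intro!: sum.cong)
  also have "(\<Sum>s=1..n. fscale (of_nat s) (A s (\<Sum>r=1..n - s. A r (?P k (n - s - r))))) =
      (\<Sum>s=1..n. fscale (of_nat s) (A s (?P (Suc k) (n - s))))"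
    by (simp only: opser_pow.simps)
  finally have "fscale (of_nat n) (?P (Suc (Suc k)) n) =
      fscale (1 + of_nat (Suc k)) (\<Sum>s=1..n. fscale (of_nat s) (A s (?P (Suc k) (n - s))))"
    by (simp only: fvec.scale_left_distrib fvec.scale_one)
  then show ?case
    by (simp only: of_nat_Suc[of "Suc k"])
qed

lemma opexp_rec:
  "fscale (of_nat n) (opexp A n v) = (\<Sum>r=1..n. fscale (of_nat r) (A r (opexp A (n - r) v)))"
proof (cases n)
  case (Suc m)
  \<comment> \<open>Powers beyond the degree contribute nothing, so all coefficients involved can be
    summed over the same range of \<open>k\<close>.\<close>
  have ext: "opexp A j v = (\<Sum>k\<le>m. fscale (inverse (of_nat (fact k))) (opser_pow A k j v))" if "j \<le> m" for j
    unfolding opexp_def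
    by (rule sum.mono_neutral_left) (use that in \<open>auto simp: opser_pow_eq_0 opser_A0\<close>)
  have inv: "inverse (of_nat (fact (Suc k))) * of_nat (Suc k) = inverse (of_nat (fact k) :: qfield)" for k
    by (simp only: fact_Suc of_nat_mult inverse_mult_distrib) (simp del: of_nat_Suc)
  have "fscale (of_nat n) (opexp A n v) =
      (\<Sum>k\<le>m. fscale (inverse (of_nat (fact (Suc k)))) (fscale (of_nat n) (opser_pow A (Suc k) n v)))"
    unfolding opexp_def Suc
    by (subst sum.atMost_Suc_shift) (simp add: fvec.scale_sum_right mult.commute del: opser_pow.simps(2) of_nat_Suc fact_Suc)
  also have "\<dots> = (\<Sum>k\<le>m. \<Sum>r=1..n. fscale (of_nat r) (A r (fscale (inverse (of_nat (fact k))) (opser_pow A k (n - r) v))))"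
    unfolding opser_pow_rec
    by (simp only: fvec.scale_scale inv) (simp add: fvec.scale_sum_right scale mult.commute del: of_nat_Suc fact_Suc)
  also have "\<dots> = (\<Sum>r=1..n. \<Sum>k\<le>m. fscale (of_nat r) (A r (fscale (inverse (of_nat (fact k))) (opser_pow A k (n - r) v))))"
    by (rule sum.swap)
  also have "\<dots> = (\<Sum>r=1..n. fscale (of_nat r) (A r (opexp A (n - r) v)))"
    by (intro sum.cong refl) (auto simp: Suc ext opser_Asum fvec.scale_sum_right)
  finally show ?thesis .
qed simp

lemma opexp_unique:
  assumes "U 0 = v" and "\<And>n. fscale (of_nat n) (U n) = (\<Sum>r=1..n. fscale (of_nat r) (A r (U (n - r))))"
  shows "opexp A n v = U n"
proof (induction n rule: less_induct)
  case (less n)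
  show ?case
  proof (cases "n = 0")
    case False
    have "fscale (of_nat n) (opexp A n v) = fscale (of_nat n) (U n)"
      unfolding opexp_rec assms(2) using less by (intro sum.cong) auto
    with False show ?thesis by simp
  qed (simp add: assms opexp_0)
qed

end

section \<open>The algebra structure of the Frenkel--Jing module\<close>

definition xvar :: "nat \<Rightarrow> L0" where "xvar i = Fsingle (Poly_Mapping.single i 1, 0) 1"

definition evar :: "int \<Rightarrow> L0" where "evar k = Fsingle (0, k) 1"

lemma evar_add: "evar (k + l) = evar k * evar l"
  by (simp add: evar_def mult_single)

lemma evar_0: "evar 0 = 1"
  by (simp add: evar_def flip: zero_prod_def)

definition mu_prod :: "(nat \<Rightarrow> 'r::comm_ring_1) \<Rightarrow> (nat \<Rightarrow>\<^sub>0 nat) \<Rightarrow> 'r"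
  where "mu_prod f \<mu> = (\<Prod>i\<in>Poly_Mapping.keys \<mu>. f i ^ lookup \<mu> i)"

lemma mu_prod_superset:
  assumes "finite A" "Poly_Mapping.keys \<mu> \<subseteq> A"
  shows "mu_prod f \<mu> = (\<Prod>i\<in>A. f i ^ lookup \<mu> i)"
  unfolding mu_prod_def
  by (rule prod.mono_neutral_left) (use assms in \<open>auto simp: in_keys_iff\<close>)

lemma mu_prod_0: "mu_prod f 0 = 1"
  by (simp add: mu_prod_def)

lemma mu_prod_add: "mu_prod f (\<mu> + \<nu>) = mu_prod f \<mu> * mu_prod f \<nu>"
proof -
  let ?A = "Poly_Mapping.keys \<mu> \<union> Poly_Mapping.keys \<nu>"
  have "mu_prod f \<rho> = (\<Prod>i\<in>?A. f i ^ lookup \<rho> i)" if "Poly_Mapping.keys \<rho> \<subseteq> ?A" for \<rho>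
    using that by (intro mu_prod_superset) auto
  then show ?thesis
    using keys_add[of \<mu> \<nu>] by (simp add: lookup_add power_add prod.distrib)
qed

lemma mu_prod_single: "mu_prod f (Poly_Mapping.single i n) = f i ^ n"
  by (simp add: mu_prod_def)

lemma ring_hom_mu_prod: "ring_hom h \<Longrightarrow> h (mu_prod f \<mu>) = mu_prod (\<lambda>i. h (f i)) \<mu>"
  by (simp add: mu_prod_def ring_hom_prod ring_hom_power)

lemma mu_prod_xvar: "mu_prod xvar \<mu> = Fsingle (\<mu>, 0) 1"
proof (induction \<mu> rule: single_induct)
  case (single i n)
  show ?case
    by (induction n) (simp_all add: mu_prod_single mu_prod_0 xvar_def mult_single flip: single_add zero_prod_def)
qed (simp add: mu_prod_add mult_single)

lemma L0_single: "Fsingle (\<mu>, k) c = Fsingle 0 c * evar k * mu_prod xvar \<mu>"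
  by (simp add: mu_prod_xvar evar_def mult_single)

lemma L0_induct [case_names const xvar evar add mult]:
  assumes "\<And>c. P (Fsingle 0 c)" "\<And>i. P (xvar i)" "\<And>k. P (evar k)"
    and "\<And>u v. P u \<Longrightarrow> P v \<Longrightarrow> P (u + v)" and mult: "\<And>u v. P u \<Longrightarrow> P v \<Longrightarrow> P (u * v)"
  shows "P v"
proof (induction v rule: single_induct)
  case (single b c)
  obtain \<mu> k where b: "b = (\<mu>, k)" by fastforce
  have 1: "P 1" using assms(1)[of 1] by simp
  have "P (mu_prod xvar \<mu>)"
  proof (induction \<mu> rule: single_induct)
    case (single i n)
    show ?case
      by (induction n) (simp_all add: mu_prod_single mu_prod_0 1 assms)
  qed (simp add: mu_prod_add mult)
  then show ?case
    unfolding b L0_single by (intro assms)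
qed (rule assms)

lemma lin_ext_eq_hom_ext:
  fixes f :: "'b \<Rightarrow> ('d::comm_monoid_add \<Rightarrow>\<^sub>0 qfield)"
  shows "lin_ext f = hom_ext (Fsingle 0) f"
  by (simp add: fun_eq_iff lin_ext_def hom_ext_def fscale_eq_mult)

lemma lin_ext_single: "lin_ext f (Fsingle b k) = fscale k (f b)"
  by (simp add: lin_ext_def)

lemma heis_neg_eq: "heis_neg r v = xvar (r - 1) * v"
  by (simp add: heis_neg_def xvar_def)

lemma heis_pos_add: "heis_pos r (u + v) = heis_pos r u + heis_pos r v"
  by (simp add: heis_pos_def lin_ext_eq_hom_ext hom_ext_add ring_hom_single)

lemma heis_pos_0: "heis_pos r 0 = 0"
  using heis_pos_add[of r 0 0] by simp

lemma heis_pos_fscale: "heis_pos r (fscale k v) = fscale k (heis_pos r v)"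
  by (induction v rule: single_induct) (auto simp: heis_pos_single heis_pos_add fvec.scale_right_distrib mult.assoc)

lemma heis_pos_commute:
  assumes "1 \<le> r" "1 \<le> s"
  shows "heis_pos r (heis_pos s v) = heis_pos s (heis_pos r v)"
proof (cases "r = s")
  case False
  then have ne: "r - 1 \<noteq> s - 1" using assms by linarith
  show ?thesis
  proof (induction v rule: single_induct)
    case (single b k)
    have "\<mu> - Poly_Mapping.single i 1 - Poly_Mapping.single j 1 = \<mu> - Poly_Mapping.single j 1 - Poly_Mapping.single i 1"
      for \<mu> :: "nat \<Rightarrow>\<^sub>0 nat" and i j
      by (rule poly_mapping_eqI) (simp add: lookup_minus)
    then show ?case
      using ne by (cases b) (simp add: heis_pos_single lookup_minus lookup_single when_def mult_ac)
  qed (simp add: heis_pos_add)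
qed simp

text \<open>$a(r)$ is a multiple of the partial derivative with respect to $a(-r)$.\<close>

lemma heis_pos_mult: "heis_pos r (u * v) = heis_pos r u * v + u * heis_pos r v"
proof (induction u rule: single_induct)
  case (single b k)
  show ?case
  proof (induction v rule: single_induct)
    case (single b' k')
    obtain \<mu> m where b: "b = (\<mu>, m)" by fastforce
    obtain \<nu> n where b': "b' = (\<nu>, n)" by fastforce
    let ?d = "Poly_Mapping.single (r - 1) 1 :: nat \<Rightarrow>\<^sub>0 nat"
    \<comment> \<open>Subtraction of exponents truncates at 0, so it commutes with addition only if
      the exponent is positive; otherwise the coefficient of the derivative vanishes.\<close>
    have 1: "\<mu> - ?d + \<nu> = \<mu> + \<nu> - ?d" if "lookup \<mu> (r - 1) \<noteq> 0"
      using that by (intro poly_mapping_eqI) (auto simp: lookup_add lookup_minus lookup_single when_def)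
    have 2: "\<mu> + (\<nu> - ?d) = \<mu> + \<nu> - ?d" if "lookup \<nu> (r - 1) \<noteq> 0"
      using that by (intro poly_mapping_eqI) (auto simp: lookup_add lookup_minus lookup_single when_def)
    show ?case
      unfolding b b' using 1 2
      by (cases "lookup \<mu> (r - 1) = 0"; cases "lookup \<nu> (r - 1) = 0")
        (simp_all add: heis_pos_single mult_single lookup_add algebra_simps add_divide_distrib flip: single_add)
  qed (simp add: heis_pos_add algebra_simps)
qed (simp add: heis_pos_add algebra_simps)

lemma heis_pos_xvar:
  "1 \<le> r \<Longrightarrow> heis_pos r (xvar i) = (if i + 1 = r then Fsingle 0 (qnum (2 * r) * qnum r / of_nat r) else 0)"
  by (auto simp: xvar_def heis_pos_single lookup_single when_def zero_prod_def)

lemma heis_pos_evar: "heis_pos r (evar k) = 0"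
  by (simp add: evar_def heis_pos_single)

lemma heis_pos_const: "heis_pos r (Fsingle 0 k) = 0"
  by (simp add: zero_prod_def heis_pos_single)

section \<open>Annihilation parts as algebra homomorphisms\<close>

lemma ring_hom_fconst: "ring_hom (\<lambda>k. fls_const (Fsingle (0::'b::comm_monoid_add) k))"
  by (rule ring_hom_comp[OF ring_hom_fls_const ring_hom_single])

lemma fls_const_eq_mono1: "fls_const c = mono1 c 0"
  by (simp add: mono1_def)

lemma mono1_power: "mono1 c a ^ n = mono1 (c ^ n) (of_nat n * a)"
  by (induction n) (simp_all add: mono1_1 mono1_mult algebra_simps)

lemma mono1_0 [simp]: "mono1 0 a = 0"
  by (rule fls_eqI) (simp add: mono1_nth)

lemma mono1_add: "mono1 c a + mono1 d a = mono1 (c + d) a"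
  by (rule fls_eqI) (simp add: mono1_nth)

text \<open>\<open>shift0 \<sigma> \<kappa> \<delta>\<close> is the homomorphism $a(-r) \mapsto a(-r) + \sigma_r z^{-r}$,
  $e^{k\alpha_1} \mapsto (\kappa z^\delta)^k e^{k\alpha_1}$.\<close>

definition shift0 :: "(nat \<Rightarrow> qfield) \<Rightarrow> qfield \<Rightarrow> int \<Rightarrow> L0 \<Rightarrow> L0 fls"
  where "shift0 \<sigma> \<kappa> \<delta> = hom_ext (\<lambda>k. fls_const (Fsingle 0 k))
    (\<lambda>(\<mu>, k). mono1 (fscale (\<kappa> powi k) (evar k)) (\<delta> * k) *
      mu_prod (\<lambda>i. mono1 (xvar i) 0 + mono1 (Fsingle 0 (\<sigma> (i + 1))) (- int (i + 1))) \<mu>)"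

lemma shift0_single:
  "shift0 \<sigma> \<kappa> \<delta> (Fsingle (\<mu>, k) c) = fls_const (Fsingle 0 c) *
    (mono1 (fscale (\<kappa> powi k) (evar k)) (\<delta> * k) *
      mu_prod (\<lambda>i. mono1 (xvar i) 0 + mono1 (Fsingle 0 (\<sigma> (i + 1))) (- int (i + 1))) \<mu>)"
  by (simp add: shift0_def hom_ext_single[OF ring_hom_fconst])

lemma alg_hom_shift0:
  assumes "\<kappa> \<noteq> 0"
  shows "alg_hom (\<lambda>k. fls_const (Fsingle 0 k)) (shift0 \<sigma> \<kappa> \<delta>)"
  unfolding shift0_def
proof (rule alg_hom_hom_ext[OF ring_hom_fconst], goal_cases)
  case 1
  then show ?case
    by (simp add: zero_prod_def mu_prod_0 evar_0 mono1_1)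
next
  case (2 a b)
  obtain \<mu> k \<nu> l where ab: "a = (\<mu>, k)" "b = (\<nu>, l)" by fastforce
  have "mono1 (fscale (\<kappa> powi (k + l)) (evar (k + l))) (\<delta> * (k + l)) =
      mono1 (fscale (\<kappa> powi k) (evar k)) (\<delta> * k) * mono1 (fscale (\<kappa> powi l) (evar l)) (\<delta> * l)"
    using assms by (simp add: mono1_mult fscale_mult_fscale evar_add power_int_add algebra_simps)
  then show ?case
    by (simp add: ab mu_prod_add ac_simps)
qed

lemmas ring_hom_shift0 = alg_hom_ring_hom[OF alg_hom_shift0]

lemma shift0_const: "\<kappa> \<noteq> 0 \<Longrightarrow> shift0 \<sigma> \<kappa> \<delta> (Fsingle 0 c) = mono1 (Fsingle 0 c) 0"
  using alg_hom_scalar[OF alg_hom_shift0] by (simp add: fls_const_eq_mono1)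

lemma shift0_xvar: "shift0 \<sigma> \<kappa> \<delta> (xvar i) = mono1 (xvar i) 0 + mono1 (Fsingle 0 (\<sigma> (i + 1))) (- int (i + 1))"
  by (subst (1) xvar_def) (simp add: shift0_single mu_prod_single evar_0 mono1_1)

lemma shift0_evar: "shift0 \<sigma> \<kappa> \<delta> (evar k) = mono1 (fscale (\<kappa> powi k) (evar k)) (\<delta> * k)"
  by (subst (1) evar_def) (simp add: shift0_single mu_prod_0)

text \<open>On a basis vector the zero modes act by a scalar and a power of $z$, which split off
  from the translation of the $a(-r)$.\<close>

lemma shift0_factor:
  "shift0 \<sigma> \<kappa> \<delta> (Fsingle (\<mu>, k) c) =
    mono1 (Fsingle 0 (\<kappa> powi k)) (\<delta> * k) * shift0 \<sigma> 1 0 (Fsingle (\<mu>, k) c)"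
proof -
  have "mono1 (fscale (\<kappa> powi k) (evar k)) (\<delta> * k) =
      mono1 (Fsingle 0 (\<kappa> powi k)) (\<delta> * k) * mono1 (fscale (1 powi k) (evar k)) (0 * k)"
    by (simp add: mono1_mult fscale_eq_mult)
  then show ?thesis
    unfolding shift0_single by (simp only: ac_simps)
qed

lemma fls_times_nth_nonpos:
  fixes F G :: "'a::comm_ring_1 fls"
  assumes "\<And>i. 0 < i \<Longrightarrow> F $$ i = 0" "\<And>i. 0 < i \<Longrightarrow> G $$ i = 0"
  shows "(F * G) $$ (- int n) = (\<Sum>i\<le>n. F $$ (- int i) * G $$ (- int (n - i)))"
    and "0 < m \<Longrightarrow> (F * G) $$ m = 0"
proof -
  define M where "M = min 0 (min (fls_subdegree F) (fls_subdegree G))"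
  have *: "(F * G) $$ k = (\<Sum>i=M..k - M. F $$ i * G $$ (k - i))" for k
    by (rule fls_times_nth_between) (auto simp: M_def)
  show "(F * G) $$ m = 0" if "0 < m"
    unfolding * by (rule sum.neutral) (metis assms mult_zero_left mult_zero_right diff_gt_0_iff_gt linorder_not_le order_le_less_trans that)
  have "(\<Sum>i\<in>{- int n..0}. F $$ i * G $$ (- int n - i)) = (\<Sum>i\<in>{M - int n..- M}. F $$ i * G $$ (- int n - i))"
    by (rule sum.mono_neutral_left) (auto simp: assms M_def)
  also have "\<dots> = (\<Sum>i\<in>{M..- int n - M}. F $$ i * G $$ (- int n - i))"
    by (rule sum.mono_neutral_cong)  (auto simp: M_def)
  finally show "(F * G) $$ (- int n) = (\<Sum>i\<le>n. F $$ (- int i) * G $$ (- int (n - i)))"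
    unfolding *
    by (subst (asm) sum.reindex_bij_witness[of "{- int n..0}" "\<lambda>i. - int i" "\<lambda>i. nat (- i)" "{..n}"
        "\<lambda>i. F $$ (- int i) * G $$ (- int (n - i))" "\<lambda>i. F $$ i * G $$ (- int n - i)"])
      (auto simp: of_nat_diff)
qed

text \<open>The exponential of a derivation is an algebra homomorphism; both sides of the identity
  below solve the same differential equation.\<close>

context
  fixes g \<sigma> :: "nat \<Rightarrow> qfield" and A :: "nat \<Rightarrow> L0 \<Rightarrow> L0"
  assumes \<sigma>: "\<And>r. \<sigma> r = g r * (qnum (2 * r) * qnum r / of_nat r)"
  defines "A \<equiv> \<lambda>r u. fscale (g r) (heis_pos r u)"
begin

lemma annihilation_rec:
  "(\<forall>n>0. shift0 \<sigma> 1 0 u $$ n = 0) \<and> shift0 \<sigma> 1 0 u $$ 0 = u \<and>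
   (\<forall>n. fscale (of_nat n) (shift0 \<sigma> 1 0 u $$ (- int n)) =
      (\<Sum>r=1..n. fscale (of_nat r) (A r (shift0 \<sigma> 1 0 u $$ (- int (n - r))))))"
proof (induction u rule: L0_induct)
  case (const c)
  show ?case
    by (auto simp: shift0_const mono1_nth A_def heis_pos_const heis_pos_0 intro!: sum.neutral sum.neutral[symmetric])
next
  case (evar k)
  show ?case
    by (auto simp: shift0_evar mono1_nth A_def heis_pos_evar heis_pos_0 intro!: sum.neutral sum.neutral[symmetric])
next
  case (xvar i)
  have "fscale (of_nat r) (A r (shift0 \<sigma> 1 0 (xvar i) $$ (- int (n - r)))) =
      (if r = n \<and> n = Suc i then fscale (of_nat n) (Fsingle 0 (\<sigma> n)) else 0)" if "r \<in> {1..n}" for r n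
    using that by (auto simp: shift0_xvar mono1_nth A_def heis_pos_xvar heis_pos_const heis_pos_0 \<sigma>)
  then have "(\<Sum>r=1..n. fscale (of_nat r) (A r (shift0 \<sigma> 1 0 (xvar i) $$ (- int (n - r))))) =
      (\<Sum>r=1..n. if r = n \<and> n = Suc i then fscale (of_nat n) (Fsingle 0 (\<sigma> n)) else 0)" for n
    by (rule sum.cong[OF refl])
  \<comment> \<open>The preceding fact is general in \<open>n\<close>, so the dots denote its right
    side as a function of \<open>n\<close>.\<close>
  also have "\<dots>n = (if n = Suc i then fscale (of_nat n) (Fsingle 0 (\<sigma> n)) else 0)" for n
    by auto
  finally show ?case
    by (auto simp: shift0_xvar mono1_nth)
next
  case (add u v)
  have "shift0 \<sigma> 1 0 (u + v) = shift0 \<sigma> 1 0 u + shift0 \<sigma> 1 0 v"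
    by (simp add: ring_hom_add[OF ring_hom_shift0])
  then show ?case
    using add by (simp add: fvec.scale_right_distrib A_def heis_pos_add sum.distrib)
next
  case (mult u v)
  let ?S = "shift0 \<sigma> 1 0" and ?U = "\<lambda>u n. shift0 \<sigma> 1 0 u $$ (- int n)"
  have S: "?S (u * v) = ?S u * ?S v"
    by (simp add: ring_hom_mult[OF ring_hom_shift0])
  have pos: "\<And>i. 0 < i \<Longrightarrow> ?S u $$ i = 0" "\<And>i. 0 < i \<Longrightarrow> ?S v $$ i = 0"
    using mult by auto
  have U: "?U (u * v) n = (\<Sum>i\<le>n. ?U u i * ?U v (n - i))" for n
    unfolding S by (rule fls_times_nth_nonpos[OF pos])
  have A_sum: "A r (sum f I) = (\<Sum>i\<in>I. A r (f i))" for r f and I :: "nat set"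
    by (induction I rule: infinite_finite_induct) (simp_all add: A_def heis_pos_0 heis_pos_add fvec.scale_right_distrib)
  have A_mult: "A r (a * b) = A r a * b + a * A r b" for r a b
    by (simp add: A_def heis_pos_mult fscale_eq_mult algebra_simps)
  have u: "fscale (of_nat n) (?U u n) = (\<Sum>r=1..n. fscale (of_nat r) (A r (?U u (n - r))))" for n
    using mult(1) by blast
  have v: "fscale (of_nat n) (?U v n) = (\<Sum>r=1..n. fscale (of_nat r) (A r (?U v (n - r))))" for n
    using mult(2) by blast
  have "fscale (of_nat n) (?U (u * v) n) =
      (\<Sum>r=1..n. fscale (of_nat r) (A r (?U (u * v) (n - r))))" for n
  proof -
    \<comment> \<open>The degree splits as $n = i + (n-i)$. Both factors solve the equation, and
      since each \<open>A r\<close> is a derivation the two sums recombine to the equation of the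
      product.\<close>
    have "fscale (of_nat n) (?U (u * v) n) =
        (\<Sum>i\<le>n. fscale (of_nat i) (?U u i) * ?U v (n - i)) + (\<Sum>i\<le>n. ?U u i * fscale (of_nat (n - i)) (?U v (n - i)))"
      unfolding U fvec.scale_sum_right sum.distrib[symmetric]
      by (intro sum.cong refl) (auto simp: fscale_eq_mult of_nat_diff single_diff algebra_simps simp del: single_of_nat)
    also have "(\<Sum>i\<le>n. ?U u i * fscale (of_nat (n - i)) (?U v (n - i))) =
        (\<Sum>i\<le>n. ?U u (n - i) * fscale (of_nat i) (?U v i))"
      by (rule sum.reindex_bij_witness[of _ "\<lambda>i. n - i" "\<lambda>i. n - i"]) auto
    also have "(\<Sum>i\<le>n. fscale (of_nat i) (?U u i) * ?U v (n - i)) =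
        (\<Sum>i\<le>n. \<Sum>r=1..i. fscale (of_nat r) (A r (?U u (i - r)) * ?U v (n - i)))"
      unfolding u by (simp add: sum_distrib_right sum_distrib_left fscale_eq_mult ac_simps)
    also have "\<dots> = (\<Sum>r=1..n. \<Sum>i\<le>n - r. fscale (of_nat r) (A r (?U u i) * ?U v (n - r - i)))"
      by (subst (1 2) sum.Sigma; simp)
        (rule sum.reindex_bij_witness[of _ "\<lambda>(r, i). (i + r, r)" "\<lambda>(i, r). (r, i - r)"]; auto)
    also have "(\<Sum>i\<le>n. ?U u (n - i) * fscale (of_nat i) (?U v i)) =
        (\<Sum>i\<le>n. \<Sum>r=1..i. fscale (of_nat r) (?U u (n - i) * A r (?U v (i - r))))"
      unfolding v by (simp add: sum_distrib_left fscale_eq_mult ac_simps)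
    also have "\<dots> = (\<Sum>r=1..n. \<Sum>i\<le>n - r. fscale (of_nat r) (?U u i * A r (?U v (n - r - i))))"
      by (subst (1 2) sum.Sigma; simp)
        (rule sum.reindex_bij_witness[of _ "\<lambda>(r, i). (n - i, r)" "\<lambda>(i, r). (r, n - i)"]; auto)
    finally show ?thesis
      unfolding U A_sum A_mult
      by (simp add: sum.distrib fvec.scale_right_distrib fvec.scale_sum_right)
  qed
  then show ?case
    using mult fls_times_nth_nonpos(2)[OF pos] by (auto simp: S fls_times_nth_nonpos(1)[OF pos, of 0, simplified])
qed

lemma opexp_heis_pos: "opexp A n u = shift0 \<sigma> 1 0 u $$ (- int n)"
proof (rule opexp_unique)
  show "A r (A s v) = A s (A r v)" if "1 \<le> r" "1 \<le> s" for r s v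
    using heis_pos_commute[OF that] by (simp add: A_def heis_pos_fscale mult.commute)
qed (use annihilation_rec[of u] in \<open>auto simp: A_def heis_pos_add heis_pos_fscale fvec.scale_right_distrib mult.commute\<close>)

end

lemma is_exp_uniq:
  fixes E F :: "'r::comm_ring_1 fps" and c :: "qfield \<Rightarrow> 'r"
  assumes "ring_hom c" "is_exp g E" "is_exp g F"
  shows "E = F"
proof (rule is_exp_unique[OF _ assms(2,3)])
  fix n :: nat assume "0 < n"
  then have "c (inverse (of_nat n)) * c (of_nat n) = 1"
    by (subst ring_hom_mult[OF assms(1), symmetric]) (simp add: ring_hom_1[OF assms(1)])
  then have "c (inverse (of_nat n)) * of_nat n = 1"
    by (simp add: ring_hom_of_nat[OF assms(1)])
  then show "\<exists>y::'r. y * of_nat n = 1" ..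
qed

section \<open>Creation parts and vertex operators on one tensor factor\<close>

definition exp0 :: "(nat \<Rightarrow> qfield) \<Rightarrow> L0 fps"
  where "exp0 f = Abs_fps (\<lambda>n. opexp (\<lambda>r u. fscale (f r) (heis_neg r u)) n 1)"

lemma exp0_rec:
  "fscale (of_nat n) (exp0 f $ n) = (\<Sum>r=1..n. fscale (of_nat r) (fscale (f r) (heis_neg r (exp0 f $ (n - r)))))"
  unfolding exp0_def fps_nth_Abs_fps
  by (rule opexp_rec) (auto simp: heis_neg_eq fscale_eq_mult algebra_simps)

text \<open>The $a(-r)$ act by multiplication, so their exponential is multiplication by its value
  at 1.\<close>

lemma opexp_heis_neg: "opexp (\<lambda>r u. fscale (f r) (heis_neg r u)) n v = exp0 f $ n * v"
proof (rule opexp_unique)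
  show "fscale (of_nat n) (exp0 f $ n * v) =
      (\<Sum>r=1..n. fscale (of_nat r) (fscale (f r) (heis_neg r (exp0 f $ (n - r) * v))))" for n
  proof -
    have "fscale (of_nat n) (exp0 f $ n * v) = fscale (of_nat n) (exp0 f $ n) * v"
      by (simp add: fscale_eq_mult mult.assoc)
    then show ?thesis
      unfolding exp0_rec by (simp add: sum_distrib_right fscale_eq_mult heis_neg_eq mult.assoc)
  qed
qed (auto simp: heis_neg_eq fscale_eq_mult algebra_simps exp0_def opexp_0)

lemma is_exp_exp0: "is_exp (\<lambda>r. fscale (f r) (xvar (r - 1))) (exp0 f)"
  unfolding is_exp_iff
proof safe
  show "exp0 f $ 0 = 1"
    by (simp add: exp0_def opexp_0)
  show "of_nat n * exp0 f $ n = (\<Sum>r=1..n. of_nat r * fscale (f r) (xvar (r - 1)) * exp0 f $ (n - r))" for n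
    using exp0_rec[of n f] by (simp add: fscale_eq_mult heis_neg_eq mult.assoc)
qed

lemma exp0_0: "exp0 (\<lambda>_. 0) = 1"
  using is_exp_exp0[of "\<lambda>_. 0"] is_exp_0 by (intro is_exp_uniq[OF ring_hom_single]) simp_all

lemma exp0_dilate:
  assumes "k \<noteq> 0"
  shows "fls_dilate k (fps_to_fls (exp0 f)) = fps_to_fls (exp0 (\<lambda>r. k ^ r * f r))"
proof -
  have 1: "Fsingle (0 :: L0_basis) k ^ n = Fsingle 0 (k ^ n)" for n
    by (rule ring_hom_power[OF ring_hom_single, symmetric])
  have "is_exp (\<lambda>r. fscale (k ^ r * f r) (xvar (r - 1))) (Abs_fps (\<lambda>n. Fsingle 0 k ^ n * exp0 f $ n))"
    using is_exp_dilate[OF is_exp_exp0, of "Fsingle 0 k" f] unfolding 1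
    by (simp add: fscale_eq_mult flip: mult.assoc) (simp add: mult_single)
  then have "Abs_fps (\<lambda>n. Fsingle 0 k ^ n * exp0 f $ n) = exp0 (\<lambda>r. k ^ r * f r)"
    using is_exp_exp0 by (rule is_exp_uniq[OF ring_hom_single])
  then have *: "exp0 (\<lambda>r. k ^ r * f r) $ n = fscale (k ^ n) (exp0 f $ n)" for n
    by (simp add: 1 fscale_eq_mult fps_eq_iff)
  show ?thesis
    by (rule fls_eqI) (simp add: * power_int_def)
qed

lemma shift0_dilate:
  assumes "k \<noteq> 0" "\<kappa> \<noteq> 0"
  shows "fls_dilate k (shift0 \<sigma> \<kappa> \<delta> u) = shift0 (\<lambda>r. \<sigma> r * inverse k ^ r) (\<kappa> * k powi \<delta>) \<delta> u"
proof (induction u rule: L0_induct)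
  case (xvar i)
  have "- 1 - int i = - int (Suc i)"
    by simp
  then have "k powi (- 1 - int i) = inverse k * inverse k ^ i"
    by (simp only: power_int_minus power_int_of_nat power_Suc inverse_mult_distrib power_inverse)
  then show ?case
    by (simp add: shift0_xvar fls_dilate_mono1 ring_hom_add[OF ring_hom_fls_dilate[OF assms(1)]] mult_ac)
next
  case (evar l)
  show ?case
    using assms by (simp add: shift0_evar fls_dilate_mono1 power_int_mult_distrib mult_ac flip: power_int_mult)
qed (use assms in \<open>simp_all add: shift0_const fls_dilate_mono1 ring_hom_add[OF ring_hom_fls_dilate]
    ring_hom_mult[OF ring_hom_fls_dilate] ring_hom_add[OF ring_hom_shift0] ring_hom_mult[OF ring_hom_shift0]\<close>)

definition vop0 :: "(nat \<Rightarrow> qfield) \<Rightarrow> int \<Rightarrow> (nat \<Rightarrow> qfield) \<Rightarrow> qfield \<Rightarrow> int \<Rightarrow> L0 \<Rightarrow> L0 fls"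
  where "vop0 f s \<sigma> \<kappa> \<delta> u = fps_to_fls (exp0 f) * mono1 (evar s) 0 * shift0 \<sigma> \<kappa> \<delta> u"

lemma vop0_dilate:
  assumes "k \<noteq> 0" "\<kappa> \<noteq> 0"
  shows "fls_dilate k (vop0 f s \<sigma> \<kappa> \<delta> u) =
    vop0 (\<lambda>r. k ^ r * f r) s (\<lambda>r. \<sigma> r * inverse k ^ r) (\<kappa> * k powi \<delta>) \<delta> u"
  unfolding vop0_def ring_hom_mult[OF ring_hom_fls_dilate[OF assms(1)]]
    exp0_dilate[OF assms(1)] shift0_dilate[OF assms] fls_dilate_mono1 by simp

lemma dilate_eqI: "(\<And>n. a v n = F $$ n) \<Longrightarrow> dilate k a v n = fls_dilate k F $$ n"
  by (simp add: dilate_def)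

lemma xplus_single:
  "xplus (Fsingle (\<mu>, k) 1) n = vop0 (\<lambda>r. inverse (qh ^ r) / qnum r) 1
     (\<lambda>r. - (inverse (qh ^ r) / qnum r) * (qnum (2 * r) * qnum r / of_nat r)) 1 2 (Fsingle (\<mu>, k) 1) $$ n"
proof -
  let ?f = "\<lambda>r. inverse (qh ^ r) / qnum r"
  let ?\<sigma> = "\<lambda>r. - ?f r * (qnum (2 * r) * qnum r / of_nat r)"
  let ?A = "\<lambda>r u. fscale (- ?f r) (heis_pos r u)"
  let ?w = "Fsingle (\<mu>, k + 1) 1 :: L0"
  define S where "S = shift0 ?\<sigma> 1 0 ?w"
  \<comment> \<open>Annihilation beyond depth \<open>J\<close> kills this vector, so the infinite
    sum in \<open>xplus\<close> has finite support.\<close>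
  define J where "J = nat (- fls_subdegree S)"
  have J: "S $$ (- int j) = 0" if "J < j" for j
    using that by (simp add: J_def)
  have Spos: "S $$ i = 0" if "0 < i" for i
    using annihilation_rec[of ?\<sigma> "\<lambda>r. - ?f r" ?w] that unfolding S_def by blast
  have lat: "lattice_current (Fsingle (\<mu>, k) 1) l = (if l = 2 * k then ?w else 0)" for l
    by (simp add: lattice_current_def lin_ext_single)
  define h where "h = (\<lambda>(j::nat, l::int). if 0 \<le> n + int j - l \<and> l = 2 * k then exp0 ?f $ nat (n + int j - l) * S $$ (- int j) else 0)"
  have ann: "opexp ?A j (if l = 2 * k then ?w else 0) = (if l = 2 * k then S $$ (- int j) else 0)" for j l
  proof (cases "l = 2 * k")
    case True
    show ?thesis
      by (simp only: True if_True refl S_def opexp_heis_pos[of ?\<sigma> "\<lambda>r. - ?f r", OF refl])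
  qed (simp only: if_False opexp_zero heis_pos_0 fvec.scale_zero_right)
  have "xplus (Fsingle (\<mu>, k) 1) n = Sum_any h"
    unfolding xplus_def lat ann opexp_heis_neg h_def
    by (rule arg_cong[of _ _ Sum_any]) (auto simp: fun_eq_iff)
  also have "\<dots> = (\<Sum>p\<in>{0..J} \<times> {2 * k}. h p)"
    by (rule Sum_any.expand_superset) (auto simp: h_def J intro!: leI split: if_splits)
  also have "\<dots> = (\<Sum>j\<in>{0..J}. h (j, 2 * k))"
    by (rule sum.reindex_bij_witness[of _ "\<lambda>j. (j, 2 * k)" fst]) auto
  also have "\<dots> = (\<Sum>i\<in>{- int J..0}. S $$ i * fps_to_fls (exp0 ?f) $$ (n - 2 * k - i))"
    by (rule sum.reindex_bij_witness[of _ "\<lambda>i. nat (- i)" "\<lambda>j. - int j"])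
      (auto simp: h_def algebra_simps)
  also have "\<dots> = (\<Sum>i\<in>{- int J..n - 2 * k - 0}. S $$ i * fps_to_fls (exp0 ?f) $$ (n - 2 * k - i))"
    by (rule sum.mono_neutral_cong) (auto simp: Spos)
  also have "\<dots> = (S * fps_to_fls (exp0 ?f)) $$ (n - 2 * k)"
    by (rule fls_times_nth_between[symmetric]) (auto simp: J_def split: if_splits)
  also have S_eq: "S = mono1 (evar 1) 0 * shift0 ?\<sigma> 1 0 (Fsingle (\<mu>, k) 1)"
  proof -
    have "?w = evar 1 * Fsingle (\<mu>, k) 1"
      by (simp add: evar_def mult_single add.commute)
    then show ?thesis
      by (simp add: S_def ring_hom_mult[OF ring_hom_shift0] shift0_evar)
  qed
  also have "(mono1 (evar 1) 0 * shift0 ?\<sigma> 1 0 (Fsingle (\<mu>, k) 1) * fps_to_fls (exp0 ?f)) $$ (n - 2 * k) =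
     (mono1 1 (2 * k) * (mono1 (evar 1) 0 * shift0 ?\<sigma> 1 0 (Fsingle (\<mu>, k) 1) * fps_to_fls (exp0 ?f))) $$ n"
    by (simp add: mono1_times_nth)
  also have "\<dots> = vop0 ?f 1 ?\<sigma> 1 2 (Fsingle (\<mu>, k) 1) $$ n"
    unfolding vop0_def shift0_factor[of _ _ 2] by (simp add: ac_simps)
  finally show ?thesis .
qed

lemma K_inv_alg_hom: "alg_hom (Fsingle 0) K_inv"
  unfolding K_inv_def lin_ext_eq_hom_ext
  by (rule alg_hom_hom_ext[OF ring_hom_single])
    (auto simp: case_prod_beta mult_single power_int_add power_int_diff power_int_minus divide_inverse algebra_simps simp flip: zero_prod_def)

lemma phi_single:
  "phi (Fsingle (\<mu>, k) 1) n = vop0 (\<lambda>r. - (qq - inverse qq)) 0 (\<lambda>_. 0) (qq powi (- 2)) 0 (Fsingle (\<mu>, k) 1) $$ n"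
proof -
  let ?f = "\<lambda>r::nat. - (qq - inverse qq)"
  note K = alg_hom_ring_hom[OF K_inv_alg_hom]
  have "K_inv (xvar i) = xvar i" for i
    by (simp add: xvar_def K_inv_def lin_ext_single)
  then have "K_inv (fscale (?f r) (xvar (r - 1))) = fscale (?f r) (xvar (r - 1))" for r
    by (simp only: alg_hom_fscale[OF K_inv_alg_hom]) (simp only: fscale_eq_mult)
  then have "is_exp (\<lambda>r. fscale (?f r) (xvar (r - 1))) (map_fps K_inv (exp0 ?f))"
    using is_exp_hom[OF K is_exp_exp0[of ?f]] by simp
  then have "map_fps K_inv (exp0 ?f) = exp0 ?f"
    using is_exp_exp0 by (rule is_exp_uniq[OF ring_hom_single])
  then have KE: "K_inv (exp0 ?f $ m) = exp0 ?f $ m" for m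
    by (metis map_fps_nth)
  have mp: "mu_prod (\<lambda>i. mono1 (xvar i) 0 + mono1 (Fsingle 0 0) (- int (i + 1))) \<mu> = fls_const (Fsingle (\<mu>, 0) 1)"
  proof -
    show ?thesis
      by (simp add: mu_prod_xvar flip: fls_const_eq_mono1 ring_hom_mu_prod[OF ring_hom_fls_const])
  qed
  have "shift0 (\<lambda>_. 0) (qq powi (- 2)) 0 (Fsingle (\<mu>, k) 1) = fls_const (K_inv (Fsingle (\<mu>, k) 1))"
    unfolding shift0_single mp
    by (simp add: K_inv_def lin_ext_single evar_def mult_single flip: fls_const_eq_mono1 power_int_mult)
  then show ?thesis
    by (simp add: phi_def vop0_def opexp_heis_neg ring_hom_mult[OF K] KE[simplified] evar_0 mono1_1)
qed

lemma one_current_vop0: "one_current v n = vop0 (\<lambda>_. 0) 0 (\<lambda>_. 0) 1 0 v $$ n"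
proof -
  have "shift0 (\<lambda>_. 0) 1 0 v = fls_const v"
    by (induction v rule: L0_induct)
      (simp_all add: shift0_const shift0_xvar shift0_evar ring_hom_add[OF ring_hom_shift0]
        ring_hom_mult[OF ring_hom_shift0] fls_plus_const flip: fls_const_eq_mono1)
  then show ?thesis
    by (simp add: one_current_def vop0_def exp0_0 evar_0 mono1_1)
qed

section \<open>The algebra structure of the tensor power\<close>

type_synonym 'c Lc = "('c \<Rightarrow> L0_basis) \<Rightarrow>\<^sub>0 qfield"

text \<open>The embedding of the $i$-th tensor factor. Basis indices of the tensor power add
  pointwise, so its monoid algebra is the tensor power of the algebra \<open>L0\<close>.\<close>

definition slot :: "'c \<Rightarrow> L0 \<Rightarrow> 'c Lc"
  where "slot i = hom_ext (Fsingle 0) (\<lambda>b. Fsingle (\<lambda>j. if j = i then b else 0) 1)"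

lemma slot_single: "slot i (Fsingle b k) = Fsingle (\<lambda>j. if j = i then b else 0) k"
  by (simp add: slot_def hom_ext_single[OF ring_hom_single] mult_single)

lemma alg_hom_slot: "alg_hom (Fsingle 0) (slot i)"
  unfolding slot_def
proof (rule alg_hom_hom_ext[OF ring_hom_single])
  have "(\<lambda>j. if j = i then 0 else 0) = (0 :: 'a \<Rightarrow> L0_basis)"
    by (simp add: fun_eq_iff)
  then show "Fsingle (\<lambda>j. if j = i then 0 else 0 :: L0_basis) 1 = (1 :: 'a Lc)"
    by (simp only: single_one)
  show "Fsingle (\<lambda>j. if j = i then a + b else 0) 1 =
      (Fsingle (\<lambda>j. if j = i then a else 0) 1 * Fsingle (\<lambda>j. if j = i then b else 0) 1 :: 'a Lc)" for a b
    by (simp add: mult_single fun_eq_iff plus_fun_def if_distrib cong: if_cong)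
qed

lemmas ring_hom_slot = alg_hom_ring_hom[OF alg_hom_slot]
lemmas slot_const = alg_hom_scalar[OF alg_hom_slot]
lemmas slot_fscale = alg_hom_fscale[OF alg_hom_slot, folded fscale_eq_mult]

lemma prod_slot_single:
  "finite J \<Longrightarrow> (\<Prod>i\<in>J. slot i (Fsingle (b i) 1)) = Fsingle (\<lambda>j. if j \<in> J then b j else 0) 1"
proof (induction J rule: finite_induct)
  case empty
  have "(\<lambda>j. 0) = (0 :: 'a \<Rightarrow> L0_basis)"
    by (simp add: fun_eq_iff)
  then show ?case
    by (simp only: prod.empty empty_iff if_False single_one)
next
  case (insert i J)
  have "(\<lambda>j. if j = i then b i else 0) + (\<lambda>j. if j \<in> J then b j else 0) = (\<lambda>j. if j \<in> insert i J then b j else 0)"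
    using insert.hyps by (auto simp: fun_eq_iff)
  then show ?case
    unfolding prod.insert[OF insert.hyps] insert.IH by (simp only: slot_single mult_single mult_1_left)
qed

lemma Lc_single:
  fixes b :: "'c::finite \<Rightarrow> L0_basis"
  shows "Fsingle b k = Fsingle 0 k * (\<Prod>i\<in>UNIV. slot i (Fsingle (b i) 1))"
  by (simp add: prod_slot_single mult_single)

lemma Lc_induct [case_names const xvar evar add mult]:
  fixes v :: "'c::finite Lc"
  assumes const: "\<And>c. P (Fsingle 0 c)" and "\<And>i r. P (slot i (xvar r))" "\<And>i k. P (slot i (evar k))"
    and add: "\<And>u v. P u \<Longrightarrow> P v \<Longrightarrow> P (u + v)" and mult: "\<And>u v. P u \<Longrightarrow> P v \<Longrightarrow> P (u * v)"
  shows "P v"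
proof (induction v rule: single_induct)
  case (single b c)
  have slot: "P (slot i u)" for i u
  proof (induction u rule: L0_induct)
    case (add u v)
    then show ?case unfolding ring_hom_add[OF ring_hom_slot] by (rule assms)
  next
    case (mult u v)
    then show ?case unfolding ring_hom_mult[OF ring_hom_slot] by (rule assms)
  qed (simp_all only: slot_const assms(1-3))
  have prod: "P (\<Prod>i\<in>J. slot i (Fsingle (b i) 1))" if "finite J" for J
    using that
  proof (induction J rule: finite_induct)
    case empty
    show ?case using const[of 1] by (simp only: prod.empty single_one)
  next
    case (insert i J)
    show ?case unfolding prod.insert[OF insert.hyps] by (intro mult slot insert.IH)
  qed
  show ?case
    by (subst Lc_single) (intro mult const prod finite)
qed (rule add)

text \<open>\<open>w\<close> does not involve the factor \<open>i\<close>, so a basis index of the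
  product splits uniquely into its \<open>i\<close>-th component and the rest.\<close>

lemma lookup_slot_times:
  fixes w :: "'c Lc"
  assumes "\<And>f. f \<in> Poly_Mapping.keys w \<Longrightarrow> f i = 0"
  shows "lookup (slot i u * w) b' = lookup u (b' i) * lookup w (b'(i := 0))"
proof (induction u rule: single_induct)
  case (single b k)
  have *: "slot i (Fsingle b k) * Fsingle f c = Fsingle (f(i := b)) (k * c)" if "f i = 0" for f c
  proof -
    have "(\<lambda>j. if j = i then b else 0) + f = f(i := b)"
      using that by (auto simp: fun_eq_iff)
    then show ?thesis by (simp add: slot_single mult_single)
  qed
  have "slot i (Fsingle b k) * w = (\<Sum>f\<in>Poly_Mapping.keys w. slot i (Fsingle b k) * Fsingle f (lookup w f))"
    by (subst (1) sum_single_superset[OF finite_keys order_refl, of w]) (simp add: sum_distrib_left)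
  also have "\<dots> = (\<Sum>f\<in>Poly_Mapping.keys w. Fsingle (f(i := b)) (k * lookup w f))"
    using assms by (intro sum.cong refl *)
  finally have "lookup (slot i (Fsingle b k) * w) b' =
      (\<Sum>f\<in>Poly_Mapping.keys w. k * lookup w f when f(i := b) = b')"
    by (simp add: lookup_sum lookup_single)
  also have "\<dots> = (\<Sum>f\<in>Poly_Mapping.keys w. if f = b'(i := 0) then (k when b = b' i) * lookup w f else 0)"
  proof (rule sum.cong[OF refl])
    fix f assume "f \<in> Poly_Mapping.keys w"
    then have "f i = 0" by (rule assms)
    then have "f(i := b) = b' \<longleftrightarrow> f = b'(i := 0) \<and> b = b' i"
      by (auto simp: fun_eq_iff)
    then show "(k * lookup w f when f(i := b) = b') =
        (if f = b'(i := 0) then (k when b = b' i) * lookup w f else 0)"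
      by (simp add: when_def)
  qed
  also have "\<dots> = (k when b = b' i) * lookup w (b'(i := 0))"
    by (simp add: in_keys_iff)
  finally show ?case
    by (simp only: lookup_single)
qed (simp add: ring_hom_add[OF ring_hom_slot] lookup_add algebra_simps)

text \<open>Turns a product of matrix entries, as in \<open>tensor_current\<close>, into entries of
  one product in the algebra. The set \<open>J\<close> of factors is general for the sake of
  induction.\<close>

lemma lookup_prod_slot:
  fixes U :: "'c \<Rightarrow> L0 fls"
  assumes "finite J"
  shows "map_fls (\<lambda>w. lookup w b') (\<Prod>i\<in>J. map_fls (slot i) (U i)) =
    (if \<forall>j. j \<notin> J \<longrightarrow> b' j = 0 then \<Prod>i\<in>J. map_fls (\<lambda>u. lookup u (b' i)) (U i) else 0)"
  using assms
proof (induction J arbitrary: b' rule: finite_induct)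
  case empty
  have "(\<forall>j. b' j = 0) \<longleftrightarrow> b' = 0"
    by (auto simp: fun_eq_iff)
  then show ?case
    by (auto simp: map_fls_nth lookup_one fls_one_nth when_def zero_fun_def intro!: fls_eqI)
next
  case (insert i J)
  let ?G = "\<Prod>i\<in>J. map_fls (slot i) (U i)" and ?F = "map_fls (slot i) (U i)"
  have G: "lookup (?G $$ n) b = (if \<forall>j. j \<notin> J \<longrightarrow> b j = 0
      then (\<Prod>i\<in>J. map_fls (\<lambda>u. lookup u (b i)) (U i)) $$ n else 0)" for n b
    using arg_cong[OF insert.IH[of b], of "\<lambda>F. F $$ n"] by (auto simp: map_fls_nth split: if_splits)
  have keys: "f i = 0" if "f \<in> Poly_Mapping.keys (?G $$ n)" for f n
    using that insert.hyps(2) by (auto simp: in_keys_iff G split: if_splits)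
  have s0: "slot i 0 = 0"
    by (rule ring_hom_0[OF ring_hom_slot])
  have dist: "A * (if P then B else 0) = (if P then A * B else 0)" for A B :: "qfield fls" and P
    by simp
  let ?M = "fls_subdegree (U i)" and ?N = "fls_subdegree ?G"
  show ?case
  proof (rule fls_eqI)
    fix n
    have "lookup ((?F * ?G) $$ n) b' =
        (\<Sum>k=?M..n - ?N. lookup (U i $$ k) (b' i) * lookup (?G $$ (n - k)) (b'(i := 0)))"
      by (subst fls_times_nth_between[of ?M _ ?N]) (auto simp: map_fls_nth s0 lookup_sum lookup_slot_times keys)
    also have "\<dots> = (map_fls (\<lambda>u. lookup u (b' i)) (U i) *
        map_fls (\<lambda>w. lookup w (b'(i := 0))) ?G) $$ n"
      by (subst fls_times_nth_between[of ?M _ ?N]) (auto simp: map_fls_nth)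
    also have "map_fls (\<lambda>w. lookup w (b'(i := 0))) ?G =
        (if \<forall>j. j \<notin> insert i J \<longrightarrow> b' j = 0 then \<Prod>i\<in>J. map_fls (\<lambda>u. lookup u (b' i)) (U i) else 0)"
    proof -
      have "(\<Prod>j\<in>J. map_fls (\<lambda>u. lookup u ((b'(i := 0)) j)) (U j)) =
          (\<Prod>j\<in>J. map_fls (\<lambda>u. lookup u (b' j)) (U j))"
        using insert.hyps(2) by (intro prod.cong) auto
      moreover have "(\<forall>j. j \<notin> J \<longrightarrow> (b'(i := 0)) j = 0) \<longleftrightarrow> (\<forall>j. j \<notin> insert i J \<longrightarrow> b' j = 0)"
        using insert.hyps(2) by auto
      ultimately show ?thesis
        unfolding insert.IH by (simp only:)
    qed
    finally show "map_fls (\<lambda>w. lookup w b') (\<Prod>i\<in>insert i J. map_fls (slot i) (U i)) $$ n =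
        (if \<forall>j. j \<notin> insert i J \<longrightarrow> b' j = 0
         then \<Prod>i\<in>insert i J. map_fls (\<lambda>u. lookup u (b' i)) (U i) else 0) $$ n"
      by (simp only: prod.insert[OF insert.hyps] dist map_fls_nth lookup_zero)
  qed
qed

section \<open>Vertex operators on the tensor power\<close>

definition shiftc :: "('c::finite \<Rightarrow> nat \<Rightarrow> qfield) \<Rightarrow> ('c \<Rightarrow> qfield) \<Rightarrow> ('c \<Rightarrow> int) \<Rightarrow> 'c Lc \<Rightarrow> 'c Lc fls"
  where "shiftc \<sigma> \<kappa> \<delta> = hom_ext (\<lambda>k. fls_const (Fsingle 0 k))
    (\<lambda>b. \<Prod>i\<in>UNIV. map_fls (slot i) (shift0 (\<sigma> i) (\<kappa> i) (\<delta> i) (Fsingle (b i) 1)))"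

lemmas ring_hom_map_slot = ring_hom_map_fls[OF ring_hom_slot]

lemma map_slot_mono1: "map_fls (slot i) (mono1 c a) = mono1 (slot i c) a"
  by (rule fls_eqI) (simp add: map_fls_nth mono1_nth ring_hom_0[OF ring_hom_slot])

lemma alg_hom_shiftc:
  assumes "\<And>i. \<kappa> i \<noteq> 0"
  shows "alg_hom (\<lambda>k. fls_const (Fsingle 0 k)) (shiftc \<sigma> \<kappa> \<delta>)"
  unfolding shiftc_def
proof (rule alg_hom_hom_ext[OF ring_hom_fconst], goal_cases)
  case 1
  show ?case
    by (simp add: ring_hom_1[OF ring_hom_shift0[OF assms]] ring_hom_1[OF ring_hom_map_slot])
next
  case (2 a b)
  have "Fsingle (a i + b i) 1 = (Fsingle (a i) 1 * Fsingle (b i) 1 :: L0)" for i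
    by (simp add: mult_single)
  then show ?case
    by (simp add: ring_hom_mult[OF ring_hom_shift0[OF assms]] ring_hom_mult[OF ring_hom_map_slot] prod.distrib)
qed

lemmas ring_hom_shiftc = alg_hom_ring_hom[OF alg_hom_shiftc]

lemma shiftc_slot:
  assumes "\<And>i. \<kappa> i \<noteq> 0"
  shows "shiftc \<sigma> \<kappa> \<delta> (slot i u) = map_fls (slot i) (shift0 (\<sigma> i) (\<kappa> i) (\<delta> i) u)"
proof (induction u rule: single_induct)
  case (single b k)
  have 1: "map_fls (slot j) (shift0 (\<sigma> j) (\<kappa> j) (\<delta> j) (Fsingle (if j = i then b else 0) 1)) =
      (if j = i then map_fls (slot i) (shift0 (\<sigma> i) (\<kappa> i) (\<delta> i) (Fsingle b 1)) else 1)" for j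
    by (simp add: ring_hom_1[OF ring_hom_shift0[OF assms]] ring_hom_1[OF ring_hom_map_slot])
  have 2: "shift0 (\<sigma> i) (\<kappa> i) (\<delta> i) (Fsingle b k) = mono1 (Fsingle 0 k) 0 * shift0 (\<sigma> i) (\<kappa> i) (\<delta> i) (Fsingle b 1)"
    using alg_hom_fscale[OF alg_hom_shift0[OF assms], of "\<sigma> i" i "\<delta> i" k "Fsingle b 1"]
    by (simp add: fls_const_eq_mono1)
  show ?case
    unfolding slot_single shiftc_def hom_ext_single[OF ring_hom_fconst] 1 2
    by (simp add: ring_hom_mult[OF ring_hom_map_slot] map_slot_mono1 slot_const fls_const_eq_mono1)
qed (simp add: ring_hom_add[OF ring_hom_slot] ring_hom_add[OF ring_hom_shiftc[OF assms]]
    ring_hom_add[OF ring_hom_map_slot] ring_hom_add[OF ring_hom_shift0[OF assms]])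

lemma
  assumes "\<And>i. \<kappa> i \<noteq> 0"
  shows shiftc_const: "shiftc \<sigma> \<kappa> \<delta> (Fsingle 0 c) = mono1 (Fsingle 0 c) 0"
    and shiftc_xvar: "shiftc \<sigma> \<kappa> \<delta> (slot i (xvar r)) =
      mono1 (slot i (xvar r)) 0 + mono1 (Fsingle 0 (\<sigma> i (r + 1))) (- int (r + 1))"
    and shiftc_evar: "shiftc \<sigma> \<kappa> \<delta> (slot i (evar k)) = mono1 (fscale (\<kappa> i powi k) (slot i (evar k))) (\<delta> i * k)"
  using alg_hom_scalar[OF alg_hom_shiftc[OF assms]]
  by (simp_all add: fls_const_eq_mono1 shiftc_slot[OF assms] shift0_xvar shift0_evar
    ring_hom_add[OF ring_hom_map_slot] map_slot_mono1 slot_const slot_fscale)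

definition expc :: "('c::finite \<Rightarrow> nat \<Rightarrow> qfield) \<Rightarrow> 'c Lc fps"
  where "expc f = (\<Prod>i\<in>UNIV. map_fps (slot i) (exp0 (f i)))"

definition evarc :: "('c::finite \<Rightarrow> int) \<Rightarrow> 'c Lc"
  where "evarc s = (\<Prod>i\<in>UNIV. slot i (evar (s i)))"

definition linc :: "('c::finite \<Rightarrow> nat \<Rightarrow> qfield) \<Rightarrow> nat \<Rightarrow> 'c Lc"
  where "linc f r = (\<Sum>i\<in>UNIV. fscale (f i r) (slot i (xvar (r - 1))))"

definition vopc :: "('c::finite \<Rightarrow> nat \<Rightarrow> qfield) \<Rightarrow> ('c \<Rightarrow> int) \<Rightarrow> ('c \<Rightarrow> nat \<Rightarrow> qfield) \<Rightarrow>
    ('c \<Rightarrow> qfield) \<Rightarrow> ('c \<Rightarrow> int) \<Rightarrow> 'c Lc \<Rightarrow> 'c Lc fls"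
  where "vopc f s \<sigma> \<kappa> \<delta> v = fps_to_fls (expc f) * mono1 (evarc s) 0 * shiftc \<sigma> \<kappa> \<delta> v"

lemma is_exp_expc: "is_exp (linc f) (expc f)"
proof -
  have "is_exp (\<lambda>r. slot i (fscale (f i r) (xvar (r - 1)))) (map_fps (slot i) (exp0 (f i)))" for i
    by (rule is_exp_hom[OF ring_hom_slot is_exp_exp0])
  then have "is_exp (\<lambda>r. \<Sum>i\<in>UNIV. slot i (fscale (f i r) (xvar (r - 1)))) (expc f)"
    unfolding expc_def by (intro is_exp_prod) auto
  then show ?thesis
    by (simp add: linc_def[abs_def] slot_fscale)
qed

lemma expc_add: "expc (\<lambda>i r. f i r + g i r) = expc f * expc g"
proof (rule is_exp_uniq[OF ring_hom_single is_exp_expc])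
  have "linc (\<lambda>i r. f i r + g i r) = (\<lambda>r. linc f r + linc g r)"
    by (simp add: linc_def fun_eq_iff fvec.scale_left_distrib sum.distrib)
  then show "is_exp (linc (\<lambda>i r. f i r + g i r)) (expc f * expc g)"
    using is_exp_mult[OF is_exp_expc is_exp_expc] by simp
qed

lemma evarc_add: "evarc (\<lambda>i. s i + t i) = evarc s * evarc t"
  by (simp add: evarc_def evar_add ring_hom_mult[OF ring_hom_slot] prod.distrib)

text \<open>Matrix entries see the factors at basis vectors only, which is why \<open>A\<close> is
  assumed only there. The entries assemble to a product of slots, and the three kinds of parts are
  collected separately.\<close>

lemma tensor_current_vopc:
  fixes A :: "'c::finite \<Rightarrow> L0_basis fseries"
  assumes A: "\<And>i b n. A i (Fsingle b 1) n = vop0 (f i) (s i) (\<sigma> i) (\<kappa> i) (\<delta> i) (Fsingle b 1) $$ n"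
    and \<kappa>: "\<And>i. \<kappa> i \<noteq> 0"
  shows "tensor_current A v n = vopc f s \<sigma> \<kappa> \<delta> v $$ n"
proof (induction v rule: single_induct)
  case (single b k)
  let ?U = "\<lambda>i. vop0 (f i) (s i) (\<sigma> i) (\<kappa> i) (\<delta> i) (Fsingle (b i) 1)"
  have "mat_entry (A i) (b' i) (b i) = map_fls (\<lambda>u. lookup u (b' i)) (?U i)" for i b'
    by (simp add: mat_entry_def map_fls_def A)
  then have "fls_nth (\<Prod>i\<in>UNIV. mat_entry (A i) (b' i) (b i)) n =
      lookup ((\<Prod>i\<in>UNIV. map_fls (slot i) (?U i)) $$ n) b'" for b'
    using arg_cong[OF lookup_prod_slot[of UNIV b' ?U], of "\<lambda>F. F $$ n"] by (simp add: map_fls_nth)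
  then have "tensor_current A (Fsingle b k) n = fscale k ((\<Prod>i\<in>UNIV. map_fls (slot i) (?U i)) $$ n)"
    by (simp add: tensor_current_def lin_ext_single)
  also have "(\<Prod>i\<in>UNIV. map_fls (slot i) (?U i)) = vopc f s \<sigma> \<kappa> \<delta> (Fsingle b 1)"
  proof -
    have e: "fps_to_fls (expc f) = (\<Prod>i\<in>UNIV. map_fls (slot i) (fps_to_fls (exp0 (f i))))"
      unfolding expc_def ring_hom_prod[OF ring_hom_fps_to_fls]
      by (simp add: map_fls_fps_to_fls ring_hom_0[OF ring_hom_slot])
    have "mono1 (evarc s) 0 = (\<Prod>i\<in>UNIV. mono1 (slot i (evar (s i))) 0)"
      by (simp add: evarc_def ring_hom_prod[OF ring_hom_fls_const] flip: fls_const_eq_mono1)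
    then show ?thesis
      unfolding vopc_def e shiftc_def hom_ext_single[OF ring_hom_fconst]
      by (simp add: vop0_def ring_hom_mult[OF ring_hom_map_slot] map_slot_mono1 prod.distrib)
  qed
  also have "fscale k (vopc f s \<sigma> \<kappa> \<delta> (Fsingle b 1) $$ n) = vopc f s \<sigma> \<kappa> \<delta> (Fsingle b k) $$ n"
  proof -
    have "shiftc \<sigma> \<kappa> \<delta> (Fsingle b k) = mono1 (Fsingle 0 k) 0 * shiftc \<sigma> \<kappa> \<delta> (Fsingle b 1)"
      using alg_hom_fscale[OF alg_hom_shiftc[OF \<kappa>], where k = k and v = "Fsingle b 1"]
      by (simp add: fls_const_eq_mono1)
    then have "vopc f s \<sigma> \<kappa> \<delta> (Fsingle b k) = mono1 (Fsingle 0 k) 0 * vopc f s \<sigma> \<kappa> \<delta> (Fsingle b 1)"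
      by (simp add: vopc_def ac_simps)
    then show ?thesis
      by (simp add: mono1_times_nth fscale_eq_mult)
  qed
  finally show ?case .
next
  case (add u v)
  then show ?case
    by (simp add: tensor_current_def lin_ext_eq_hom_ext hom_ext_add[OF ring_hom_single] vopc_def
      ring_hom_add[OF ring_hom_shiftc[OF \<kappa>]] distrib_left)
qed

lemma is_exp_cong: "(\<And>r. 1 \<le> r \<Longrightarrow> g r = h r) \<Longrightarrow> is_exp g E \<longleftrightarrow> is_exp h E"
  unfolding is_exp_iff by (auto cong: sum.cong_simp)

text \<open>\<open>ratio h\<close> is the series $h(z_2/z_1)$.\<close>

definition ratio :: "qfield fps \<Rightarrow> ('b::comm_monoid_add \<Rightarrow>\<^sub>0 qfield) fls fls"
  where "ratio h = fps_to_fls (Abs_fps (\<lambda>j. mono1 (Fsingle 0 (h $ j)) (- int j)))"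

lemma ratio_mult: "ratio (g * h) = (ratio g * ratio h :: ('b::comm_monoid_add \<Rightarrow>\<^sub>0 qfield) fls fls)"
proof -
  have "mono1 (Fsingle 0 ((g * h) $ n)) (- int n) =
      (\<Sum>i=0..n. mono1 (Fsingle 0 (g $ i)) (- int i) * mono1 (Fsingle 0 (h $ (n - i))) (- int (n - i)) :: ('b \<Rightarrow>\<^sub>0 qfield) fls)" for n
  proof -
    have "mono1 (Fsingle 0 ((g * h) $ n)) (- int n) =
        (\<Sum>i=0..n. mono1 (Fsingle 0 (g $ i * h $ (n - i))) (- int n) :: ('b \<Rightarrow>\<^sub>0 qfield) fls)"
      by (rule fls_eqI) (simp add: mono1_nth fls_nth_sum fps_mult_nth ring_hom_sum[OF ring_hom_single])
    also have "\<dots> = (\<Sum>i=0..n. mono1 (Fsingle 0 (g $ i)) (- int i) * mono1 (Fsingle 0 (h $ (n - i))) (- int (n - i)))"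
      by (intro sum.cong refl) (auto simp: mono1_mult mult_single of_nat_diff)
    finally show ?thesis .
  qed
  then show ?thesis
    unfolding ratio_def fls_times_fps_to_fls[symmetric]
    by (intro arg_cong[of _ _ fps_to_fls] fps_ext) (simp only: fps_mult_nth[of "Abs_fps _"] fps_nth_Abs_fps)
qed

lemma ratio_poly:
  assumes "degree u \<le> d"
  shows "ratio (fps_of_poly u) = (\<Sum>k\<le>d. mono2 (Fsingle 0 (coeff u k)) (- int k) (int k))"
proof (intro fls_eqI)
  fix n2 n1
  have "(\<Sum>k\<le>d. mono2 (Fsingle 0 (coeff u k)) (- int k) (int k) :: ('a \<Rightarrow>\<^sub>0 qfield) fls fls) $$ n2 $$ n1 =
      (\<Sum>k\<le>d. if k = nat n2 then (if n1 = - n2 \<and> 0 \<le> n2 then Fsingle 0 (coeff u k) else 0) else 0)"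
    unfolding fls_nth_sum
  proof (rule sum.cong[OF refl])
    fix k
    show "(mono2 (Fsingle 0 (coeff u k)) (- int k) (int k) :: ('a \<Rightarrow>\<^sub>0 qfield) fls fls) $$ n2 $$ n1 =
        (if k = nat n2 then (if n1 = - n2 \<and> 0 \<le> n2 then Fsingle 0 (coeff u k) else 0) else 0)"
      unfolding mono2_nth by (cases "n2 = int k") auto
  qed
  also have "\<dots> = (if n1 = - n2 \<and> 0 \<le> n2 then Fsingle 0 (coeff u (nat n2)) else 0)"
  proof (cases "nat n2 \<le> d")
    case False
    then have "coeff u (nat n2) = 0"
      using assms by (intro coeff_eq_0) linarith
    then show ?thesis
      using False by simp
  qed simp
  also have "\<dots> = ratio (fps_of_poly u) $$ n2 $$ n1"
    by (cases "0 \<le> n2") (simp_all add: ratio_def mono1_nth)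
  finally show "ratio (fps_of_poly u) $$ n2 $$ n1 =
      (\<Sum>k\<le>d. mono2 (Fsingle 0 (coeff u k)) (- int k) (int k) :: ('a \<Rightarrow>\<^sub>0 qfield) fls fls) $$ n2 $$ n1"
    by (rule sym)
qed

text \<open>On the diagonal $z_2/z_1$ becomes 1.\<close>

lemma lpoly2_ratio: "lpoly2 (ratio (fps_of_poly u)) (mono1 (Fsingle 0 (poly u 1)) 0)"
proof -
  have "lpoly2 (\<Sum>k\<le>degree u. mono2 (Fsingle 0 (coeff u k)) (- int k) (int k))
      (\<Sum>k\<le>degree u. mono1 (Fsingle 0 (coeff u k)) 0)"
    by (rule lpoly2_sum[OF finite_atMost]) (rule lpoly2_monoI[OF refl], simp)
  also have "(\<Sum>k\<le>degree u. mono1 (Fsingle 0 (coeff u k)) 0) = mono1 (Fsingle 0 (poly u 1)) 0"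
    by (simp add: poly_altdef ring_hom_sum[OF ring_hom_fconst] flip: fls_const_eq_mono1)
  finally show ?thesis
    by (simp add: ratio_poly[OF order_refl])
qed

context
  fixes \<sigma> :: "'c::finite \<Rightarrow> nat \<Rightarrow> qfield" and \<kappa> :: "'c \<Rightarrow> qfield" and \<delta> :: "'c \<Rightarrow> int"
  assumes \<kappa>: "\<And>i. \<kappa> i \<noteq> 0"
begin

lemma shiftc_linc:
  assumes "1 \<le> r"
  shows "shiftc \<sigma> \<kappa> \<delta> (linc f r) = fls_const (linc f r) + mono1 (Fsingle 0 (\<Sum>i\<in>UNIV. f i r * \<sigma> i r)) (- int r)"
proof -
  note hom = ring_hom_shiftc[OF \<kappa>]
  have "shiftc \<sigma> \<kappa> \<delta> (fscale (f i r) (slot i (xvar (r - 1)))) =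
      fls_const (fscale (f i r) (slot i (xvar (r - 1)))) + mono1 (Fsingle 0 (f i r * \<sigma> i r)) (- int r)" for i
    using assms
    by (simp add: alg_hom_fscale[OF alg_hom_shiftc[OF \<kappa>]] shiftc_xvar[OF \<kappa>])
      (simp add: fls_const_eq_mono1 distrib_left mono1_mult mult_single fscale_eq_mult)
  moreover have "(\<Sum>i\<in>A. mono1 (h i) a) = mono1 (\<Sum>i\<in>A. h i) a" for A :: "'c set" and h :: "'c \<Rightarrow> 'c Lc" and a
    by (rule fls_eqI) (simp add: mono1_nth fls_nth_sum)
  ultimately show ?thesis
    by (simp add: linc_def ring_hom_sum[OF hom] ring_hom_sum[OF ring_hom_fls_const] ring_hom_sum[OF ring_hom_single] sum.distrib)
qed

lemma shiftc_expc:
  assumes "is_exp \<tau> \<rho>" and \<tau>: "\<And>r. 1 \<le> r \<Longrightarrow> \<tau> r = (\<Sum>i\<in>UNIV. f i r * \<sigma> i r)"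
  shows "map_fls (shiftc \<sigma> \<kappa> \<delta>) (fps_to_fls (expc f)) = fps_to_fls (map_fps fls_const (expc f)) * ratio \<rho>"
proof -
  note hom = ring_hom_shiftc[OF \<kappa>, where \<sigma> = \<sigma> and \<delta> = \<delta>]
  have pow: "mono1 1 (- 1) ^ r * fls_const (Fsingle 0 k) = (mono1 (Fsingle 0 k) (- int r) :: 'c Lc fls)" for r k
    by (simp add: mono1_power mono1_mult fls_const_eq_mono1)
  have "is_exp (\<lambda>r. mono1 1 (- 1) ^ r * fls_const (Fsingle 0 (\<tau> r)))
      (Abs_fps (\<lambda>n. mono1 1 (- 1) ^ n * map_fps (\<lambda>k. fls_const (Fsingle (0 :: 'c \<Rightarrow> L0_basis) k)) \<rho> $ n))"
    by (rule is_exp_dilate) (rule is_exp_hom[OF ring_hom_fconst assms(1)])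
  then have \<rho>: "is_exp (\<lambda>r. mono1 (Fsingle 0 (\<tau> r)) (- int r))
      (Abs_fps (\<lambda>j. mono1 (Fsingle 0 (\<rho> $ j)) (- int j) :: 'c Lc fls))"
    by (simp only: pow map_fps_nth)
  have "is_exp (\<lambda>r. fls_const (linc f r) + mono1 (Fsingle 0 (\<tau> r)) (- int r))
      (map_fps fls_const (expc f) * Abs_fps (\<lambda>j. mono1 (Fsingle 0 (\<rho> $ j)) (- int j)))"
    by (rule is_exp_mult[OF is_exp_hom[OF ring_hom_fls_const is_exp_expc] \<rho>])
  moreover have "is_exp (\<lambda>r. fls_const (linc f r) + mono1 (Fsingle 0 (\<tau> r)) (- int r)) (map_fps (shiftc \<sigma> \<kappa> \<delta>) (expc f))"
    using is_exp_hom[OF hom is_exp_expc[of f]]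
    by (subst is_exp_cong[where h = "\<lambda>r. shiftc \<sigma> \<kappa> \<delta> (linc f r)"]) (simp_all add: shiftc_linc \<tau>)
  ultimately have "map_fps (shiftc \<sigma> \<kappa> \<delta>) (expc f) =
      map_fps fls_const (expc f) * Abs_fps (\<lambda>j. mono1 (Fsingle 0 (\<rho> $ j)) (- int j))"
    by (rule is_exp_uniq[OF ring_hom_fconst, symmetric])
  then show ?thesis
    by (simp add: map_fls_fps_to_fls ring_hom_0[OF hom] ratio_def fls_times_fps_to_fls)
qed

lemma map_shiftc_mono1: "shiftc \<sigma> \<kappa> \<delta> c = mono1 d a \<Longrightarrow> map_fls (shiftc \<sigma> \<kappa> \<delta>) (mono1 c b) = mono2 d a b"
  by (intro fls_eqI) (simp add: map_fls_nth ring_hom_0[OF ring_hom_shiftc[OF \<kappa>]] mono1_nth mono2_nth)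

lemma shiftc_evarc:
  "shiftc \<sigma> \<kappa> \<delta> (evarc s) = mono1 (fscale (\<Prod>i\<in>UNIV. \<kappa> i powi s i) (evarc s)) (\<Sum>i\<in>UNIV. \<delta> i * s i)"
proof -
  have *: "(\<Prod>i\<in>J. mono1 (fscale (\<kappa> i powi s i) (slot i (evar (s i)))) (\<delta> i * s i)) =
      mono1 (fscale (\<Prod>i\<in>J. \<kappa> i powi s i) (\<Prod>i\<in>J. slot i (evar (s i)))) (\<Sum>i\<in>J. \<delta> i * s i)" for J
    by (induction J rule: infinite_finite_induct) (simp_all add: mono1_1 mono1_mult fscale_mult_fscale)
  show ?thesis
    unfolding evarc_def ring_hom_prod[OF ring_hom_shiftc[OF \<kappa>]] shiftc_evar[OF \<kappa>] by (rule *)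
qed

text \<open>Applied to a vector, two translations give a Laurent polynomial, and on the diagonal
  their parameters combine. Both facts are multiplicative in \<open>v\<close> and are checked on
  generators.\<close>

lemma lpoly2_shiftc:
  assumes \<kappa>': "\<And>i. \<kappa>' i \<noteq> 0"
  shows "lpoly2 (map_fls (shiftc \<sigma> \<kappa> \<delta>) (shiftc \<sigma>' \<kappa>' \<delta>' v))
    (shiftc (\<lambda>i r. \<sigma> i r + \<sigma>' i r) (\<lambda>i. \<kappa> i * \<kappa>' i) (\<lambda>i. \<delta> i + \<delta>' i) v)"
proof -
  have \<kappa>\<kappa>': "\<kappa> i * \<kappa>' i \<noteq> 0" for i
    using \<kappa> \<kappa>' by simp
  note hom = ring_hom_map_fls[OF ring_hom_shiftc[OF \<kappa>]] ring_hom_shiftc[OF \<kappa>'] ring_hom_shiftc[OF \<kappa>\<kappa>']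
  note val = shiftc_const[OF \<kappa>'] shiftc_const[OF \<kappa>\<kappa>'] shiftc_xvar[OF \<kappa>'] shiftc_xvar[OF \<kappa>\<kappa>'] shiftc_evar[OF \<kappa>'] shiftc_evar[OF \<kappa>\<kappa>']
  have mono: "lpoly2 (mono2 c a b) (mono1 c d)" if "d = a + b" for c :: "'c Lc" and a b d
    unfolding that by (rule lpoly2_mono)
  show ?thesis
  proof (induction v rule: Lc_induct)
    case (const c)
    show ?case
      unfolding val map_shiftc_mono1[OF shiftc_const[OF \<kappa>]] by (rule mono) simp
  next
    case (xvar i r)
    let ?x = "slot i (xvar r)"
    have "map_fls (shiftc \<sigma> \<kappa> \<delta>) (mono1 ?x 0) = mono2 ?x 0 0 + mono2 (Fsingle 0 (\<sigma> i (r + 1))) (- int (r + 1)) 0"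
      by (intro fls_eqI) (auto simp: map_fls_nth ring_hom_0[OF ring_hom_shiftc[OF \<kappa>]] mono1_nth mono2_nth shiftc_xvar[OF \<kappa>])
    moreover have "map_fls (shiftc \<sigma> \<kappa> \<delta>) (mono1 (Fsingle 0 (\<sigma>' i (r + 1))) (- int (r + 1))) =
        mono2 (Fsingle 0 (\<sigma>' i (r + 1))) 0 (- int (r + 1))"
      by (rule map_shiftc_mono1) (simp add: shiftc_const[OF \<kappa>])
    moreover have "mono1 ?x 0 + mono1 (Fsingle 0 (\<sigma> i (r + 1) + \<sigma>' i (r + 1))) (- int (r + 1)) =
        mono1 ?x 0 + mono1 (Fsingle 0 (\<sigma> i (r + 1))) (- int (r + 1)) + mono1 (Fsingle 0 (\<sigma>' i (r + 1))) (- int (r + 1))"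
      by (simp add: single_add mono1_add add.assoc)
    ultimately show ?case
      unfolding val ring_hom_add[OF hom(1)]
      by (simp only:) (intro lpoly2_add mono; simp only: add_0_left add_0_right)
  next
    case (evar i k)
    have "shiftc \<sigma> \<kappa> \<delta> (fscale (\<kappa>' i powi k) (slot i (evar k))) =
        mono1 (fscale ((\<kappa> i * \<kappa>' i) powi k) (slot i (evar k))) (\<delta> i * k)"
      by (simp add: alg_hom_fscale[OF alg_hom_shiftc[OF \<kappa>]] shiftc_evar[OF \<kappa>] fls_const_eq_mono1 mono1_mult
        power_int_mult_distrib mult.commute flip: fscale_eq_mult)
    then have "map_fls (shiftc \<sigma> \<kappa> \<delta>) (mono1 (fscale (\<kappa>' i powi k) (slot i (evar k))) (\<delta>' i * k)) =
        mono2 (fscale ((\<kappa> i * \<kappa>' i) powi k) (slot i (evar k))) (\<delta> i * k) (\<delta>' i * k)"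
      by (rule map_shiftc_mono1)
    then show ?case
      unfolding val by (simp only:) (intro mono; simp only: distrib_right)
  next
    case (add u v)
    then show ?case
      unfolding ring_hom_add[OF hom(1)] ring_hom_add[OF hom(2)] ring_hom_add[OF hom(3)] by (rule lpoly2_add)
  next
    case (mult u v)
    then show ?case
      unfolding ring_hom_mult[OF hom(1)] ring_hom_mult[OF hom(2)] ring_hom_mult[OF hom(3)] by (rule lpoly2_mult)
  qed
qed

lemma diag_vopc:
  assumes \<kappa>': "\<And>i. \<kappa>' i \<noteq> 0"
    and \<tau>: "is_exp \<tau> \<rho>" "\<And>r. 1 \<le> r \<Longrightarrow> \<tau> r = (\<Sum>i\<in>UNIV. f' i r * \<sigma> i r)"
    and p: "fps_of_poly p * \<rho> = fps_of_poly u"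
  shows "diag (ratio (fps_of_poly p) * map_fls (vopc f s \<sigma> \<kappa> \<delta>) (vopc f' s' \<sigma>' \<kappa>' \<delta>' v))
    (mono1 (Fsingle 0 (poly u 1 * (\<Prod>i\<in>UNIV. \<kappa> i powi s' i))) (\<Sum>i\<in>UNIV. \<delta> i * s' i) *
      vopc (\<lambda>i r. f i r + f' i r) (\<lambda>i. s i + s' i) (\<lambda>i r. \<sigma> i r + \<sigma>' i r) (\<lambda>i. \<kappa> i * \<kappa>' i) (\<lambda>i. \<delta> i + \<delta>' i) v)"
proof -
  let ?S = "shiftc \<sigma> \<kappa> \<delta>" and ?S' = "shiftc \<sigma>' \<kappa>' \<delta>' v"
  let ?S'' = "shiftc (\<lambda>i r. \<sigma> i r + \<sigma>' i r) (\<lambda>i. \<kappa> i * \<kappa>' i) (\<lambda>i. \<delta> i + \<delta>' i) v"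
  let ?K = "\<Prod>i\<in>UNIV. \<kappa> i powi s' i" and ?d = "\<Sum>i\<in>UNIV. \<delta> i * s' i"
  note hom = ring_hom_map_fls[OF ring_hom_shiftc[OF \<kappa>, where \<sigma> = \<sigma> and \<delta> = \<delta>]]
  have "map_fls (vopc f s \<sigma> \<kappa> \<delta>) F = fls_const (fps_to_fls (expc f) * mono1 (evarc s) 0) * map_fls ?S F" for F
    by (intro fls_eqI) (simp add: map_fls_nth vopc_def ring_hom_0[OF ring_hom_shiftc[OF \<kappa>]])
  then have "ratio (fps_of_poly p) * map_fls (vopc f s \<sigma> \<kappa> \<delta>) (vopc f' s' \<sigma>' \<kappa>' \<delta>' v) =
      ratio (fps_of_poly p) * (fls_const (fps_to_fls (expc f) * mono1 (evarc s) 0) *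
        (fps_to_fls (map_fps fls_const (expc f')) * ratio \<rho> * mono2 (fscale ?K (evarc s')) ?d 0 * map_fls ?S ?S'))"
    by (simp only: vopc_def[of f'] ring_hom_mult[OF hom] shiftc_expc[OF \<tau>] map_shiftc_mono1[OF shiftc_evarc])
  also have "\<dots> = (fls_const (fps_to_fls (expc f)) * fps_to_fls (map_fps fls_const (expc f'))) *
      (mono2 (evarc s) 0 0 * mono2 (fscale ?K (evarc s')) ?d 0 * ratio (fps_of_poly u) * map_fls ?S ?S')"
  proof -
    have "fls_const (fps_to_fls (expc f) * mono1 (evarc s) 0) = fls_const (fps_to_fls (expc f)) * mono2 (evarc s) 0 0"
      by (simp add: mono2_def mono1_def)
    moreover have "ratio (fps_of_poly u) = (ratio (fps_of_poly p) * ratio \<rho> :: 'c Lc fls fls)"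
      unfolding p[symmetric] by (rule ratio_mult)
    ultimately show ?thesis
      by (simp only: mult_ac)
  qed
  finally have eq: "ratio (fps_of_poly p) * map_fls (vopc f s \<sigma> \<kappa> \<delta>) (vopc f' s' \<sigma>' \<kappa>' \<delta>' v) = \<dots>" .
  have "diag \<dots> (fps_to_fls (expc f * expc f') *
      (mono1 (evarc s) (0 + 0) * mono1 (fscale ?K (evarc s')) (?d + 0) * mono1 (Fsingle 0 (poly u 1)) 0 * ?S''))"
    by (intro diag_times_lpoly2 diag_fps lpoly2_mult lpoly2_mono lpoly2_ratio lpoly2_shiftc \<kappa>')
  also have "fps_to_fls (expc f * expc f') *
      (mono1 (evarc s) (0 + 0) * mono1 (fscale ?K (evarc s')) (?d + 0) * mono1 (Fsingle 0 (poly u 1)) 0 * ?S'') =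
    mono1 (Fsingle 0 (poly u 1 * ?K)) ?d *
      vopc (\<lambda>i r. f i r + f' i r) (\<lambda>i. s i + s' i) (\<lambda>i r. \<sigma> i r + \<sigma>' i r) (\<lambda>i. \<kappa> i * \<kappa>' i) (\<lambda>i. \<delta> i + \<delta>' i) v"
  proof -
    have u: "Fsingle 0 (poly u 1 * ?K) = (Fsingle 0 (poly u 1) * Fsingle 0 ?K :: 'c Lc)"
      by (simp add: mult_single)
    have e: "mono1 (evarc s) (0 + 0) * mono1 (fscale ?K (evarc s')) (?d + 0) * mono1 (Fsingle 0 (poly u 1)) 0 =
        mono1 (Fsingle 0 (poly u 1 * ?K)) ?d * mono1 (evarc (\<lambda>i. s i + s' i)) 0"
      unfolding mono1_mult evarc_add fscale_eq_mult u by (simp add: mult_ac)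
    show ?thesis
      unfolding e vopc_def expc_add fls_times_fps_to_fls by (simp only: mult_ac)
  qed
  finally show ?thesis
    unfolding eq .
qed

end

section \<open>Limits of products of currents\<close>

definition limit :: "qfield poly \<Rightarrow> 'b fseries \<Rightarrow> 'b fseries \<Rightarrow> 'b fseries \<Rightarrow> bool"
  where "limit p a b c \<longleftrightarrow> regular p a b \<and> (\<forall>v n. Sum_any (\<lambda>i. reg p a b v i (n - i)) = c v n)"

lemma reg_superset:
  assumes "degree p \<le> d"
  shows "reg p a b v n1 n2 = (\<Sum>k\<le>d. fscale (coeff p k) (a (b v (n2 - int k)) (n1 + int k)))"
  unfolding reg_def
  by (rule sum.mono_neutral_left) (use assms in \<open>auto simp: coeff_eq_0\<close>)

lemma reg_add_poly: "reg (p + q) a b v n1 n2 = reg p a b v n1 n2 + reg q a b v n1 n2"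
proof -
  let ?d = "max (degree p) (degree q)"
  have "reg r a b v n1 n2 = (\<Sum>k\<le>?d. fscale (coeff r k) (a (b v (n2 - int k)) (n1 + int k)))"
    if "degree r \<le> ?d" for r
    using that by (rule reg_superset)
  then show ?thesis
    using degree_add_le_max[of p q] by (simp add: fvec.scale_left_distrib sum.distrib)
qed

lemma reg_smult: "reg (smult k p) a b v n1 n2 = fscale k (reg p a b v n1 n2)"
  by (subst reg_superset[OF degree_smult_le]) (simp add: reg_def fvec.scale_sum_right)

lemma reg_pCons_0: "reg (pCons 0 p) a b v n1 n2 = reg p a b v (n1 + 1) (n2 - 1)"
  by (subst reg_superset[of _ "Suc (degree p)"], simp, subst sum.atMost_Suc_shift)
    (simp add: reg_def algebra_simps)

lemma limit_0: "limit 0 a b 0"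
  by (simp add: limit_def regular_def reg_def)

lemma regular_finite: "regular p a b \<Longrightarrow> finite {i. reg p a b v i (n - i) \<noteq> 0}"
proof -
  assume "regular p a b"
  then obtain N where "\<And>n1 n2. n1 < N \<or> n2 < N \<Longrightarrow> reg p a b v n1 n2 = 0"
    unfolding regular_def by blast
  then show ?thesis by (rule finite_diag)
qed

lemma regularE:
  assumes "regular p a b"
  obtains N where "\<And>n1 n2. n1 < N \<or> n2 < N \<Longrightarrow> reg p a b v n1 n2 = 0"
  using assms unfolding regular_def by blast

lemma limit_addI:
  assumes "limit p a b c" "limit p' a' b' c'"
    and eq: "\<And>v n1 n2. reg q d e v n1 n2 = reg p a b v n1 n2 + reg p' a' b' v n1 n2"
  shows "limit q d e (c + c')"
proof -
  have r: "regular p a b" "regular p' a' b'"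
    using assms by (auto simp: limit_def)
  have "\<exists>N. \<forall>n1 n2. n1 < N \<or> n2 < N \<longrightarrow> reg q d e v n1 n2 = 0" for v
  proof -
    obtain N where N: "\<And>n1 n2. n1 < N \<or> n2 < N \<Longrightarrow> reg p a b v n1 n2 = 0"
      using regularE[OF r(1)] by blast
    obtain M where M: "\<And>n1 n2. n1 < M \<or> n2 < M \<Longrightarrow> reg p' a' b' v n1 n2 = 0"
      using regularE[OF r(2)] by blast
    have "reg q d e v n1 n2 = 0" if "n1 < min N M \<or> n2 < min N M" for n1 n2
      using that N[of n1 n2] M[of n1 n2] by (auto simp: eq)
    then show ?thesis by blast
  qed
  then show ?thesis
    using assms Sum_any.distrib[OF regular_finite[OF r(1)] regular_finite[OF r(2)]]
    by (simp add: limit_def regular_def eq)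
qed

lemma limit_scaleI:
  assumes "limit p a b c" and eq: "\<And>v n1 n2. reg q d e v n1 n2 = fscale k (reg p a b v n1 n2)"
  shows "limit q d e (cscale k c)"
proof -
  have r: "regular p a b"
    using assms by (auto simp: limit_def)
  have "Sum_any (\<lambda>i. fscale k (reg p a b v i (n - i))) = fscale k (Sum_any (\<lambda>i. reg p a b v i (n - i)))" for v n
  proof (cases "k = 0")
    case False
    then show ?thesis
      using regular_finite[OF r] by (simp add: Sum_any.expand_set fvec.scale_sum_right)
  qed simp
  moreover have "regular q d e"
    using r unfolding regular_def eq by (metis fvec.scale_zero_right)
  ultimately show ?thesis
    using assms by (simp add: limit_def cscale_def eq)
qed

lemma limit_shiftI:
  assumes "limit p a b c" and eq: "\<And>v n1 n2. reg q d e v n1 n2 = reg p a b v (n1 - s) (n2 - t)"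
  shows "limit q d e (\<lambda>v n. c v (n - (s + t)))"
proof -
  have "\<exists>N. \<forall>n1 n2. n1 < N \<or> n2 < N \<longrightarrow> reg q d e v n1 n2 = 0" for v
  proof -
    obtain N where N: "\<And>n1 n2. n1 < N \<or> n2 < N \<Longrightarrow> reg p a b v n1 n2 = 0"
      using assms(1) regularE[of p a b] unfolding limit_def by blast
    have "reg q d e v n1 n2 = 0" if "n1 < N - \<bar>s\<bar> - \<bar>t\<bar> \<or> n2 < N - \<bar>s\<bar> - \<bar>t\<bar>" for n1 n2
      unfolding eq by (rule N) (use that in linarith)
    then show ?thesis by blast
  qed
  moreover have "Sum_any (\<lambda>i. reg q d e v i (n - i)) = c v (n - (s + t))" for v n
  proof -
    have "Sum_any (\<lambda>i. reg q d e v i (n - i)) = Sum_any (\<lambda>i. reg p a b v (i - s) ((n - (s + t)) - (i - s)))"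
      by (simp add: eq algebra_simps)
    also have "\<dots> = Sum_any (\<lambda>i. reg p a b v i ((n - (s + t)) - i))"
      by (rule Sum_any_shift)
    also have "\<dots> = c v (n - (s + t))"
      using assms(1) by (simp add: limit_def)
    finally show ?thesis .
  qed
  ultimately show ?thesis
    by (simp add: limit_def regular_def)
qed

text \<open>Multiplication by $z_2/z_1$ moves coefficients along the antidiagonals and leaves the
  limit unchanged, so a further factor \<open>q\<close> contributes its value at 1.\<close>

lemma limit_mult_poly:
  assumes "limit p a b c"
  shows "limit (p * q) a b (cscale (poly q 1) c)"
proof (induction q)
  case 0
  have "cscale 0 c = 0"
    by (rule cvec.scale_zero_left)
  then show ?case
    using limit_0[of a b] by (simp only: mult_zero_right poly_0)
next
  case (pCons k q)
  have "limit (pCons 0 (p * q)) a b (cscale (poly q 1) c)"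
    using limit_shiftI[OF pCons.IH, of "pCons 0 (p * q)" a b "- 1" 1] by (simp add: reg_pCons_0)
  moreover have "limit (smult k p) a b (cscale k c)"
    by (rule limit_scaleI[OF assms reg_smult])
  ultimately have "limit (smult k p + pCons 0 (p * q)) a b (cscale k c + cscale (poly q 1) c)"
    by (intro limit_addI[OF _ _ reg_add_poly])
  then show ?case
    by (simp only: mult_pCons_right poly_pCons mult_1_left cvec.scale_left_distrib)
qed

lemma polys0_mult: "p \<in> polys0 \<Longrightarrow> q \<in> polys0 \<Longrightarrow> p * q \<in> polys0"
  by (simp add: polys0_def)

lemma polys0_1: "1 \<in> polys0"
  by (simp add: polys0_def)

lemma limit_mult_polys0: "limit p a b c \<Longrightarrow> q \<in> polys0 \<Longrightarrow> limit (p * q) a b c"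
  using limit_mult_poly[of p a b c q] by (simp add: polys0_def)

text \<open>Both limits can be computed with the common multiple \<open>p * q\<close>, as all
  polynomials in \<open>polys0\<close> have value 1 at 1.\<close>

lemma limit_unique:
  assumes "limit p a b c" "p \<in> polys0" "limit q a b c'" "q \<in> polys0"
  shows "c = c'"
  using limit_mult_polys0[OF assms(1,4)] limit_mult_polys0[OF assms(3,2)]
  by (simp add: limit_def mult.commute fun_eq_iff)

definition lprod :: "'b fseries \<Rightarrow> 'b fseries \<Rightarrow> 'b fseries \<Rightarrow> bool"
  where "lprod a b c \<longleftrightarrow> (\<exists>p\<in>polys0. limit p a b c)"

text \<open>The polynomial in \<open>prod_hom\<close> comes from a choice; by uniqueness of the
  limit any witness determines the value.\<close>

lemma prod_hom_lprod:
  assumes "lprod ((sqderiv ^^ r) a) (dilate (sq ^ (\<alpha> + r)) b) c"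
  shows "prod_hom r a \<alpha> b = cscale (inverse (sqfact r)) c"
proof -
  let ?a = "(sqderiv ^^ r) a" and ?b = "dilate (sq ^ (\<alpha> + r)) b"
  define p where "p = (SOME p. p \<in> polys0 \<and> regular p ?a ?b)"
  obtain q where q: "q \<in> polys0" "limit q ?a ?b c"
    using assms unfolding lprod_def by blast
  then have "\<exists>p. p \<in> polys0 \<and> regular p ?a ?b"
    by (auto simp: limit_def)
  then have p: "p \<in> polys0" "regular p ?a ?b"
    unfolding p_def by (metis (mono_tags, lifting) someI_ex)+
  have "limit p ?a ?b (\<lambda>v n. Sum_any (\<lambda>i. reg p ?a ?b v i (n - i)))"
    using p by (simp add: limit_def)
  from limit_unique[OF q(2,1) this p(1)] show ?thesis
    by (simp add: prod_hom_def Let_def p_def cscale_def)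
qed

definition clinear :: "'b fseries \<Rightarrow> bool"
  where "clinear a \<longleftrightarrow> (\<forall>u v n. a (u + v) n = a u n + a v n) \<and> (\<forall>k v n. a (fscale k v) n = fscale k (a v n))"

lemma clinear_zero: "clinear a \<Longrightarrow> a 0 n = 0"
  unfolding clinear_def by (metis fvec.scale_zero_left)

text \<open>Multiplication by $z^s$.\<close>

definition zshift :: "int \<Rightarrow> 'b fseries \<Rightarrow> 'b fseries"
  where "zshift s a = (\<lambda>v n. a v (n - s))"

lemma lprod_0_left: "lprod 0 b 0"
  unfolding lprod_def by (rule bexI[OF _ polys0_1]) (simp add: limit_def regular_def reg_def)

lemma lprod_0_right: "clinear a \<Longrightarrow> lprod a 0 0"
  unfolding lprod_def by (rule bexI[OF _ polys0_1]) (simp add: limit_def regular_def reg_def clinear_zero)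

lemma lprod_add_left:
  assumes "lprod a b c" "lprod a' b c'"
  shows "lprod (a + a') b (c + c')"
proof -
  obtain p q where "p \<in> polys0" "q \<in> polys0" "limit p a b c" "limit q a' b c'"
    using assms unfolding lprod_def by blast
  then have "p * q \<in> polys0" "limit (p * q) a b c" "limit (p * q) a' b c'"
    using limit_mult_polys0[of q a' b c' p] by (auto simp: polys0_mult limit_mult_polys0 mult.commute)
  moreover have "reg r (a + a') b v n1 n2 = reg r a b v n1 n2 + reg r a' b v n1 n2" for r v n1 n2
    by (simp add: reg_def fvec.scale_right_distrib sum.distrib)
  ultimately show ?thesis
    unfolding lprod_def using limit_addI by metis
qed

lemma lprod_add_right:
  assumes "clinear a" "lprod a b c" "lprod a b' c'"
  shows "lprod a (b + b') (c + c')"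
proof -
  obtain p q where "p \<in> polys0" "q \<in> polys0" "limit p a b c" "limit q a b' c'"
    using assms unfolding lprod_def by blast
  then have "p * q \<in> polys0" "limit (p * q) a b c" "limit (p * q) a b' c'"
    using limit_mult_polys0[of q a b' c' p] by (auto simp: polys0_mult limit_mult_polys0 mult.commute)
  moreover have "reg r a (b + b') v n1 n2 = reg r a b v n1 n2 + reg r a b' v n1 n2" for r v n1 n2
    using assms(1) by (simp add: reg_def clinear_def fvec.scale_right_distrib sum.distrib)
  ultimately show ?thesis
    unfolding lprod_def using limit_addI by metis
qed

lemma lprod_scale_left: "lprod a b c \<Longrightarrow> lprod (cscale k a) b (cscale k c)"
  unfolding lprod_def
  by (elim bexE, rule bexI, rule limit_scaleI)
    (auto simp: reg_def cscale_def fvec.scale_sum_right mult.commute)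

lemma lprod_scale_right: "clinear a \<Longrightarrow> lprod a b c \<Longrightarrow> lprod a (cscale k b) (cscale k c)"
  unfolding lprod_def
  by (elim bexE, rule bexI, rule limit_scaleI)
    (auto simp: reg_def cscale_def clinear_def fvec.scale_sum_right mult.commute)

lemma lprod_zshift:
  assumes "lprod a b c"
  shows "lprod (zshift s a) (zshift t b) (zshift (s + t) c)"
proof -
  obtain p where p: "p \<in> polys0" "limit p a b c"
    using assms unfolding lprod_def by blast
  have "limit p (zshift s a) (zshift t b) (\<lambda>v n. c v (n - (s + t)))"
    by (rule limit_shiftI[OF p(2)]) (simp add: reg_def zshift_def algebra_simps)
  with p(1) show ?thesis
    unfolding lprod_def zshift_def by blast
qed

lemma lprod_sum_left:
  "finite I \<Longrightarrow> (\<And>i. i \<in> I \<Longrightarrow> lprod (a i) b (c i)) \<Longrightarrow> lprod (sum a I) b (sum c I)"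
  by (induction I rule: finite_induct) (simp_all add: lprod_0_left lprod_add_left)

lemma lprod_sum_right:
  "finite I \<Longrightarrow> clinear a \<Longrightarrow> (\<And>i. i \<in> I \<Longrightarrow> lprod a (b i) (c i)) \<Longrightarrow> lprod a (sum b I) (sum c I)"
  by (induction I rule: finite_induct) (simp_all add: lprod_0_right lprod_add_right)

lemma lprod_sum_list_right:
  "clinear a \<Longrightarrow> (\<And>x. x \<in> set xs \<Longrightarrow> lprod a (b x) (c x)) \<Longrightarrow> lprod a (\<Sum>x\<leftarrow>xs. b x) (\<Sum>x\<leftarrow>xs. c x)"
  by (induction xs) (simp_all add: lprod_0_right lprod_add_right)

lemma
  assumes "clinear a"
  shows clinear_cscale: "clinear (cscale k a)" and clinear_zshift: "clinear (zshift s a)" and clinear_sqderiv: "clinear (sqderiv a)"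
  using assms
  by (auto simp: clinear_def cscale_def zshift_def dilate_def sqderiv_def fvec.scale_right_distrib
      fvec.scale_right_diff_distrib algebra_simps)

lemma clinear_sqderiv_pow: "clinear a \<Longrightarrow> clinear ((sqderiv ^^ r) a)"
  by (induction r) (simp_all add: clinear_sqderiv)

lemma clinear_add: "clinear a \<Longrightarrow> clinear b \<Longrightarrow> clinear (a + b)"
  by (simp add: clinear_def fvec.scale_right_distrib algebra_simps)

lemma clinear_0: "clinear 0"
  by (simp add: clinear_def)

lemma clinear_sum: "(\<And>i. i \<in> I \<Longrightarrow> clinear (a i)) \<Longrightarrow> clinear (sum a I)"
  by (induction I rule: infinite_finite_induct) (simp_all add: clinear_add clinear_0)

lemma dilate_0 [simp]: "dilate k 0 = 0"
  by (simp add: dilate_def fun_eq_iff)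

lemma sqderiv_pow_0: "(sqderiv ^^ r) 0 = 0"
proof (induction r)
  case (Suc r)
  have "sqderiv 0 = 0"
    by (simp add: sqderiv_def dilate_def fun_eq_iff)
  then show ?case
    by (simp only: funpow.simps comp_apply Suc)
qed simp

text \<open>Only one summand of \<open>cprod\<close> survives, because products with 0 vanish. That
  vanishing has to be derived through \<open>lprod\<close>, \<open>prod_hom\<close> being defined by
  a choice; it also covers zero monomials, whose degree is 0.\<close>

lemma cprod_monom:
  assumes "clinear a" "n < 0"
  shows "cprod (monom a \<alpha>) n (monom b \<beta>) =
    monom (prod_hom (nat (- n - 1)) a \<alpha> b) (\<alpha> + \<beta> + nat (- n - 1))"
proof -
  let ?r = "nat (- n - 1)"
  have z1: "prod_hom ?r 0 \<alpha>' b' = 0" for \<alpha>' and b' :: "'a fseries"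
    using prod_hom_lprod[of ?r 0 \<alpha>' b' 0] by (simp add: sqderiv_pow_0 lprod_0_left)
  have z2: "prod_hom ?r a \<alpha>' 0 = 0" for \<alpha>'
    using prod_hom_lprod[of ?r a \<alpha>' 0 0] by (simp add: lprod_0_right clinear_sqderiv_pow assms)
  have "(\<Sum>\<beta>'\<le>degree (monom b \<beta>). monom (prod_hom ?r a \<alpha> (coeff (monom b \<beta>) \<beta>')) (\<alpha> + \<beta>' + ?r)) =
      monom (prod_hom ?r a \<alpha> b) (\<alpha> + \<beta> + ?r)"
  proof (cases "b = 0")
    case False
    have "(\<Sum>\<beta>'\<le>\<beta>. monom (prod_hom ?r a \<alpha> (coeff (monom b \<beta>) \<beta>')) (\<alpha> + \<beta>' + ?r)) =
        (\<Sum>\<beta>'\<in>{\<beta>}. monom (prod_hom ?r a \<alpha> (coeff (monom b \<beta>) \<beta>')) (\<alpha> + \<beta>' + ?r))"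
      by (rule sum.mono_neutral_right) (auto simp: z2)
    then show ?thesis by (simp add: degree_monom_eq[OF False])
  qed (simp add: z2)
  moreover have "(\<Sum>\<alpha>'\<le>degree (monom a \<alpha>). f \<alpha>' (coeff (monom a \<alpha>) \<alpha>')) = f \<alpha> a"
    if "\<And>\<alpha>'. f \<alpha>' 0 = 0" for f :: "nat \<Rightarrow> 'a fseries \<Rightarrow> 'a fseries poly"
  proof (cases "a = 0")
    case False
    have "(\<Sum>\<alpha>'\<le>\<alpha>. f \<alpha>' (coeff (monom a \<alpha>) \<alpha>')) = (\<Sum>\<alpha>'\<in>{\<alpha>}. f \<alpha>' (coeff (monom a \<alpha>) \<alpha>'))"
      by (rule sum.mono_neutral_right) (auto simp: that)
    then show ?thesis by (simp add: degree_monom_eq[OF False])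
  qed (simp add: that)
  note this[of "\<lambda>\<alpha>' c. \<Sum>\<beta>'\<le>degree (monom b \<beta>). monom (prod_hom ?r c \<alpha>' (coeff (monom b \<beta>) \<beta>')) (\<alpha>' + \<beta>' + ?r)"]
  ultimately show ?thesis
    using assms(2) by (simp add: cprod_def z1 Let_def)
qed

lemma eval_t1_monom: "eval_t1 (monom a n) = a"
proof (cases "a = 0")
  case False
  have "(\<Sum>\<alpha>\<le>n. coeff (monom a n) \<alpha>) = (\<Sum>\<alpha>\<in>{n}. coeff (monom a n) \<alpha>)"
    by (rule sum.mono_neutral_right) auto
  then show ?thesis
    by (simp add: eval_t1_def degree_monom_eq[OF False])
qed (simp add: eval_t1_def)

section \<open>Contractions\<close>

text \<open>\<open>contracts \<tau> c\<close>: the series $\exp(\sum_r \tau_r y^r)$ is a rational function whose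
  denominator is in $\mathbb F[y]_0$ up to a scalar, and its value at $y = 1$ is \<open>c\<close>.\<close>

definition contracts :: "(nat \<Rightarrow> qfield) \<Rightarrow> qfield \<Rightarrow> bool"
  where "contracts \<tau> c \<longleftrightarrow> (\<exists>p\<in>polys0. \<exists>\<rho> u. is_exp \<tau> \<rho> \<and> fps_of_poly p * \<rho> = fps_of_poly u \<and> poly u 1 = c)"

lemma contracts_0: "contracts (\<lambda>_. 0) 1"
  unfolding contracts_def
  by (rule bexI[OF _ polys0_1], rule exI[of _ 1], rule exI[of _ 1]) (simp add: is_exp_0)

lemma contracts_add:
  assumes "contracts \<tau> c" "contracts \<tau>' c'"
  shows "contracts (\<lambda>r. \<tau> r + \<tau>' r) (c * c')"
proof -
  obtain p \<rho> u where p: "p \<in> polys0" "is_exp \<tau> \<rho>" "fps_of_poly p * \<rho> = fps_of_poly u" "poly u 1 = c"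
    using assms(1) unfolding contracts_def by blast
  obtain p' \<rho>' u' where p': "p' \<in> polys0" "is_exp \<tau>' \<rho>'" "fps_of_poly p' * \<rho>' = fps_of_poly u'" "poly u' 1 = c'"
    using assms(2) unfolding contracts_def by blast
  have "fps_of_poly (p * p') * (\<rho> * \<rho>') = (fps_of_poly p * \<rho>) * (fps_of_poly p' * \<rho>')"
    by (simp add: fps_of_poly_mult mult_ac)
  also have "\<dots> = fps_of_poly (u * u')"
    by (simp add: p p' fps_of_poly_mult)
  finally show ?thesis
    unfolding contracts_def
    using p p' is_exp_mult[OF p(2) p'(2)] polys0_mult[OF p(1) p'(1)]
    by (intro bexI[of _ "p * p'"] exI[of _ "\<rho> * \<rho>'"] exI[of _ "u * u'"]) auto
qed

lemma contracts_cong: "(\<And>r. 1 \<le> r \<Longrightarrow> \<tau> r = \<tau>' r) \<Longrightarrow> contracts \<tau> c \<longleftrightarrow> contracts \<tau>' c"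
  unfolding contracts_def using is_exp_cong by metis

lemma contracts_sum_list:
  "(\<And>x. x \<in> set xs \<Longrightarrow> contracts (\<tau> x) (c x)) \<Longrightarrow> contracts (\<lambda>r. \<Sum>x\<leftarrow>xs. \<tau> x r) (\<Prod>x\<leftarrow>xs. c x)"
proof (induction xs)
  case (Cons x xs)
  have "contracts (\<lambda>r. \<tau> x r + (\<Sum>x\<leftarrow>xs. \<tau> x r)) (c x * (\<Prod>x\<leftarrow>xs. c x))"
    by (rule contracts_add) (use Cons in auto)
  then show ?case by simp
qed (simp add: contracts_0)

lemma contracts_numerator: "contracts (\<lambda>r. - (s ^ r / of_nat r)) (1 - s)"
proof -
  have "is_exp (\<lambda>r. - (s ^ r / of_nat r)) (fps_of_poly [:1, - s:])"
    unfolding is_exp_iff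
  proof safe
    fix n
    show "of_nat n * fps_of_poly [:1, - s:] $ n =
        (\<Sum>r=1..n. of_nat r * - (s ^ r / of_nat r) * fps_of_poly [:1, - s:] $ (n - r))"
    proof (cases n)
      case (Suc m)
      have "(\<Sum>r=1..n. of_nat r * - (s ^ r / of_nat r) * fps_of_poly [:1, - s:] $ (n - r)) =
          (\<Sum>r=1..n. (if r = n then - (s ^ n) else 0) + (if r = m then s ^ n else 0))"
        by (intro sum.cong refl) (auto simp: Suc coeff_pCons split: nat.splits)
      also have "\<dots> = - (s ^ n) + (if 1 \<le> m then s ^ n else 0)"
        by (simp add: sum.distrib Suc del: sum.cl_ivl_Suc)
      also have "\<dots> = of_nat n * fps_of_poly [:1, - s:] $ n"
        by (cases m) (simp_all add: Suc)
      finally show ?thesis by simp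
    qed simp
  qed simp
  then show ?thesis
    unfolding contracts_def
    by (intro bexI[OF _ polys0_1] exI[of _ "fps_of_poly [:1, - s:]"] exI[of _ "[:1, - s:]"]) simp
qed

lemma contracts_denominator:
  assumes "\<And>n. s * sq ^ n \<noteq> 1"
  shows "contracts (\<lambda>r. s ^ r / of_nat r) (1 / (1 - s))"
proof -
  let ?\<rho> = "Abs_fps (\<lambda>n. s ^ n)"
  let ?p = "[:1 / (1 - s), - s / (1 - s):]"
  have s: "1 - s \<noteq> 0"
    using assms[of 0] by simp
  have poly_p: "poly ?p x = (1 - s * x) / (1 - s)" for x
    by (simp add: divide_simps)
  have "?p \<in> polys0"
    unfolding polys0_def mem_Collect_eq poly_p using s assms by simp
  moreover have "is_exp (\<lambda>r. s ^ r / of_nat r) ?\<rho>"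
    unfolding is_exp_iff
  proof safe
    fix n
    have "(\<Sum>r=1..n. of_nat r * (s ^ r / of_nat r) * ?\<rho> $ (n - r)) = (\<Sum>r=1..n. s ^ n)"
      by (intro sum.cong refl) (auto simp flip: power_add)
    then show "of_nat n * ?\<rho> $ n = (\<Sum>r=1..n. of_nat r * (s ^ r / of_nat r) * ?\<rho> $ (n - r))"
      by simp
  qed simp
  moreover have "fps_of_poly ?p * ?\<rho> = fps_of_poly [:1 / (1 - s):]"
  proof (rule fps_ext)
    fix n
    have "(\<Sum>i=0..n. coeff ?p i * s ^ (n - i)) = (if n = 0 then 1 / (1 - s) else 0)"
    proof (cases n)
      case (Suc m)
      have "(\<Sum>i=0..n. coeff ?p i * s ^ (n - i)) = (\<Sum>i\<in>{0, 1}. coeff ?p i * s ^ (n - i))"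
        by (rule sum.mono_neutral_right) (auto simp: Suc coeff_pCons split: nat.splits)
      then show ?thesis by (simp add: Suc)
    qed simp
    then show "(fps_of_poly ?p * ?\<rho>) $ n = fps_of_poly [:1 / (1 - s):] $ n"
      by (simp add: fps_mult_nth coeff_pCons split: nat.splits)
  qed
  ultimately show ?thesis
    unfolding contracts_def by (intro bexI[of _ ?p] exI[of _ ?\<rho>] exI[of _ "[:1 / (1 - s):]"]) auto
qed

section \<open>The currents attached to marked points\<close>

text \<open>The vertex operator attached to \<open>(a, l)\<close> is the $l$-th summand of $x(z\mathsf q^a)$. A list of
  such pairs stands for their normally ordered product.\<close>

definition vf :: "nat \<times> 'c::{finite,linorder} \<Rightarrow> 'c \<Rightarrow> nat \<Rightarrow> qfield"
  where "vf x i r = (if i < snd x then - (qq - inverse qq) * (sq ^ fst x * qh ^ (2 * rank i + 1)) ^ r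
    else if i = snd x then inverse (qh ^ r) / qnum r * (sq ^ fst x * qq ^ rank i) ^ r else 0)"

definition vs :: "nat \<times> 'c \<Rightarrow> 'c \<Rightarrow> int"
  where "vs x i = (if i = snd x then 1 else 0)"

text \<open>Translation of $a(-r)$: the annihilation coefficient times the commutator. The dilation
  enters inversely since $a(r)$ comes with $z^{-r}$.\<close>

definition vsig :: "nat \<times> 'c::{finite,linorder} \<Rightarrow> 'c \<Rightarrow> nat \<Rightarrow> qfield"
  where "vsig x i r = (if i = snd x
    then - (inverse (qh ^ r) / qnum r) * (qnum (2 * r) * qnum r / of_nat r) * inverse (sq ^ fst x * qq ^ rank i) ^ r
    else 0)"

definition vkap :: "nat \<times> 'c::{finite,linorder} \<Rightarrow> 'c \<Rightarrow> qfield"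
  where "vkap x i = (if i < snd x then qq powi (- 2) else if i = snd x then (sq ^ fst x * qq ^ rank i) ^ 2 else 1)"

definition vdel :: "nat \<times> 'c \<Rightarrow> 'c \<Rightarrow> int"
  where "vdel x i = (if i = snd x then 2 else 0)"

definition vop :: "(nat \<times> 'c::{finite,linorder}) list \<Rightarrow> 'c Lc \<Rightarrow> 'c Lc fls"
  where "vop D = vopc (\<lambda>i r. \<Sum>x\<leftarrow>D. vf x i r) (\<lambda>i. \<Sum>x\<leftarrow>D. vs x i) (\<lambda>i r. \<Sum>x\<leftarrow>D. vsig x i r)
    (\<lambda>i. \<Prod>x\<leftarrow>D. vkap x i) (\<lambda>i. \<Sum>x\<leftarrow>D. vdel x i)"

lemma vkap_nonzero: "vkap x i \<noteq> 0"
  by (simp add: vkap_def)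

lemma prod_vkap_nonzero: "(\<Prod>x\<leftarrow>D. vkap x i) \<noteq> 0"
  by (induction D) (simp_all add: vkap_nonzero)

lemma qnum_nonzero:
  assumes "1 \<le> r"
  shows "qnum r \<noteq> 0"
proof -
  have "qq ^ r - inverse (qq ^ r) \<noteq> 0"
  proof
    assume "qq ^ r - inverse (qq ^ r) = 0"
    then have "qq ^ r * qq ^ r = 1" by (simp add: field_simps)
    then show False
      using sq_power_neq_1[of r] assms by (simp add: sq_def power2_eq_square power_mult_distrib)
  qed
  moreover have "qq - inverse qq \<noteq> 0"
  proof
    assume "qq - inverse qq = 0"
    then have "sq = 1" by (simp add: field_simps sq_def power2_eq_square)
    then show False by simp
  qed
  ultimately show ?thesis by (simp add: qnum_def)
qed

lemma qq_diff_nonzero: "qq - inverse qq \<noteq> 0"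
  using qnum_nonzero[of 1] by (auto simp: qnum_def)

lemma qnum_double: "1 \<le> r \<Longrightarrow> qnum (2 * r) = qnum r * (qq ^ r + inverse (qq ^ r))"
  by (simp add: qnum_def mult_2 power_add) (simp add: field_simps qq_diff_nonzero)

definition ctr :: "nat \<times> 'c::linorder \<Rightarrow> nat \<times> 'c \<Rightarrow> qfield"
  where "ctr x y = (let s = sq ^ (fst y - fst x) in
    if snd x = snd y then (1 - s) * (1 - s / sq) else if snd x < snd y then (1 - s / sq) / (1 - sq * s) else 1)"

text \<open>Annihilation in \<open>x\<close> takes place only in the tensor factor
  \<open>snd x\<close>. There the creation part of \<open>y\<close> is that of \<open>xplus\<close>,
  that of \<open>phi\<close>, or trivial, which gives the three cases of \<open>ctr\<close>.\<close>

lemma contracts_pair: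
  assumes "fst x < fst y"
  shows "contracts (\<lambda>r. \<Sum>i\<in>UNIV. vf y i r * vsig x i r) (ctr x y)"
proof -
  define s where "s = sq ^ (fst y - fst x)"
  have pow: "sq ^ fst y = s * sq ^ fst x"
    using assms by (simp add: s_def flip: power_add)
  have sum: "(\<Sum>i\<in>UNIV. vf y i r * vsig x i r) = vf y (snd x) r * vsig x (snd x) r" for r
    using sum.delta[of UNIV "snd x" "\<lambda>i. vf y i r * vsig x i r"]
    by (subst sum.cong[OF refl, of _ _ "\<lambda>i. if i = snd x then vf y i r * vsig x i r else 0"]) (auto simp: vsig_def)
  have c1: "contracts (\<lambda>r. - (s ^ r / of_nat r)) (1 - s)" "contracts (\<lambda>r. - ((s / sq) ^ r / of_nat r)) (1 - s / sq)"
    by (rule contracts_numerator)+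
  \<comment> \<open>A positive power of \<open>sq\<close>, so the denominator is admissible.\<close>
  have "sq * s * sq ^ n \<noteq> 1" for n
    using sq_power_neq_1[of "Suc (fst y - fst x + n)"] by (simp add: s_def power_add mult.assoc)
  then have c2: "contracts (\<lambda>r. (sq * s) ^ r / of_nat r) (1 / (1 - sq * s))"
    by (rule contracts_denominator)
  have qh2: "inverse (qh ^ r) * inverse (qh ^ r) = inverse (qq ^ r)" for r
    by (simp add: qq_def power2_eq_square power_mult_distrib)
  have sqr: "sq ^ r = qq ^ r * qq ^ r" for r
    by (simp add: sq_def power2_eq_square power_mult_distrib)
  consider "snd x = snd y" | "snd x < snd y" | "snd y < snd x"
    by fastforce
  then show ?thesis
  proof cases
    case 1
    have "(\<Sum>i\<in>UNIV. vf y i r * vsig x i r) = - (s ^ r / of_nat r) + - ((s / sq) ^ r / of_nat r)" if "1 \<le> r" for r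
    proof -
      have "(\<Sum>i\<in>UNIV. vf y i r * vsig x i r) =
          - (inverse (qh ^ r) * inverse (qh ^ r)) * (qq ^ r + inverse (qq ^ r)) * s ^ r / of_nat r"
        unfolding sum using qnum_nonzero[OF that] that
        by (simp add: vf_def vsig_def 1 qnum_double pow power_mult_distrib power_inverse divide_simps)
      also have "\<dots> = - (s ^ r / of_nat r) + - ((s / sq) ^ r / of_nat r)"
        unfolding qh2 using that by (simp add: power_divide sqr field_simps)
      finally show ?thesis .
    qed
    then show ?thesis
      using contracts_add[OF c1] 1 by (subst contracts_cong) (auto simp: ctr_def Let_def s_def)
  next
    case 2
    have "(\<Sum>i\<in>UNIV. vf y i r * vsig x i r) = - ((s / sq) ^ r / of_nat r) + (sq * s) ^ r / of_nat r" if "1 \<le> r" for r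
    proof -
      let ?R = "qq ^ rank (snd x)"
      have e: "qh ^ (2 * rank (snd x) + 1) = ?R * qh"
        by (simp add: qq_def power_mult)
      have e': "qh ^ (rank (snd x) * 2) = ?R"
        by (simp add: qq_def mult.commute flip: power_mult)
      have "(\<Sum>i\<in>UNIV. vf y i r * vsig x i r) =
          (qq - inverse qq) * qnum (2 * r) * s ^ r / of_nat r"
        unfolding sum unfolding vf_def vsig_def using 2 qnum_nonzero[OF that] that
        by (simp add: e pow power_mult_distrib power_inverse divide_simps del: power_Suc power_add)
          (simp add: algebra_simps e')
      also have "(qq - inverse qq) * qnum (2 * r) = sq ^ r - inverse (sq ^ r)"
        using qq_diff_nonzero by (simp add: qnum_def sqr mult_2 power_add)
      also have "(sq ^ r - inverse (sq ^ r)) * s ^ r / of_nat r = - ((s / sq) ^ r / of_nat r) + (sq * s) ^ r / of_nat r"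
        using that by (simp add: power_divide power_mult_distrib field_simps)
      finally show ?thesis .
    qed
    then show ?thesis
      using contracts_add[OF c1(2) c2] 2 by (subst contracts_cong) (auto simp: ctr_def Let_def s_def)
  next
    case 3
    then have "\<not> snd x < snd y" "snd x \<noteq> snd y"
      by auto
    then show ?thesis
      unfolding sum using contracts_0 by (simp add: vf_def ctr_def Let_def)
  qed
qed

lemma sum_list_swap_sum: "(\<Sum>i\<in>I. \<Sum>x\<leftarrow>xs. f i x) = (\<Sum>x\<leftarrow>xs. \<Sum>i\<in>I. f i x)"
  by (induction xs) (simp_all add: sum.distrib)

lemma contracts_lists:
  assumes "\<And>x y. x \<in> set D \<Longrightarrow> y \<in> set D' \<Longrightarrow> fst x < fst y"
  shows "contracts (\<lambda>r. \<Sum>i\<in>UNIV. (\<Sum>y\<leftarrow>D'. vf y i r) * (\<Sum>x\<leftarrow>D. vsig x i r)) (\<Prod>x\<leftarrow>D. \<Prod>y\<leftarrow>D'. ctr x y)"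
proof -
  have "contracts (\<lambda>r. \<Sum>x\<leftarrow>D. \<Sum>y\<leftarrow>D'. \<Sum>i\<in>UNIV. vf y i r * vsig x i r) (\<Prod>x\<leftarrow>D. \<Prod>y\<leftarrow>D'. ctr x y)"
    by (intro contracts_sum_list contracts_pair assms)
  moreover have "(\<Sum>i\<in>UNIV. (\<Sum>y\<leftarrow>D'. vf y i r) * (\<Sum>x\<leftarrow>D. vsig x i r)) =
      (\<Sum>x\<leftarrow>D. \<Sum>y\<leftarrow>D'. \<Sum>i\<in>UNIV. vf y i r * vsig x i r)" for r
    by (simp add: sum_list_mult_const sum_list_const_mult flip: sum_list_swap_sum)
  ultimately show ?thesis by simp
qed

lemma prod_vs: "(\<Prod>i\<in>UNIV. k i powi vs y i) = k (snd y)" for k :: "'c::finite \<Rightarrow> qfield"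
proof -
  have "(\<Prod>i\<in>UNIV. k i powi vs y i) = (\<Prod>i\<in>UNIV. if i = snd y then k i else 1)"
    by (intro prod.cong refl) (simp add: vs_def)
  then show ?thesis by simp
qed

lemma prod_list_vs:
  fixes k :: "'c::finite \<Rightarrow> qfield"
  assumes "\<And>i. k i \<noteq> 0"
  shows "(\<Prod>i\<in>UNIV. k i powi (\<Sum>y\<leftarrow>D. vs y i)) = (\<Prod>y\<leftarrow>D. k (snd y))"
  by (induction D) (simp_all add: power_int_add assms prod.distrib prod_vs)

lemma sum_list_vs: "(\<Sum>i\<in>UNIV. d i * (\<Sum>y\<leftarrow>D. vs y i)) = (\<Sum>y\<leftarrow>D. d (snd y))" for d :: "'c::finite \<Rightarrow> int"
proof (induction D)
  case (Cons y D)
  have "(\<Sum>i\<in>UNIV. d i * vs y i) = (\<Sum>i\<in>UNIV. if i = snd y then d i else 0)"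
    by (intro sum.cong refl) (simp add: vs_def)
  then show ?case
    using Cons by (simp add: distrib_left sum.distrib)
qed simp

lemma prod_list_mult:
  fixes f g :: "'a \<Rightarrow> 'b::comm_monoid_mult"
  shows "(\<Prod>x\<leftarrow>xs. f x * g x) = (\<Prod>x\<leftarrow>xs. f x) * (\<Prod>x\<leftarrow>xs. g x)"
  by (induction xs) (simp_all add: mult_ac)

lemma prod_list_1: "(\<Prod>x\<leftarrow>xs. 1) = (1 :: 'b::comm_monoid_mult)"
  by (induction xs) simp_all

text \<open>The contractions of all pairs multiply up; \<open>vkap\<close> and \<open>vdel\<close>
  come from moving the zero modes of \<open>D\<close> past the group elements of
  \<open>D'\<close>.\<close>

lemma lprod_vop:
  assumes "\<And>x y. x \<in> set D \<Longrightarrow> y \<in> set D' \<Longrightarrow> fst x < fst y"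
  shows "lprod (\<lambda>v n. vop D v $$ n) (\<lambda>v n. vop D' v $$ n)
    (cscale (\<Prod>x\<leftarrow>D. \<Prod>y\<leftarrow>D'. ctr x y * vkap x (snd y))
      (zshift (\<Sum>x\<leftarrow>D. \<Sum>y\<leftarrow>D'. vdel x (snd y)) (\<lambda>v n. vop (D @ D') v $$ n)))"
proof -
  let ?c = "\<Prod>x\<leftarrow>D. \<Prod>y\<leftarrow>D'. ctr x y" and ?K = "\<Prod>x\<leftarrow>D. \<Prod>y\<leftarrow>D'. vkap x (snd y)"
    and ?d = "\<Sum>x\<leftarrow>D. \<Sum>y\<leftarrow>D'. vdel x (snd y)"
  let ?\<tau> = "\<lambda>r. \<Sum>i\<in>UNIV. (\<Sum>y\<leftarrow>D'. vf y i r) * (\<Sum>x\<leftarrow>D. vsig x i r)"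
  obtain p \<rho> u where p: "p \<in> polys0" "is_exp ?\<tau> \<rho>" "fps_of_poly p * \<rho> = fps_of_poly u" "poly u 1 = ?c"
    using contracts_lists[OF assms] unfolding contracts_def by blast
  have swap: "(\<Prod>y\<leftarrow>D'. \<Prod>x\<leftarrow>D. f x y) = (\<Prod>x\<leftarrow>D. \<Prod>y\<leftarrow>D'. f x y)" for f :: "_ \<Rightarrow> _ \<Rightarrow> qfield"
    by (induction D) (simp_all add: prod_list_mult prod_list_1)
  have K: "(\<Prod>i\<in>UNIV. (\<Prod>x\<leftarrow>D. vkap x i) powi (\<Sum>y\<leftarrow>D'. vs y i)) = ?K"
    by (simp only: prod_list_vs[OF prod_vkap_nonzero] swap)
  have swap': "(\<Sum>y\<leftarrow>D'. \<Sum>x\<leftarrow>D. f x y) = (\<Sum>x\<leftarrow>D. \<Sum>y\<leftarrow>D'. f x y)" for f :: "_ \<Rightarrow> _ \<Rightarrow> int"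
    by (induction D) (simp_all add: sum_list_addf)
  have d: "(\<Sum>i\<in>UNIV. (\<Sum>x\<leftarrow>D. vdel x i) * (\<Sum>y\<leftarrow>D'. vs y i)) = ?d"
    by (simp only: sum_list_vs swap')
  have app: "vop (D @ D') = vopc (\<lambda>i r. (\<Sum>x\<leftarrow>D. vf x i r) + (\<Sum>x\<leftarrow>D'. vf x i r)) (\<lambda>i. (\<Sum>x\<leftarrow>D. vs x i) + (\<Sum>x\<leftarrow>D'. vs x i))
      (\<lambda>i r. (\<Sum>x\<leftarrow>D. vsig x i r) + (\<Sum>x\<leftarrow>D'. vsig x i r)) (\<lambda>i. (\<Prod>x\<leftarrow>D. vkap x i) * (\<Prod>x\<leftarrow>D'. vkap x i))
      (\<lambda>i. (\<Sum>x\<leftarrow>D. vdel x i) + (\<Sum>x\<leftarrow>D'. vdel x i))"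
    by (simp add: vop_def)
  let ?F = "\<lambda>v. ratio (fps_of_poly p) * map_fls (vop D) (vop D' v)"
  have diag: "diag (?F v) (mono1 (Fsingle 0 (?c * ?K)) ?d * vop (D @ D') v)" for v
    unfolding K[symmetric] d[symmetric] p(4)[symmetric] app
    unfolding vop_def by (rule diag_vopc[OF _ _ p(2) refl p(3)]) (rule prod_vkap_nonzero)+
  have vop0: "vop D 0 = 0"
    by (simp add: vop_def vopc_def ring_hom_0[OF ring_hom_shiftc[OF prod_vkap_nonzero]])
  have reg: "reg p (\<lambda>v n. vop D v $$ n) (\<lambda>v n. vop D' v $$ n) v n1 n2 = ?F v $$ n2 $$ n1" for v n1 n2
  proof -
    have "?F v $$ n2 $$ n1 = (\<Sum>k\<le>degree p. (map_fls (vop D) (vop D' v) * mono2 (Fsingle 0 (coeff p k)) (- int k) (int k)) $$ n2 $$ n1)"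
      unfolding ratio_poly[OF order_refl] mult.commute[of "sum _ _"] sum_distrib_left fls_nth_sum ..
    then show ?thesis
      unfolding times_mono2_nth by (simp add: reg_def map_fls_nth vop0 fscale_eq_mult mult.commute)
  qed
  have "limit p (\<lambda>v n. vop D v $$ n) (\<lambda>v n. vop D' v $$ n)
      (\<lambda>v n. (mono1 (Fsingle 0 (?c * ?K)) ?d * vop (D @ D') v) $$ n)"
    using diag unfolding limit_def regular_def reg diag_def by blast
  moreover have "(\<lambda>v n. (mono1 (Fsingle 0 (?c * ?K)) ?d * vop (D @ D') v) $$ n) =
      cscale (?c * ?K) (zshift ?d (\<lambda>v n. vop (D @ D') v $$ n))"
    by (simp add: mono1_times_nth cscale_def zshift_def fscale_eq_mult)
  moreover have "?c * ?K = (\<Prod>x\<leftarrow>D. \<Prod>y\<leftarrow>D'. ctr x y * vkap x (snd y))"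
    by (simp add: prod_list_mult)
  ultimately show ?thesis
    using p(1) unfolding lprod_def by auto
qed

section \<open>The current $x(z)$ and its products\<close>

text \<open>\<open>pcur D\<close> is the limit of the product $x_{l_1}(z\mathsf q^{a_1}) x_{l_2}(z\mathsf q^{a_2}) \cdots$
  for \<open>D = [(a\<^sub>1, l\<^sub>1), (a\<^sub>2, l\<^sub>2), \<dots>]\<close> with increasing \<open>a\<^sub>j\<close>, where $x_l(z)$ is the $l$-th summand of
  $x(z)$; \<open>xcur [a\<^sub>1, a\<^sub>2, \<dots>]\<close> is that of $x(z\mathsf q^{a_1}) x(z\mathsf q^{a_2}) \cdots$.\<close>

fun ccoef :: "(nat \<times> 'c::{finite,linorder}) list \<Rightarrow> qfield" where
  "ccoef [] = 1"
| "ccoef (x # D) = (\<Prod>y\<leftarrow>D. ctr x y * vkap x (snd y)) * ccoef D"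

fun cdeg :: "(nat \<times> 'c) list \<Rightarrow> int" where
  "cdeg [] = 0"
| "cdeg (x # D) = (\<Sum>y\<leftarrow>D. vdel x (snd y)) + cdeg D"

definition pcur :: "(nat \<times> 'c::{finite,linorder}) list \<Rightarrow> 'c Lc_basis fseries"
  where "pcur D = cscale (ccoef D) (zshift (cdeg D) (\<lambda>v n. vop D v $$ n))"

definition xcur :: "nat list \<Rightarrow> 'c::{finite,linorder} Lc_basis fseries"
  where "xcur a = (\<Sum>D | map fst D = a. pcur D)"

lemma ccoef_append: "ccoef (D @ D') = ccoef D * ccoef D' * (\<Prod>x\<leftarrow>D. \<Prod>y\<leftarrow>D'. ctr x y * vkap x (snd y))"
  by (induction D) (simp_all add: mult_ac)

lemma cdeg_append: "cdeg (D @ D') = cdeg D + cdeg D' + (\<Sum>x\<leftarrow>D. \<Sum>y\<leftarrow>D'. vdel x (snd y))"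
  by (induction D) simp_all

lemma clinear_vop: "clinear (\<lambda>v n. vop D v $$ n)"
proof -
  note alg = alg_hom_shiftc[OF prod_vkap_nonzero]
  have "vop D (fscale k v) = fls_const (Fsingle 0 k) * vop D v" for k v
    unfolding vop_def vopc_def alg_hom_fscale[OF alg] by (simp only: mult_ac)
  moreover have "vop D (u + v) = vop D u + vop D v" for u v
    unfolding vop_def vopc_def ring_hom_add[OF alg_hom_ring_hom[OF alg]] by (simp only: distrib_left)
  ultimately show ?thesis
    by (simp add: clinear_def fscale_eq_mult)
qed

lemma clinear_pcur: "clinear (pcur D)"
  by (simp add: pcur_def clinear_cscale clinear_zshift clinear_vop)

lemma clinear_xcur: "clinear (xcur a)"
  unfolding xcur_def by (rule clinear_sum) (rule clinear_pcur)

lemma zshift_zshift: "zshift s (zshift t a) = zshift (s + t) a"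
  by (simp add: zshift_def algebra_simps)

lemma zshift_cscale: "zshift s (cscale k a) = cscale k (zshift s a)"
  by (simp add: zshift_def cscale_def)

lemma lprod_pcur:
  assumes "\<And>x y. x \<in> set D \<Longrightarrow> y \<in> set D' \<Longrightarrow> fst x < fst y"
  shows "lprod (pcur D) (pcur D') (pcur (D @ D'))"
proof -
  let ?V = "\<lambda>D v n. vop D v $$ n"
  have "lprod (cscale (ccoef D) (zshift (cdeg D) (?V D))) (cscale (ccoef D') (zshift (cdeg D') (?V D')))
    (cscale (ccoef D') (cscale (ccoef D) (zshift (cdeg D + cdeg D')
      (cscale (\<Prod>x\<leftarrow>D. \<Prod>y\<leftarrow>D'. ctr x y * vkap x (snd y))
        (zshift (\<Sum>x\<leftarrow>D. \<Sum>y\<leftarrow>D'. vdel x (snd y)) (?V (D @ D')))))))"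
    by (intro lprod_scale_right lprod_scale_left lprod_zshift clinear_cscale clinear_zshift clinear_vop lprod_vop assms)
  then show ?thesis
    unfolding pcur_def ccoef_append cdeg_append by (simp add: zshift_zshift zshift_cscale mult_ac)
qed

lemma finite_map_fst: "finite {D :: (nat \<times> 'c::finite) list. map fst D = a}"
proof (rule finite_subset)
  show "{D :: (nat \<times> 'c) list. map fst D = a} \<subseteq> {D. set D \<subseteq> set a \<times> UNIV \<and> length D = length a}"
    by force
  show "finite {D :: (nat \<times> 'c) list. set D \<subseteq> set a \<times> UNIV \<and> length D = length a}"
    by (rule finite_lists_length_eq) simp
qed

lemma lprod_xcur:
  assumes "\<And>i j. i \<in> set a \<Longrightarrow> j \<in> set b \<Longrightarrow> i < j"
  shows "lprod (xcur a :: 'c::{finite,linorder} Lc_basis fseries) (xcur b) (xcur (a @ b))"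
proof -
  have lt: "fst x < fst y" if "map fst D = a" "map fst D' = b" "x \<in> set D" "y \<in> set D'"
    for D D' :: "(nat \<times> 'c) list" and x y
    using assms that by auto
  have "lprod (xcur a :: 'c Lc_basis fseries) (xcur b) (\<Sum>D | map fst D = a. \<Sum>D' | map fst D' = b. pcur (D @ D'))"
    unfolding xcur_def[of a]
  proof (rule lprod_sum_left[OF finite_map_fst])
    fix D :: "(nat \<times> 'c) list" assume D: "D \<in> {D. map fst D = a}"
    show "lprod (pcur D) (xcur b) (\<Sum>D' | map fst D' = b. pcur (D @ D'))"
      unfolding xcur_def
      by (rule lprod_sum_right[OF finite_map_fst clinear_pcur]) (use D lt in \<open>auto intro!: lprod_pcur\<close>)
  qed
  also have "(\<Sum>D | map fst D = a. \<Sum>D' | map fst D' = b. pcur (D @ D')) = (xcur (a @ b) :: 'c Lc_basis fseries)"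
    unfolding xcur_def
    by (subst sum.Sigma[OF finite_map_fst]; (simp add: finite_map_fst)?)
      (rule sum.reindex_bij_witness[of _ "\<lambda>D. (take (length a) D, drop (length a) D)" "\<lambda>(D, D'). D @ D'"];
        auto simp: take_map[symmetric] drop_map[symmetric])
  finally show ?thesis .
qed

lemma vopc_one:
  fixes v :: "'c::finite Lc"
  shows "vopc (\<lambda>i r. 0) (\<lambda>i. 0) (\<lambda>i r. 0) (\<lambda>i. 1) (\<lambda>i. 0) v = fls_const v"
proof -
  have "map_fps (slot i) 1 = (1 :: 'c Lc fps)" for i :: 'c
    by (rule ring_hom_1[OF ring_hom_map_fps[OF ring_hom_slot]])
  then have "expc (\<lambda>i r. 0) = (1 :: 'c Lc fps)"
    by (simp add: expc_def exp0_0)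
  moreover have "evarc (\<lambda>i. 0) = (1 :: 'c Lc)"
    by (simp add: evarc_def evar_0 ring_hom_1[OF ring_hom_slot])
  moreover have "shiftc (\<lambda>i r. 0) (\<lambda>i. 1) (\<lambda>i. 0) v = fls_const v"
  proof (induction v rule: Lc_induct)
    case (add u v)
    then show ?case
      by (subst ring_hom_add[OF ring_hom_shiftc]) (simp_all add: fls_plus_const)
  next
    case (mult u v)
    then show ?case
      by (subst ring_hom_mult[OF ring_hom_shiftc]) simp_all
  qed (simp_all add: shiftc_const shiftc_xvar shiftc_evar fls_const_eq_mono1)
  ultimately show ?thesis
    by (simp add: vopc_def mono1_1)
qed

lemma xcur_Nil: "xcur [] = one_current"
proof -
  have "vop [] v = fls_const v" for v :: "'a Lc"
    by (simp add: vop_def vopc_one)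
  then show ?thesis
    by (simp add: xcur_def pcur_def zshift_def one_current_def cscale_def fun_eq_iff)
qed

text \<open>A single point has nothing to contract, so the summands are bare vertex operators. The
  three positions of \<open>i\<close> relative to \<open>l\<close> give the factors
  \<open>phi\<close>, \<open>xplus\<close> and the identity.\<close>

lemma x_current_eq: "x_current = (xcur [0] :: 'c::{finite,linorder} Lc_basis fseries)"
proof -
  let ?A = "\<lambda>l i. if i < l then dilate (qh ^ (2 * rank i + 1)) phi
    else if i = l then dilate (qq ^ rank l) xplus else one_current"
  have "tensor_current (?A l) v n = vop [(0, l)] v $$ n" for l :: 'c and v n
    unfolding vop_def
  proof (rule tensor_current_vopc[OF _ prod_vkap_nonzero])
    fix i and b :: L0_basis and n
    obtain \<mu> k where b: "b = (\<mu>, k)" by fastforce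
    let ?V = "vop0 (\<lambda>r. \<Sum>x\<leftarrow>[(0, l)]. vf x i r) (\<Sum>x\<leftarrow>[(0, l)]. vs x i)
      (\<lambda>r. \<Sum>x\<leftarrow>[(0, l)]. vsig x i r) (\<Prod>x\<leftarrow>[(0, l)]. vkap x i) (\<Sum>x\<leftarrow>[(0, l)]. vdel x i) (Fsingle b 1)"
    consider "i < l" | "i = l" | "l < i"
      by fastforce
    then show "?A l i (Fsingle b 1) n = ?V $$ n"
    proof cases
      case 1
      let ?k = "qh ^ (2 * rank i + 1)"
      have "?A l i (Fsingle b 1) n = dilate ?k phi (Fsingle b 1) n"
        using 1 by simp
      also have "\<dots> = fls_dilate ?k (vop0 (\<lambda>r. - (qq - inverse qq)) 0 (\<lambda>_. 0) (qq powi (- 2)) 0 (Fsingle b 1)) $$ n"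
        unfolding b by (rule dilate_eqI) (rule phi_single)
      also have "fls_dilate ?k (vop0 (\<lambda>r. - (qq - inverse qq)) 0 (\<lambda>_. 0) (qq powi (- 2)) 0 (Fsingle b 1)) =
          vop0 (\<lambda>r. ?k ^ r * - (qq - inverse qq)) 0 (\<lambda>r. 0 * inverse ?k ^ r) (qq powi (- 2) * ?k powi 0) 0 (Fsingle b 1)"
        by (rule vop0_dilate) simp_all
      also have "\<dots> = ?V"
        using 1 less_imp_neq[OF 1] by (simp add: vf_def vs_def vsig_def vkap_def vdel_def mult.commute)
      finally show ?thesis .
    next
      case 2
      let ?k = "qq ^ rank l"
      let ?f = "\<lambda>r. inverse (qh ^ r) / qnum r"
      let ?\<sigma> = "\<lambda>r. - (inverse (qh ^ r) / qnum r) * (qnum (2 * r) * qnum r / of_nat r)"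
      have "?A l i (Fsingle b 1) n = dilate ?k xplus (Fsingle b 1) n"
        using 2 by simp
      also have "\<dots> = fls_dilate ?k (vop0 ?f 1 ?\<sigma> 1 2 (Fsingle b 1)) $$ n"
        unfolding b by (rule dilate_eqI) (rule xplus_single)
      also have "fls_dilate ?k (vop0 ?f 1 ?\<sigma> 1 2 (Fsingle b 1)) =
          vop0 (\<lambda>r. ?k ^ r * ?f r) 1 (\<lambda>r. ?\<sigma> r * inverse ?k ^ r) (1 * ?k powi 2) 2 (Fsingle b 1)"
        by (rule vop0_dilate) simp_all
      also have "\<dots> = ?V"
        using 2 by (simp add: vf_def vs_def vsig_def vkap_def vdel_def mult.commute)
      finally show ?thesis .
    next
      case 3
      then have "\<not> i < l" "i \<noteq> l" by auto
      then show ?thesis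
        by (simp add: one_current_vop0 vf_def vs_def vsig_def vkap_def vdel_def)
    qed
  qed
  then have "tensor_current (?A l) = pcur [(0, l)]" for l :: 'c
    by (simp add: pcur_def cscale_def zshift_def fun_eq_iff)
  then have "x_current = (\<Sum>l\<in>UNIV. pcur [(0, l :: 'c)])"
    by (simp add: x_current_def)
  also have "\<dots> = xcur [0]"
    unfolding xcur_def
    by (rule sum.reindex_bij_witness[of _ "\<lambda>D. snd (hd D)" "\<lambda>l. [(0, l)]"]) auto
  finally show ?thesis .
qed

lemma fls_dilate_map_slot: "fls_dilate k (map_fls (slot i) F) = map_fls (slot i) (fls_dilate k F)"
  by (rule fls_eqI) (simp add: map_fls_nth ring_hom_0[OF ring_hom_slot] slot_fscale)

lemma vopc_dilate:
  fixes \<kappa> :: "'c::finite \<Rightarrow> qfield"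
  assumes k: "k \<noteq> 0" and \<kappa>: "\<And>i. \<kappa> i \<noteq> 0"
  shows "fls_dilate k (vopc f s \<sigma> \<kappa> \<delta> v) =
    vopc (\<lambda>i r. k ^ r * f i r) s (\<lambda>i r. \<sigma> i r * inverse k ^ r) (\<lambda>i. \<kappa> i * k powi \<delta> i) \<delta> v"
proof -
  note hom = ring_hom_fls_dilate[OF k, where 'b = "'c \<Rightarrow> L0_basis"]
  have e: "fps_to_fls (expc f) = (\<Prod>i\<in>UNIV. map_fls (slot i) (fps_to_fls (exp0 (f i))))" for f :: "'c \<Rightarrow> nat \<Rightarrow> qfield"
    unfolding expc_def ring_hom_prod[OF ring_hom_fps_to_fls]
    by (simp add: map_fls_fps_to_fls ring_hom_0[OF ring_hom_slot])
  have 1: "fls_dilate k (fps_to_fls (expc f)) = fps_to_fls (expc (\<lambda>i r. k ^ r * f i r))"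
    unfolding e ring_hom_prod[OF hom] fls_dilate_map_slot exp0_dilate[OF k] ..
  have 2: "fls_dilate k (shiftc \<sigma> \<kappa> \<delta> v) = shiftc (\<lambda>i r. \<sigma> i r * inverse k ^ r) (\<lambda>i. \<kappa> i * k powi \<delta> i) \<delta> v"
  proof (induction v rule: single_induct)
    case (single b c)
    show ?case
      unfolding shiftc_def hom_ext_single[OF ring_hom_fconst]
      unfolding ring_hom_mult[OF hom] ring_hom_prod[OF hom] fls_dilate_map_slot shift0_dilate[OF k \<kappa>] fls_const_eq_mono1 fls_dilate_mono1 by simp
  next
    case (add u v)
    then show ?case
      using k \<kappa> by (simp add: ring_hom_add[OF ring_hom_shiftc] ring_hom_add[OF hom])
  qed
  show ?thesis
    unfolding vopc_def ring_hom_mult[OF hom] 1 2 fls_dilate_mono1 by simp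
qed

definition shiftD :: "nat \<Rightarrow> (nat \<times> 'c) list \<Rightarrow> (nat \<times> 'c) list"
  where "shiftD k = map (\<lambda>(a, l). (a + k, l))"

lemma sum_list_map_shiftD: "(\<Sum>x\<leftarrow>shiftD k D. g x) = (\<Sum>x\<leftarrow>D. g (fst x + k, snd x))"
  by (simp add: shiftD_def case_prod_beta comp_def)

lemma prod_list_map_shiftD: "(\<Prod>x\<leftarrow>shiftD k D. g x) = (\<Prod>x\<leftarrow>D. g (fst x + k, snd x))"
  by (simp add: shiftD_def case_prod_beta comp_def)

lemma vkap_shift: "vkap (fst x + k, snd x) i = vkap x i * (sq ^ k) powi vdel x i"
  by (simp add: vkap_def vdel_def power_add power_mult_distrib mult_ac)

lemma vop_dilate: "fls_dilate (sq ^ k) (vop D v) = vop (shiftD k D) v"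
proof -
  have f: "(sq ^ k) ^ r * (\<Sum>x\<leftarrow>D. vf x i r) = (\<Sum>x\<leftarrow>shiftD k D. vf x i r)" for i r
    unfolding sum_list_map_shiftD sum_list_const_mult[symmetric]
    by (rule arg_cong[of _ _ sum_list], rule map_cong[OF refl])
      (simp add: vf_def power_add power_mult_distrib mult_ac)
  have \<sigma>: "(\<Sum>x\<leftarrow>D. vsig x i r) * inverse (sq ^ k) ^ r = (\<Sum>x\<leftarrow>shiftD k D. vsig x i r)" for i r
    unfolding sum_list_map_shiftD sum_list_mult_const[symmetric]
    by (rule arg_cong[of _ _ sum_list], rule map_cong[OF refl])
      (simp add: vsig_def power_add power_mult_distrib mult_ac)
  have \<kappa>: "(\<Prod>x\<leftarrow>D. vkap x i) * (sq ^ k) powi (\<Sum>x\<leftarrow>D. vdel x i) = (\<Prod>x\<leftarrow>shiftD k D. vkap x i)" for i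
    unfolding prod_list_map_shiftD vkap_shift
    by (induction D) (simp_all add: power_int_add mult_ac)
  have s: "(\<Sum>x\<leftarrow>D. vs x i) = (\<Sum>x\<leftarrow>shiftD k D. vs x i)" "(\<Sum>x\<leftarrow>D. vdel x i) = (\<Sum>x\<leftarrow>shiftD k D. vdel x i)" for i
    unfolding sum_list_map_shiftD by (simp_all add: vs_def vdel_def)
  show ?thesis
    unfolding vop_def f[symmetric] \<sigma>[symmetric] \<kappa>[symmetric] s[symmetric]
    by (rule vopc_dilate) (simp_all add: prod_vkap_nonzero)
qed

text \<open>Contractions depend only on differences of points. The zero modes contribute a power of
  the dilation, exactly what dilating the prefactor $z^d$ with $d =$ \<open>cdeg D\<close>
  produces.\<close>

lemma ccoef_shiftD: "ccoef (shiftD k D) = ccoef D * (sq ^ k) powi cdeg D"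
proof (induction D)
  case (Cons x D)
  have c: "ctr (fst x + k, snd x) (fst y + k, snd y) = ctr x y" for y
    by (simp add: ctr_def Let_def)
  have "(\<Prod>y\<leftarrow>shiftD k D. ctr (fst x + k, snd x) y * vkap (fst x + k, snd x) (snd y)) =
      (\<Prod>y\<leftarrow>D. ctr x y * vkap x (snd y)) * (sq ^ k) powi (\<Sum>y\<leftarrow>D. vdel x (snd y))"
    unfolding prod_list_map_shiftD c snd_conv vkap_shift
    by (induction D) (simp_all add: power_int_add mult_ac)
  moreover have "shiftD k (x # D) = (fst x + k, snd x) # shiftD k D"
    by (simp add: shiftD_def case_prod_beta)
  ultimately show ?case
    by (simp add: Cons power_int_add mult_ac)
qed (simp add: shiftD_def)

lemma cdeg_shiftD: "cdeg (shiftD k D) = cdeg D"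
  by (induction D) (auto simp: shiftD_def vdel_def case_prod_beta comp_def)

lemma dilate_pcur: "dilate (sq ^ k) (pcur D) = pcur (shiftD k D)"
proof (intro ext)
  fix v n
  have "vop (shiftD k D) v $$ (n - cdeg D) = fscale ((sq ^ k) powi (n - cdeg D)) (vop D v $$ (n - cdeg D))"
    by (simp flip: vop_dilate)
  moreover have "(sq ^ k) powi n = (sq ^ k) powi cdeg D * (sq ^ k) powi (n - cdeg D)"
    by (simp flip: power_int_add)
  ultimately show "dilate (sq ^ k) (pcur D) v n = pcur (shiftD k D) v n"
    by (simp add: pcur_def dilate_def cscale_def zshift_def ccoef_shiftD cdeg_shiftD mult_ac)
qed

lemma dilate_add: "dilate k (a + b) = dilate k a + dilate k b"
  by (simp add: dilate_def fun_eq_iff fvec.scale_right_distrib)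

lemma dilate_sum: "dilate k (sum f I) = (\<Sum>i\<in>I. dilate k (f i))"
  by (induction I rule: infinite_finite_induct)
    (simp_all only: sum.infinite sum.empty sum.insert dilate_0 dilate_add not_False_eq_True)

lemma dilate_sum_list: "dilate k (\<Sum>x\<leftarrow>xs. f x) = (\<Sum>x\<leftarrow>xs. dilate k (f x))"
  by (induction xs) (simp_all only: list.map sum_list.Nil sum_list.Cons dilate_0 dilate_add)

lemma dilate_cscale: "dilate k (cscale l a) = cscale l (dilate k a)"
  by (simp add: dilate_def cscale_def fun_eq_iff mult.commute)

lemma dilate_zshift: "k \<noteq> 0 \<Longrightarrow> dilate k (zshift s a) = cscale (k powi s) (zshift s (dilate k a))"
  by (simp add: dilate_def cscale_def zshift_def fun_eq_iff flip: power_int_add)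

lemma dilate_xcur: "dilate (sq ^ k) (xcur a) = xcur (map (\<lambda>i. i + k) a)"
  unfolding xcur_def dilate_sum dilate_pcur
proof (rule sum.reindex_bij_witness[of _ "map (\<lambda>(a, l). (a - k, l))" "shiftD k"], goal_cases)
  case (3 D)
  then have "set (map fst D) = set (map (\<lambda>i. i + k) a)"
    by (simp only: mem_Collect_eq)
  then have "k \<le> fst x" if "x \<in> set D" for x
    using that imageI[OF that, of fst] by auto
  then show ?case
    by (simp add: shiftD_def case_prod_beta map_idI)
next
  case (4 D)
  have "map fst (map (\<lambda>(a, l). (a - k, l)) D) = map (\<lambda>i. i - k) (map fst D)"
    by (simp add: case_prod_beta comp_def)
  with 4 show ?case
    by (simp add: comp_def)
qed (auto simp: shiftD_def case_prod_beta comp_def map_idI)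

lemma current_sum_apply: "(sum f I) v n = (\<Sum>i\<in>I. f i v n)" for f :: "'i \<Rightarrow> 'b fseries"
  by (induction I rule: infinite_finite_induct)
    (simp_all only: sum.infinite sum.empty sum.insert zero_fun_apply plus_fun_apply not_False_eq_True)

primrec sqderiv_coef :: "nat \<Rightarrow> nat \<Rightarrow> qfield" where
  "sqderiv_coef 0 i = (if i = 0 then 1 else 0)"
| "sqderiv_coef (Suc r) i = inverse (sq - 1) *
    (sq powi (- int r) * (case i of 0 \<Rightarrow> 0 | Suc j \<Rightarrow> sqderiv_coef r j) - sqderiv_coef r i)"

lemma sqderiv_coef_eq_0: "r < i \<Longrightarrow> sqderiv_coef r i = 0"
  by (induction r arbitrary: i) (auto split: nat.splits)

lemma sqderiv_coef_0: "sqderiv_coef r 0 \<noteq> 0"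
  by (induction r) simp_all

lemma sqderiv_xcur:
  "(sqderiv ^^ r) (xcur a) = zshift (- int r) (\<Sum>i\<le>r. cscale (sqderiv_coef r i) (xcur (map (\<lambda>j. j + i) a)))"
proof (induction r)
  case 0
  show ?case
    by (simp add: zshift_def cscale_def)
next
  case (Suc r)
  define Y where "Y = (\<lambda>i. xcur (map (\<lambda>j. j + i) a) :: 'a Lc_basis fseries)"
  have Y: "fscale (sq powi m) (Y i v m) = Y (Suc i) v m" for i v m
  proof -
    have "dilate (sq ^ 1) (Y i) = Y (Suc i)"
      unfolding Y_def dilate_xcur by (simp add: comp_def)
    then show ?thesis by (simp add: dilate_def fun_eq_iff)
  qed
  have "sqderiv (zshift (- int r) (\<Sum>i\<le>r. cscale (sqderiv_coef r i) (Y i))) v n =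
      zshift (- int (Suc r)) (\<Sum>i\<le>Suc r. cscale (sqderiv_coef (Suc r) i) (Y i)) v n" for v n
  proof -
    let ?m = "n + 1 + int r" and ?c = "inverse (sq - 1)" and ?g = "sqderiv_coef r"
    \<comment> \<open>\<open>Y i\<close> is read at degree \<open>?m\<close>, where the factor
      \<open>sq powi ?m\<close> turns it into \<open>Y (Suc i)\<close>; the remaining power is the
      one in the recursion.\<close>
    have "sq powi (n + 1) = sq powi (- int r) * sq powi ?m"
      by (simp flip: power_int_add)
    then have *: "fscale (sq powi (n + 1) * k) (Y i v ?m) = fscale (sq powi (- int r) * k) (Y (Suc i) v ?m)" for i k
      by (simp add: mult_ac flip: Y)
    have "sqderiv (zshift (- int r) (\<Sum>i\<le>r. cscale (?g i) (Y i))) v n =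
        fscale ?c ((\<Sum>i\<le>r. fscale (sq powi (n + 1) * ?g i) (Y i v ?m)) - (\<Sum>i\<le>r. fscale (?g i) (Y i v ?m)))"
      by (simp add: sqderiv_def dilate_def zshift_def current_sum_apply cscale_def fvec.scale_sum_right algebra_simps)
    also have "(\<Sum>i\<le>r. fscale (sq powi (n + 1) * ?g i) (Y i v ?m)) =
        (\<Sum>i\<le>Suc r. fscale (sq powi (- int r) * (case i of 0 \<Rightarrow> 0 | Suc j \<Rightarrow> ?g j)) (Y i v ?m))"
      unfolding * by (subst sum.atMost_Suc_shift) simp
    also have "(\<Sum>i\<le>r. fscale (?g i) (Y i v ?m)) = (\<Sum>i\<le>Suc r. fscale (?g i) (Y i v ?m))"
      by (simp add: sqderiv_coef_eq_0)
    also have "fscale ?c ((\<Sum>i\<le>Suc r. fscale (sq powi (- int r) * (case i of 0 \<Rightarrow> 0 | Suc j \<Rightarrow> ?g j)) (Y i v ?m)) -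
        (\<Sum>i\<le>Suc r. fscale (?g i) (Y i v ?m))) = (\<Sum>i\<le>Suc r. fscale (sqderiv_coef (Suc r) i) (Y i v ?m))"
      unfolding sum_subtractf[symmetric] fvec.scale_sum_right
      by (intro sum.cong refl)
        (simp only: sqderiv_coef.simps fvec.scale_scale[symmetric] fvec.scale_left_diff_distrib)
    finally show ?thesis
      by (simp add: zshift_def current_sum_apply cscale_def algebra_simps del: sqderiv_coef.simps sum.atMost_Suc)
  qed
  then have "sqderiv (zshift (- int r) (\<Sum>i\<le>r. cscale (sqderiv_coef r i) (Y i))) =
      zshift (- int (Suc r)) (\<Sum>i\<le>Suc r. cscale (sqderiv_coef (Suc r) i) (Y i))"
    by (intro ext)
  then show ?case
    unfolding funpow.simps comp_apply Suc.IH unfolding Y_def .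
qed

section \<open>Expansion of the monomials\<close>

lemma one_t_eq: "one_t = monom (xcur []) 0"
  by (simp add: one_t_def xcur_Nil)

lemma x_m_eq: "x_m m = monom (xcur [0..<m] :: 'c::{finite,linorder} Lc_basis fseries) m"
proof (induction m)
  case 0
  show ?case by (simp add: x_m_def one_t_eq)
next
  case (Suc m)
  have "lprod ((sqderiv ^^ 0) (xcur [0] :: 'c Lc_basis fseries)) (dilate (sq ^ (1 + 0)) (xcur [0..<m])) (xcur ([0] @ map (\<lambda>i. i + 1) [0..<m]))"
    unfolding dilate_xcur by (simp only: funpow_0 add_0_right) (rule lprod_xcur, auto)
  then have "prod_hom 0 (xcur [0] :: 'c Lc_basis fseries) 1 (xcur [0..<m]) = cscale (inverse (sqfact 0)) (xcur ([0] @ map (\<lambda>i. i + 1) [0..<m]))"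
    by (rule prod_hom_lprod)
  also have "[0] @ map (\<lambda>i. i + 1) [0..<m] = [0..<Suc m]"
    using upt_conv_Cons[of 0 "Suc m"] by (simp add: map_Suc_upt del: upt_Suc)
  also have "cscale (inverse (sqfact 0)) (xcur [0..<Suc m]) = (xcur [0..<Suc m] :: 'c Lc_basis fseries)"
    by (simp only: sqfact_def) (simp add: cscale_def)
  finally have "prod_hom 0 (xcur [0] :: 'c Lc_basis fseries) 1 (xcur [0..<m]) = xcur [0..<Suc m]" .
  then show ?case
    using Suc cprod_monom[OF clinear_xcur, of "- 1" "[0]" 1 "xcur [0..<m] :: 'c Lc_basis fseries" m]
    by (simp add: x_m_def x_t_def x_current_eq)
qed

fun msh :: "(nat \<times> int) list \<Rightarrow> int" where
  "msh [] = 0"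
| "msh ((m, r) # ms) = int (nat (- r - 1)) + msh ms"

fun mwt :: "(nat \<times> int) list \<Rightarrow> nat" where
  "mwt [] = 0"
| "mwt ((m, r) # ms) = m + mwt ms + nat (- r - 1)"

text \<open>\<open>mexp ms\<close> lists the terms of the expansion of $z^s x_{m_1}(z,t)_{r_1} \cdots \mathbf 1|_{t=1}$,
  $s = $ \<open>msh ms\<close>, into the currents \<open>xcur a\<close>; its first term is a multiple of \<open>xcur (lead ms)\<close>.\<close>

fun mexp :: "(nat \<times> int) list \<Rightarrow> (qfield \<times> nat list) list" where
  "mexp [] = [(1, [])]"
| "mexp ((m, r) # ms) = (let s = nat (- r - 1) in
    concat (map (\<lambda>i. map (\<lambda>(c, a). (inverse (sqfact s) * (sq ^ (m + s)) powi (- msh ms) * sqderiv_coef s i * c,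
      map (\<lambda>j. j + i) [0..<m] @ map (\<lambda>j. j + (m + s)) a)) (mexp ms)) [0..<Suc s]))"

fun lead :: "(nat \<times> int) list \<Rightarrow> nat list" where
  "lead [] = []"
| "lead ((m, r) # ms) = [0..<m] @ map (\<lambda>j. j + (m + nat (- r - 1))) (lead ms)"

definition mcur :: "(nat \<times> int) list \<Rightarrow> 'c::{finite,linorder} Lc_basis fseries"
  where "mcur ms = zshift (- msh ms) (\<Sum>(c, a)\<leftarrow>mexp ms. cscale c (xcur a))"

lemma cscale_sum_list:
  fixes f :: "'i \<Rightarrow> 'b fseries"
  shows "cscale k (\<Sum>x\<leftarrow>xs. f x) = (\<Sum>x\<leftarrow>xs. cscale k (f x))"
proof -
  have "cscale k 0 = (0 :: 'b fseries)"
    by (rule cvec.scale_zero_right)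
  then show ?thesis
    by (induction xs) (simp_all only: list.map sum_list.Nil sum_list.Cons cvec.scale_right_distrib)
qed

lemma x_monomial_eq:
  assumes "\<forall>(m, r)\<in>set ms. r < 0"
  shows "x_monomial ms = monom (mcur ms) (mwt ms)"
  using assms
proof (induction ms)
  case Nil
  show ?case
    by (simp add: x_monomial_def one_t_eq mcur_def zshift_def cscale_def)
next
  case (Cons p ms)
  obtain m r where p: "p = (m, r)" by fastforce
  define s where "s = nat (- r - 1)"
  define S where "S = msh ms"
  \<comment> \<open>The scalar from dilating the prefactor $z^{-S}$ of the inner monomial.\<close>
  define k where "k = (sq ^ (m + s)) powi (- S)"
  let ?b = "\<lambda>i. map (\<lambda>j. j + i) [0..<m]" and ?sh = "map (\<lambda>j. j + (m + s))"
  let ?X = "xcur [0..<m] :: 'a Lc_basis fseries"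
  have r: "r < 0" using Cons.prems p by simp
  have "x_monomial (p # ms) = cprod (monom ?X m) r (monom (mcur ms) (mwt ms))"
    using Cons by (simp add: x_monomial_def p x_m_eq)
  also have "\<dots> = monom (prod_hom s ?X m (mcur ms)) (m + mwt ms + s)"
    using cprod_monom[OF clinear_xcur r] by (simp add: s_def)
  also have "prod_hom s ?X m (mcur ms) = mcur (p # ms)"
  proof -
    let ?C = "\<Sum>i\<le>s. cscale (sqderiv_coef s i) (\<Sum>(c, a)\<leftarrow>mexp ms. cscale c (xcur (?b i @ ?sh a))) :: 'a Lc_basis fseries"
    have d: "dilate (sq ^ (m + s)) (mcur ms) = cscale k (zshift (- S) (\<Sum>(c, a)\<leftarrow>mexp ms. cscale c (xcur (?sh a))))"
      unfolding mcur_def k_def S_def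
      by (subst dilate_zshift) (simp_all add: dilate_sum_list dilate_cscale dilate_xcur case_prod_beta')
    have cl: "clinear (\<Sum>i\<le>s. cscale (sqderiv_coef s i) (xcur (?b i)))"
      by (intro clinear_sum clinear_cscale clinear_xcur)
    have "lprod ((sqderiv ^^ s) ?X) (dilate (sq ^ (m + s)) (mcur ms)) (cscale k (zshift (- int s + - S) ?C))"
      unfolding sqderiv_xcur d
    proof (intro lprod_scale_right lprod_zshift clinear_zshift cl lprod_sum_left lprod_scale_left finite_atMost)
      fix i assume "i \<in> {..s}"
      then show "lprod (xcur (?b i)) (\<Sum>(c, a)\<leftarrow>mexp ms. cscale c (xcur (?sh a)))
          (\<Sum>(c, a)\<leftarrow>mexp ms. cscale c (xcur (?b i @ ?sh a)))"
        unfolding case_prod_beta'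
        by (intro lprod_sum_list_right clinear_xcur lprod_scale_right lprod_xcur) auto
    qed
    then have "prod_hom s ?X m (mcur ms) = cscale (inverse (sqfact s)) (cscale k (zshift (- int s + - S) ?C))"
      by (rule prod_hom_lprod)
    also have "\<dots> = zshift (- msh (p # ms)) (cscale (inverse (sqfact s) * k) ?C)"
      by (simp add: p s_def S_def zshift_cscale)
    also have "cscale (inverse (sqfact s) * k) ?C = (\<Sum>(c, a)\<leftarrow>mexp (p # ms). cscale c (xcur a))"
    proof -
      have "?C = (\<Sum>i\<leftarrow>[0..<Suc s]. cscale (sqderiv_coef s i) (\<Sum>(c, a)\<leftarrow>mexp ms. cscale c (xcur (?b i @ ?sh a))))"
        by (simp only: interv_sum_list_conv_sum_set_nat atLeast0LessThan lessThan_Suc_atMost set_upt)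
      moreover have conc: "sum_list (concat (map h is)) = (\<Sum>i\<leftarrow>is. sum_list (h i))"
        for h :: "nat \<Rightarrow> 'a Lc_basis fseries list" and "is"
        by (induction "is") (simp_all only: list.map concat.simps sum_list.Nil sum_list.Cons sum_list_append)
      ultimately show ?thesis
        unfolding p mexp.simps Let_def s_def[symmetric] S_def[symmetric] k_def[symmetric] map_concat conc map_map
        by (simp only: cscale_sum_list) (simp only: comp_def case_prod_beta' map_map fst_conv snd_conv cvec.scale_scale mult.assoc)
    qed
    finally show ?thesis
      by (simp only: mcur_def)
  qed
  finally show ?case
    by (simp add: p s_def)
qed

section \<open>Leading terms of the expansions\<close>

lemma sqfact_nonzero: "sqfact s \<noteq> 0"
proof -
  have "sqint (int i) \<noteq> 0" if "1 \<le> i" for i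
    using that sq_power_neq_1[of i] by (simp add: sqint_def)
  then show ?thesis by (simp add: sqfact_def)
qed

lemma sum_list_shift: "sum_list (map (\<lambda>j. j + k) a) = sum_list a + k * length a" for a :: "nat list"
  by (induction a) simp_all

lemma mexp_sorted:
  assumes "(c, a) \<in> set (mexp ms)"
  shows "sorted_wrt (<) a" and "length a = length (lead ms)"
  using assms
proof (induction ms arbitrary: c a)
  case (Cons p ms)
  obtain m r where p: "p = (m, r)" by fastforce
  { case 1
    then show ?case using Cons.IH(1)
      by (fastforce simp: p Let_def sorted_wrt_append sorted_wrt_map)
  next
    case 2
    then show ?case using Cons.IH(2)
      by (auto simp: p Let_def) }
qed auto

lemma mexp_lead:
  assumes "\<forall>(m, r)\<in>set ms. 1 \<le> m"
  shows "\<exists>c rest. mexp ms = (c, lead ms) # rest \<and> c \<noteq> 0 \<and> (\<forall>(c', a)\<in>set rest. sum_list (lead ms) < sum_list a)"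
  using assms
proof (induction ms)
  case (Cons p ms)
  obtain m r where p: "p = (m, r)" by fastforce
  then have m: "1 \<le> m" using Cons.prems by simp
  define s where "s = nat (- r - 1)"
  obtain c rest where IH: "mexp ms = (c, lead ms) # rest" "c \<noteq> 0"
      "\<And>c' a. (c', a) \<in> set rest \<Longrightarrow> sum_list (lead ms) < sum_list a"
    using Cons by fastforce
  define f where "f = (\<lambda>i (c, a). (inverse (sqfact s) * (sq ^ (m + s)) powi (- msh ms) * sqderiv_coef s i * c,
      map (\<lambda>j. j + i) [0..<m] @ map (\<lambda>j. j + (m + s)) a))"
  have len: "length a = length (lead ms)" if "(c', a) \<in> set (mexp ms)" for c' a
    using mexp_sorted(2)[OF that] .
  have sum: "sum_list (snd (f i (c', a))) = sum_list [0..<m] + i * m + (sum_list a + (m + s) * length a)" for i c' a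
    by (simp add: f_def sum_list_shift)
  have le: "sum_list (lead ms) \<le> sum_list a" if "(c', a) \<in> set (mexp ms)" for c' a
    using that IH by (auto intro: less_imp_le)
  have upt: "[0..<Suc s] = 0 # [1..<Suc s]"
    by (simp add: upt_conv_Cons del: upt_Suc)
  have "mexp (p # ms) = concat (map (\<lambda>i. map (f i) (mexp ms)) [0..<Suc s])"
    by (simp only: p mexp.simps Let_def s_def f_def)
  then have eq: "mexp (p # ms) = f 0 (c, lead ms) # (map (f 0) rest @ concat (map (\<lambda>i. map (f i) (mexp ms)) [1..<Suc s]))"
    unfolding upt list.map concat.simps by (simp add: IH(1) del: upt_Suc)
  have f0: "f 0 (c, lead ms) = (fst (f 0 (c, lead ms)), lead (p # ms))" and nz: "fst (f 0 (c, lead ms)) \<noteq> 0"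
    using IH(2) by (auto simp: f_def p s_def sqfact_nonzero sqderiv_coef_0)
  have lead: "sum_list (lead (p # ms)) = sum_list [0..<m] + (sum_list (lead ms) + (m + s) * length (lead ms))"
    by (simp add: p s_def sum_list_shift)
  have A: "sum_list (lead (p # ms)) < sum_list a" if "(c', a) \<in> set (map (f 0) rest)" for c' a
  proof -
    obtain c1 a1 where 1: "(c1, a1) \<in> set rest" "(c', a) = f 0 (c1, a1)"
      using \<open>(c', a) \<in> set (map (f 0) rest)\<close> by force
    have "a = snd (f 0 (c1, a1))" using 1(2) by (metis snd_conv)
    then show ?thesis
      using IH(3)[OF 1(1)] len[of c1 a1] 1(1) IH(1) unfolding lead by (simp add: sum)
  qed
  have B: "sum_list (lead (p # ms)) < sum_list a"
    if mem: "(c', a) \<in> set (concat (map (\<lambda>i. map (f i) (mexp ms)) [1..<Suc s]))" for c' a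
  proof -
    obtain i c1 a1 where 1: "1 \<le> i" "(c1, a1) \<in> set (mexp ms)" "(c', a) = f i (c1, a1)"
      using mem by (force simp del: upt_Suc)
    have a: "a = snd (f i (c1, a1))" using 1(3) by (metis snd_conv)
    have "0 < i * m" using m 1(1) by simp
    then show ?thesis
      using le[OF 1(2)] unfolding lead a sum len[OF 1(2)] by linarith
  qed
  let ?R = "map (f 0) rest @ concat (map (\<lambda>i. map (f i) (mexp ms)) [1..<Suc s])"
  have "\<forall>(c', a)\<in>set ?R. sum_list (lead (p # ms)) < sum_list a"
    unfolding set_append by (intro ballI) (use A B in blast)
  moreover have "mexp (p # ms) = (fst (f 0 (c, lead ms)), lead (p # ms)) # ?R"
    using eq f0 by metis
  ultimately show ?case
    using nz by blast
qed simp

fun admissible :: "nat \<Rightarrow> (nat \<times> int) list \<Rightarrow> bool" where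
  "admissible c [] \<longleftrightarrow> True"
| "admissible c ((m, r) # ms) \<longleftrightarrow> 1 \<le> m \<and> m \<le> c \<and> (if ms = [] then r \<le> -1 else r \<le> -2) \<and> admissible c ms"

lemma admissible_iff:
  "admissible c ms \<longleftrightarrow> (\<forall>(m, r)\<in>set ms. 1 \<le> m \<and> m \<le> c) \<and> (\<forall>(m, r)\<in>set (butlast ms). r \<le> -2) \<and>
    (ms \<noteq> [] \<longrightarrow> snd (last ms) \<le> -1)"
  by (induction c ms rule: admissible.induct) auto

lemma admissible_neg: "admissible c ms \<Longrightarrow> \<forall>(m, r)\<in>set ms. r < 0"
  by (induction c ms rule: admissible.induct) (auto split: if_splits)

lemma admissible_pos: "admissible c ms \<Longrightarrow> \<forall>(m, r)\<in>set ms. 1 \<le> m"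
  by (induction c ms rule: admissible.induct) auto

lemma lead_eq_Nil: "admissible c ms \<Longrightarrow> lead ms = [] \<longleftrightarrow> ms = []"
  by (cases "(c, ms)" rule: admissible.cases) auto

lemma hd_lead: "admissible c ms \<Longrightarrow> ms \<noteq> [] \<Longrightarrow> lead ms ! 0 = 0"
  by (cases "(c, ms)" rule: admissible.cases) (auto simp: nth_append)

text \<open>The lengths of the maximal runs of consecutive numbers in \<open>lead ms\<close> are the \<open>m\<^sub>j\<close>, and the gaps
  between them give all \<open>r\<^sub>j\<close> but the last one.\<close>

lemma lead_inj:
  assumes "admissible c ms" "admissible c ms'" "lead ms = lead ms'" "msh ms = msh ms'"
  shows "ms = ms'"
  using assms
proof (induction ms arbitrary: ms')
  case Nil
  then show ?case using lead_eq_Nil[of c ms'] by simp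
next
  case (Cons p ms)
  obtain m r where p: "p = (m, r)" by fastforce
  obtain m' r' ms1 where ms': "ms' = (m', r') # ms1"
    using Cons.prems lead_eq_Nil[of c ms'] lead_eq_Nil[of c "p # ms"] by (cases ms') auto
  define s s' where "s = nat (- r - 1)" and "s' = nat (- r' - 1)"
  have eq: "[0..<m] @ map (\<lambda>j. j + (m + s)) (lead ms) = [0..<m'] @ map (\<lambda>j. j + (m' + s')) (lead ms1)"
    using Cons.prems(3) by (simp add: p ms' s_def s'_def)
  have adm: "admissible c ms" "admissible c ms1" and m: "1 \<le> m" "1 \<le> m'"
    and gap: "ms \<noteq> [] \<Longrightarrow> 1 \<le> s" "ms1 \<noteq> [] \<Longrightarrow> 1 \<le> s'"
    using Cons.prems by (auto simp: p ms' s_def s'_def split: if_splits)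
  have notin: "m \<notin> set ([0..<m] @ map (\<lambda>j. j + (m + s)) (lead ms))"
    using gap(1) lead_eq_Nil[OF adm(1)] by (cases "ms = []") auto
  have notin': "m' \<notin> set ([0..<m'] @ map (\<lambda>j. j + (m' + s')) (lead ms1))"
    using gap(2) lead_eq_Nil[OF adm(2)] by (cases "ms1 = []") auto
  have "m = m'"
  proof (rule ccontr)
    assume "m \<noteq> m'"
    then consider "m < m'" | "m' < m" by linarith
    then show False
    proof cases
      case 1
      then show False using notin unfolding eq by simp
    next
      case 2
      then show False using notin' unfolding eq[symmetric] by simp
    qed
  qed
  then have eq': "map (\<lambda>j. j + (m + s)) (lead ms) = map (\<lambda>j. j + (m + s')) (lead ms1)"
    using eq by simp
  have nil: "ms = [] \<longleftrightarrow> ms1 = []"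
    using eq' lead_eq_Nil[OF adm(1)] lead_eq_Nil[OF adm(2)] by (metis Nil_is_map_conv)
  \<comment> \<open>The first entry of the next block shows the gap, as each \<open>lead\<close>
    begins with 0. After the last block only \<open>msh\<close> is left to determine it.\<close>
  have "s = s' \<and> lead ms = lead ms1"
  proof (cases "ms = []")
    case True
    then have "ms1 = []"
      using nil by simp
    with True have "int s = int s'"
      using Cons.prems(4) by (simp only: p ms' msh.simps s_def s'_def add_0_right)
    then show ?thesis
      using True \<open>ms1 = []\<close> by simp
  next
    case False
    then have "s = s'"
      using arg_cong[OF eq', of "\<lambda>xs. xs ! 0"] hd_lead[OF adm(1)] hd_lead[OF adm(2)] nil
        lead_eq_Nil[OF adm(1)] lead_eq_Nil[OF adm(2)] by simp
    moreover have "inj (\<lambda>j::nat. j + (m + s))"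
      by (simp add: inj_def)
    ultimately show ?thesis
      using eq' by (simp add: inj_map_eq_map)
  qed
  moreover from this have "ms = ms1"
    using Cons.IH[OF adm] Cons.prems(4) by (simp add: p ms' s_def s'_def)
  moreover have "r < 0" "r' < 0"
    using admissible_neg[OF Cons.prems(1)] admissible_neg[OF Cons.prems(2)] by (auto simp: p ms')
  ultimately show ?case
    using \<open>m = m'\<close> by (simp add: p ms' s_def s'_def)
qed

section \<open>Evaluation of the vertex operators on the vacuum\<close>

lemma rank_less_iff: "rank i < rank j \<longleftrightarrow> i < j" for i j :: "'c::{finite,linorder}"
proof -
  have mono: "rank i < rank j" if "i < j" for i j :: 'c
    unfolding rank_def by (rule psubset_card_mono) (use that in auto)
  show ?thesis
    using mono[of i j] mono[of j i] by (cases i j rule: linorder_cases) auto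
qed

lemma rank_inj: "rank i = rank j \<longleftrightarrow> i = j" for i j :: "'c::{finite,linorder}"
  using rank_less_iff[of i j] rank_less_iff[of j i] by (cases i j rule: linorder_cases) auto

lemma rank_less_CARD: "rank (i :: 'c::{finite,linorder}) < CARD('c)"
  unfolding rank_def by (rule psubset_card_mono) auto

lemma rank_image_lessThan: "rank ` {j. j < i} = {..<rank i}" for i :: "'c::{finite,linorder}"
proof (rule card_subset_eq)
  show "rank ` {j. j < i} \<subseteq> {..<rank i}"
    by (auto simp: rank_less_iff)
  have "card (rank ` {j. j < i}) = card {j. j < i}"
    by (rule card_image) (simp add: inj_on_def rank_inj)
  then show "card (rank ` {j. j < i}) = card {..<rank i}"
    by (simp add: rank_def)
qed simp

lemma rank_surj:
  assumes "k < CARD('c::{finite,linorder})"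
  shows "\<exists>i::'c. rank i = k"
proof -
  have "rank ` (UNIV :: 'c set) = {..<CARD('c)}"
  proof (rule card_subset_eq)
    show "card (rank ` (UNIV :: 'c set)) = card {..<CARD('c)}"
      by (subst card_image) (simp_all add: inj_on_def rank_inj)
  qed (auto simp: rank_less_CARD)
  then show ?thesis using assms by (metis imageE lessThan_iff)
qed

text \<open>The weights are chosen such that \<open>specialize\<close> maps the exponent of the creation part of the vertex
  operator attached to \<open>(a, l)\<close> to $l\mathsf q^a T z$.\<close>

definition weight :: "'c::{finite,linorder} \<Rightarrow> qfield"
  where "weight i = qh * inverse (qq ^ rank i) * (\<Sum>t\<le>rank i. sq ^ t)"

text \<open>Index 0 is $a(-1)$. The other $a(-r)$ go to 0 and the group elements to 1, so only the
  linear term of an exponent survives.\<close>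

definition specialize :: "'c::{finite,linorder} Lc \<Rightarrow> qfield poly"
  where "specialize = hom_ext (\<lambda>k. [:k:])
    (\<lambda>b. \<Prod>i\<in>UNIV. mu_prod (\<lambda>r. if r = 0 then [:0, weight i:] else 0) (fst (b i)))"

lemma ring_hom_const_poly: "ring_hom (\<lambda>k::qfield. [:k:])"
  by (simp add: ring_hom_def)

lemma alg_hom_specialize: "alg_hom (\<lambda>k. [:k:]) specialize"
  unfolding specialize_def
  by (rule alg_hom_hom_ext[OF ring_hom_const_poly]) (simp_all add: mu_prod_0 mu_prod_add prod.distrib)

lemmas ring_hom_specialize = alg_hom_ring_hom[OF alg_hom_specialize]

lemma specialize_slot:
  "specialize (slot i (Fsingle (\<mu>, k) 1)) = mu_prod (\<lambda>r. if r = 0 then [:0, weight i:] else 0) \<mu>"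
proof -
  have "mu_prod (\<lambda>r. if r = 0 then [:0, weight j:] else 0) (fst (if j = i then (\<mu>, k) else 0)) =
      (if j = i then mu_prod (\<lambda>r. if r = 0 then [:0, weight i:] else 0) \<mu> else 1)" for j
    by (auto simp: mu_prod_0)
  then show ?thesis
    by (simp add: specialize_def slot_single hom_ext_single[OF ring_hom_const_poly])
qed

lemma specialize_xvar: "specialize (slot i (xvar r)) = (if r = 0 then [:0, weight i:] else 0)"
  by (simp add: xvar_def specialize_slot mu_prod_single)

lemma specialize_evarc: "specialize (evarc s) = 1"
  by (simp add: evarc_def ring_hom_prod[OF ring_hom_specialize] evar_def specialize_slot mu_prod_0)

lemma specialize_linc: "specialize (linc f r) = (if r \<le> 1 then [:0, \<Sum>i\<in>UNIV. weight i * f i r:] else 0)"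
proof -
  have "specialize (linc f r) = (\<Sum>i\<in>UNIV. smult (f i r) (if r - 1 = 0 then [:0, weight i:] else 0))"
    by (simp add: linc_def ring_hom_sum[OF ring_hom_specialize] alg_hom_fscale[OF alg_hom_specialize] specialize_xvar)
  moreover have "(\<Sum>i\<in>A. smult (f i r) [:0, weight i:]) = [:0, \<Sum>i\<in>A. weight i * f i r:]" for A
    by (induction A rule: infinite_finite_induct) (simp_all add: mult.commute)
  ultimately show ?thesis by simp
qed

lemma sum_weight_vf: "(\<Sum>i\<in>UNIV. weight i * vf x i 1) = of_nat (rank (snd x) + 1) * sq ^ fst x"
proof -
  define l where "l = snd x"
  define w where "w = (\<lambda>n. \<Sum>t\<le>n. sq ^ t)"
  have qh2: "(qq - inverse qq) * qh * qh = sq - 1"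
    by (simp add: qq_def sq_def power2_eq_square field_simps)
  have less: "weight i * vf x i 1 = - (sq ^ fst x) * ((sq - 1) * w (rank i))" if "i < l" for i
  proof -
    define d where "d = qq - inverse qq"
    have "vf x i 1 = - d * (sq ^ fst x * (qh ^ (2 * rank i) * qh))"
      using that by (simp add: vf_def l_def d_def mult_ac)
    then have "weight i * vf x i 1 = - (sq ^ fst x) * (((qq - inverse qq) * qh * qh) * w (rank i)) * (inverse (qq ^ rank i) * qh ^ (2 * rank i))"
      unfolding d_def[symmetric] by (simp add: weight_def w_def mult_ac)
    also have "qh ^ (2 * rank i) = qq ^ rank i"
      by (simp add: qq_def power_mult)
    finally show ?thesis
      unfolding qh2 by simp
  qed
  have eq: "weight l * vf x l 1 = sq ^ fst x * w (rank l)"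
  proof -
    have "qnum 1 = 1"
      using qq_diff_nonzero by (simp add: qnum_def)
    then show ?thesis
      by (simp add: weight_def vf_def l_def w_def field_simps)
  qed
  have "(\<Sum>i\<in>UNIV. weight i * vf x i 1) = (\<Sum>i\<in>insert l {i. i < l}. weight i * vf x i 1)"
    by (rule sum.mono_neutral_right) (auto simp: vf_def l_def)
  also have "\<dots> = sq ^ fst x * w (rank l) + (\<Sum>i | i < l. - (sq ^ fst x) * ((sq - 1) * w (rank i)))"
  proof -
    have "(\<Sum>i | i < l. weight i * vf x i 1) = (\<Sum>i | i < l. - (sq ^ fst x) * ((sq - 1) * w (rank i)))"
      by (rule sum.cong[OF refl]) (rule less, simp)
    then show ?thesis
      unfolding eq[symmetric] by simp
  qed
  also have "(\<Sum>i | i < l. - (sq ^ fst x) * ((sq - 1) * w (rank i))) = (\<Sum>t<rank l. - (sq ^ fst x) * ((sq - 1) * w t))"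
    unfolding rank_image_lessThan[symmetric]
    by (rule sum.reindex[symmetric, unfolded comp_def]) (simp add: inj_on_def rank_inj)
  also have "(\<Sum>t<rank l. - (sq ^ fst x) * ((sq - 1) * w t)) = - (sq ^ fst x) * ((sq - 1) * (\<Sum>t<rank l. w t))"
    by (simp add: sum_distrib_left)
  also have "(sq - 1) * (\<Sum>t<n. w t) = w n - of_nat (n + 1)" for n
  proof (induction n)
    case (Suc n)
    have g: "(sq - 1) * w n = sq * sq ^ n - 1"
      unfolding w_def by (induction n) (simp_all add: algebra_simps)
    show ?case
      using Suc g by (simp add: distrib_left w_def)
  qed (simp add: w_def)
  finally show ?thesis
    by (simp add: l_def algebra_simps)
qed

definition epsilon :: "(nat \<times> 'c::{finite,linorder}) list \<Rightarrow> qfield"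
  where "epsilon D = (\<Sum>x\<leftarrow>D. of_nat (rank (snd x) + 1) * sq ^ fst x)"

lemma specialize_expc:
  "specialize (expc (\<lambda>i r. \<Sum>x\<leftarrow>D. vf x i r) $ n) = monom (epsilon D ^ n / fact n) n"
proof -
  let ?g = "\<lambda>r::nat. if r \<le> 1 then [:0, epsilon D:] else 0"
  have "(\<Sum>i\<in>UNIV. weight i * (\<Sum>x\<leftarrow>D. vf x i 1)) = epsilon D"
    unfolding epsilon_def sum_weight_vf[symmetric]
    by (simp add: sum_list_const_mult[symmetric] sum_list_swap_sum)
  then have g: "specialize (linc (\<lambda>i r. \<Sum>x\<leftarrow>D. vf x i r) r) = ?g r" if "1 \<le> r" for r
    using that by (cases "r = 1") (auto simp: specialize_linc)
  have "is_exp ?g E \<longleftrightarrow> is_exp (\<lambda>r. specialize (linc (\<lambda>i r. \<Sum>x\<leftarrow>D. vf x i r) r)) E" for E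
    by (rule is_exp_cong) (simp only: g)
  then have 1: "is_exp ?g (map_fps specialize (expc (\<lambda>i r. \<Sum>x\<leftarrow>D. vf x i r)))"
    using is_exp_hom[OF ring_hom_specialize is_exp_expc] by blast
  have 2: "is_exp ?g (Abs_fps (\<lambda>n. monom (epsilon D ^ n / fact n) n))"
    unfolding is_exp_iff
  proof safe
    fix n
    show "of_nat n * Abs_fps (\<lambda>n. monom (epsilon D ^ n / fact n) n) $ n =
        (\<Sum>r=1..n. of_nat r * ?g r * Abs_fps (\<lambda>n. monom (epsilon D ^ n / fact n) n) $ (n - r))"
    proof (cases n)
      case (Suc m)
      have "(\<Sum>r=1..n. of_nat r * ?g r * Abs_fps (\<lambda>n. monom (epsilon D ^ n / fact n) n) $ (n - r)) =
          (\<Sum>r\<in>{1}. of_nat r * ?g r * Abs_fps (\<lambda>n. monom (epsilon D ^ n / fact n) n) $ (n - r))"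
        by (rule sum.mono_neutral_right) (auto simp: Suc)
      also have "\<dots> = monom (epsilon D ^ n / fact m) n"
        by (simp add: Suc monom_Suc smult_monom)
      also have "\<dots> = of_nat n * monom (epsilon D ^ n / fact n) n"
      proof -
        have "fact n = (of_nat n * fact m :: qfield)" "of_nat n \<noteq> (0 :: qfield)"
          by (simp_all add: Suc del: of_nat_Suc)
        then show ?thesis
          by (simp add: of_nat_poly smult_monom)
      qed
      finally show ?thesis by simp
    qed simp
  qed simp
  show ?thesis
    using is_exp_uniq[OF ring_hom_const_poly 1 2] by (simp add: fps_eq_iff)
qed

text \<open>The vacuum is the unit of the algebra and thus fixed by the annihilation part; only the
  creation exponential is seen.\<close>

lemma specialize_pcur:
  "specialize (pcur D 1 n) = (if n < cdeg D then 0
    else smult (ccoef D) (monom (epsilon D ^ nat (n - cdeg D) / fact (nat (n - cdeg D))) (nat (n - cdeg D))))"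
proof -
  have "vop D 1 = fps_to_fls (expc (\<lambda>i r. \<Sum>x\<leftarrow>D. vf x i r)) * mono1 (evarc (\<lambda>i. \<Sum>x\<leftarrow>D. vs x i)) 0"
    by (simp add: vop_def vopc_def ring_hom_1[OF ring_hom_shiftc[OF prod_vkap_nonzero]])
  then show ?thesis
    by (simp add: pcur_def cscale_def zshift_def times_mono1_nth alg_hom_fscale[OF alg_hom_specialize]
      ring_hom_0[OF ring_hom_specialize] ring_hom_mult[OF ring_hom_specialize] specialize_evarc specialize_expc)
qed

section \<open>Linear independence\<close>

lemma epsilon_eq: "epsilon D = to_fract (\<Sum>x\<leftarrow>D. monom (of_nat (rank (snd x) + 1)) (4 * fst x))"
proof -
  have "of_nat n * sq ^ a = to_fract (monom (of_nat n) (4 * a))" for n a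
  proof -
    have "of_nat n = to_fract (of_nat n :: complex poly)"
      by (induction n) simp_all
    then show ?thesis
      by (simp add: sq_power of_nat_poly smult_monom flip: to_fract_mult)
  qed
  then show ?thesis
    by (induction D) (simp_all add: epsilon_def del: of_nat_add of_nat_Suc)
qed

text \<open>As a polynomial in $q^{1/2}$, \<open>epsilon D\<close> has at degree $4a$ the label of
  the point $a$. Labels are positive, so the support gives the points, and the strict order gives
  the list.\<close>

lemma epsilon_inj:
  fixes D D' :: "(nat \<times> 'c::{finite,linorder}) list"
  assumes "sorted_wrt (<) (map fst D)" "sorted_wrt (<) (map fst D')" "epsilon D = epsilon D'"
  shows "D = D'"
proof -
  let ?p = "\<lambda>D :: (nat \<times> 'c) list. \<Sum>x\<leftarrow>D. monom (of_nat (rank (snd x) + 1) :: complex) (4 * fst x)"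
  have dist: "distinct (map fst E)" if "sorted_wrt (<) (map fst E)" for E :: "(nat \<times> 'c) list"
    using that strict_sorted_iff by blast
  have coeff: "coeff (?p E) (4 * a) = (case map_of E a of None \<Rightarrow> 0 | Some l \<Rightarrow> of_nat (rank l + 1))"
    if "distinct (map fst E)" for E :: "(nat \<times> 'c) list" and a
    using that
  proof (induction E)
    case (Cons x E)
    have "map_of E (fst x) = None"
      using Cons.prems by (simp add: map_of_eq_None_iff)
    then show ?case
      using Cons by (cases x) (auto split: option.splits simp del: of_nat_add of_nat_Suc)
  qed simp
  have "?p D = ?p D'"
    using assms(3) unfolding epsilon_eq by (simp only: to_fract_eq_iff)
  then have opt: "(case map_of D a of None \<Rightarrow> 0 | Some l \<Rightarrow> of_nat (rank l + 1)) =
      (case map_of D' a of None \<Rightarrow> 0 :: complex | Some l \<Rightarrow> of_nat (rank l + 1))" for a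
    using coeff[OF dist[OF assms(1)], of a] coeff[OF dist[OF assms(2)], of a] by simp
  have "map_of D a = map_of D' a" for a
    using opt[of a]
    by (auto simp: rank_inj split: option.splits simp del: of_nat_Suc)
  then have map: "map_of D = map_of D'" ..
  then have "set (map fst D) = set (map fst D')"
    by (simp add: dom_map_of_conv_image_fst[symmetric])
  then have "map fst D = map fst D'"
    using assms(1,2) strict_sorted_equal by blast
  moreover have "map (\<lambda>a. (a, the (map_of E a))) (map fst E) = E" if "distinct (map fst E)" for E :: "(nat \<times> 'c) list"
    unfolding map_map by (rule map_idI) (use that in \<open>auto simp: map_of_is_SomeI\<close>)
  ultimately show ?thesis
    using dist assms(1,2) map by metis
qed

text \<open>On the vacuum, the coefficients of $z^{n + d}$ in \<open>pcur D\<close>, with $d = $ \<open>cdeg D\<close>, are mapped to multiples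
  of $\epsilon_D^n T^n / n!$ with distinct \<open>epsilon D\<close>; interpolation separates them.\<close>

definition component :: "qfield poly \<Rightarrow> int \<Rightarrow> 'c::{finite,linorder} Lc_basis fseries \<Rightarrow> qfield"
  where "component \<pi> k a = (\<Sum>m\<le>degree \<pi>. coeff \<pi> m * fact m * coeff (specialize (a 1 (k + int m))) m)"

lemma component_add: "component \<pi> k (a + b) = component \<pi> k a + component \<pi> k b"
  by (simp add: component_def ring_hom_add[OF ring_hom_specialize] distrib_left sum.distrib)

lemma component_0: "component \<pi> k 0 = 0"
  by (simp add: component_def ring_hom_0[OF ring_hom_specialize])

lemma component_cscale: "component \<pi> k (cscale c a) = c * component \<pi> k a"
  by (simp add: component_def cscale_def alg_hom_fscale[OF alg_hom_specialize] sum_distrib_left mult_ac)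

lemma component_zshift: "component \<pi> k (zshift s a) = component \<pi> (k - s) a"
  by (simp add: component_def zshift_def algebra_simps)

lemma component_sum: "component \<pi> k (sum f I) = (\<Sum>i\<in>I. component \<pi> k (f i))"
  by (induction I rule: infinite_finite_induct)
    (simp_all only: sum.infinite sum.empty sum.insert component_0 component_add not_False_eq_True)

lemma component_sum_list: "component \<pi> k (\<Sum>x\<leftarrow>xs. f x) = (\<Sum>x\<leftarrow>xs. component \<pi> k (f x))"
  by (induction xs) (simp_all only: list.map sum_list.Nil sum_list.Cons component_0 component_add)

lemma component_pcur: "component \<pi> k (pcur D) = (if cdeg D = k then ccoef D * poly \<pi> (epsilon D) else 0)"
proof (cases "cdeg D = k")
  case True
  then show ?thesis
    by (simp add: component_def specialize_pcur poly_altdef sum_distrib_left mult_ac)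
next
  case False
  then have "coeff (specialize (pcur D 1 (k + int m))) m = 0" for m
    by (auto simp: specialize_pcur)
  with False show ?thesis by (simp add: component_def)
qed

lemma separating_poly:
  fixes A :: "qfield set"
  assumes "finite A"
  shows "\<exists>\<pi>. \<forall>e\<in>A. poly \<pi> e = (if e = e0 then 1 else 0)"
proof -
  let ?\<pi> = "\<Prod>e\<in>A - {e0}. smult (1 / (e0 - e)) [:- e, 1:]"
  have "poly ?\<pi> e = (if e = e0 then 1 else 0)" if "e \<in> A" for e
  proof (cases "e = e0")
    case True
    then show ?thesis by (auto simp: poly_prod simp flip: diff_divide_distrib split: if_splits intro!: prod.neutral)
  next
    case False
    then have "\<exists>e'\<in>A - {e0}. poly (smult (1 / (e0 - e')) [:- e', 1:]) e = 0"
      using that by (intro bexI[of _ e]) auto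
    then have "poly ?\<pi> e = 0"
      unfolding poly_prod using assms by (subst prod_zero_iff) auto
    with False show ?thesis by simp
  qed
  then show ?thesis by blast
qed

lemma ccoef_nonzero:
  assumes "sorted_wrt (\<lambda>x y. fst x < fst y \<and> (fst y = fst x + 1 \<longrightarrow> snd y < snd x)) D"
  shows "ccoef D \<noteq> 0"
  using assms
proof (induction D)
  case (Cons x D)
  have "ctr x y \<noteq> 0" if "y \<in> set D" for y
  proof -
    define k where "k = fst y - fst x"
    have k: "1 \<le> k" "k = 1 \<Longrightarrow> snd y < snd x"
      using that Cons.prems by (auto simp: k_def)
    have 1: "1 - sq ^ k \<noteq> 0"
      using sq_power_neq_1[of k] k by simp
    have 2: "1 - sq ^ k / sq \<noteq> 0" if "k \<noteq> 1"
    proof -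
      have "sq ^ k / sq = sq ^ (k - 1)"
        using k by (cases k) simp_all
      then show ?thesis
        using sq_power_neq_1[of "k - 1"] k that by simp
    qed
    have 3: "1 - sq * sq ^ k \<noteq> 0"
      using sq_power_neq_1[of "Suc k"] by simp
    show ?thesis
    proof (cases "k = 1")
      case True
      then show ?thesis
        using 3 k(2) by (auto simp: ctr_def Let_def simp flip: k_def)
    next
      case False
      then show ?thesis
        using 1 2 3 by (auto simp: ctr_def Let_def simp flip: k_def)
    qed
  qed
  then show ?case
    using Cons by (simp add: prod_list_zero_iff vkap_nonzero image_iff)
qed simp

text \<open>In a run of $m \le c$ consecutive points the summands $m, m - 1, \dots, 1$ of $x(z)$ are taken, since
  $x_l(z)x_{l'}(z\mathsf q)$ vanishes for $l \le l'$.\<close>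

lemma lead_labels:
  assumes "admissible CARD('c::{finite,linorder}) ms"
  shows "\<exists>D :: (nat \<times> 'c) list. map fst D = lead ms \<and>
    sorted_wrt (\<lambda>x y. fst x < fst y \<and> (fst y = fst x + 1 \<longrightarrow> snd y < snd x)) D"
  using assms
proof (induction ms)
  case (Cons p ms)
  obtain m r where p: "p = (m, r)" by fastforce
  define s where "s = nat (- r - 1)"
  have m: "m \<le> CARD('c)" and adm: "admissible CARD('c) ms" and s: "ms \<noteq> [] \<Longrightarrow> 1 \<le> s"
    using Cons.prems by (auto simp: p s_def split: if_splits)
  obtain D :: "(nat \<times> 'c) list" where D: "map fst D = lead ms"
    "sorted_wrt (\<lambda>x y. fst x < fst y \<and> (fst y = fst x + 1 \<longrightarrow> snd y < snd x)) D"
    using Cons.IH[OF adm] by blast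
  obtain el :: "nat \<Rightarrow> 'c" where el: "\<And>k. k < CARD('c) \<Longrightarrow> rank (el k) = k"
    using rank_surj[where 'c = 'c] by metis
  let ?D = "map (\<lambda>j. (j, el (m - 1 - j))) [0..<m] @ shiftD (m + s) D"
  have "map fst ?D = lead (p # ms)"
    using arg_cong[OF D(1), of "map (\<lambda>j. j + (m + s))"]
    by (simp add: p s_def shiftD_def comp_def case_prod_beta)
  moreover have "sorted_wrt (\<lambda>x y. fst x < fst y \<and> (fst y = fst x + 1 \<longrightarrow> snd y < snd x)) ?D"
  proof -
    have "el (m - 1 - (j + 1)) < el (m - 1 - j)" if "j + 1 < m" for j
      using that m by (subst rank_less_iff[symmetric]) (simp add: el)
    then have "sorted_wrt (\<lambda>x y. fst x < fst y \<and> (fst y = fst x + 1 \<longrightarrow> snd y < snd x))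
        (map (\<lambda>j. (j, el (m - 1 - j))) [0..<m])"
      by (auto simp: sorted_wrt_map sorted_wrt_iff_nth_less)
    moreover have "sorted_wrt (\<lambda>x y. fst x < fst y \<and> (fst y = fst x + 1 \<longrightarrow> snd y < snd x)) (shiftD (m + s) D)"
      using D(2) by (simp add: shiftD_def sorted_wrt_map case_prod_beta)
    \<comment> \<open>Points of different blocks are never neighbours, so no condition links their
      labels.\<close>
    moreover have "D \<noteq> [] \<Longrightarrow> 1 \<le> s"
      using s D(1) lead_eq_Nil[OF adm] by auto
    ultimately show ?thesis
      by (fastforce simp: sorted_wrt_append shiftD_def)
  qed
  ultimately show ?case by blast
qed simp

text \<open>Among the monomials with nonzero coefficient one with least leading sum is chosen, and
  for it a labelling \<open>D0\<close> of its leading term with nonzero coefficient. A linear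
  functional that isolates \<open>D0\<close> then sees only this monomial in the relation.\<close>

lemma mcur_independent:
  fixes T :: "(nat \<times> int) list set" and w :: "(nat \<times> int) list \<Rightarrow> qfield"
  assumes T: "finite T" "\<And>ms. ms \<in> T \<Longrightarrow> admissible CARD('c::{finite,linorder}) ms"
    and sum0: "(\<Sum>ms\<in>T. cscale (w ms) (mcur ms)) = (0 :: 'c Lc_basis fseries)"
    and ms: "ms \<in> T"
  shows "w ms = 0"
proof (rule ccontr)
  assume "w ms \<noteq> 0"
  then obtain m0 where m0: "m0 \<in> T" "w m0 \<noteq> 0"
    and min: "\<And>ms. ms \<in> T \<Longrightarrow> w ms \<noteq> 0 \<Longrightarrow> sum_list (lead m0) \<le> sum_list (lead ms)"
    using arg_min_nat_lemma[of "\<lambda>ms. ms \<in> T \<and> w ms \<noteq> 0" ms "\<lambda>ms. sum_list (lead ms)"] ms by blast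
  obtain D0 :: "(nat \<times> 'c) list" where D0: "map fst D0 = lead m0"
    "sorted_wrt (\<lambda>x y. fst x < fst y \<and> (fst y = fst x + 1 \<longrightarrow> snd y < snd x)) D0"
    using lead_labels[OF T(2)[OF m0(1)]] by blast
  have c0: "ccoef D0 \<noteq> 0"
    by (rule ccoef_nonzero[OF D0(2)])
  have D0_sorted: "sorted_wrt (<) (map fst D0)"
    unfolding sorted_wrt_map by (rule sorted_wrt_mono_rel[OF _ D0(2)]) simp
  \<comment> \<open>All labelled lists that occur in the relation; the interpolation polynomial has
    to vanish at their values of \<open>epsilon\<close>, except at that of
    \<open>D0\<close>.\<close>
  define \<D> :: "(nat \<times> 'c) list set" where "\<D> = (\<Union>ms\<in>T. \<Union>(c, a)\<in>set (mexp ms). {D. map fst D = a})"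
  have "finite \<D>"
    using T(1) by (auto simp: \<D>_def finite_map_fst)
  then obtain \<pi> where \<pi>: "\<And>D. D \<in> \<D> \<Longrightarrow> poly \<pi> (epsilon D) = (if epsilon D = epsilon D0 then 1 else 0)"
    using separating_poly[of "epsilon ` \<D>" "epsilon D0"] by blast
  have \<pi>D: "poly \<pi> (epsilon D) = (if D = D0 then 1 else 0)"
    if "ms \<in> T" "(c, a) \<in> set (mexp ms)" "map fst D = a" for ms c a D
  proof -
    have "D \<in> \<D>"
      using that by (auto simp: \<D>_def)
    moreover have "sorted_wrt (<) (map fst D)"
      using mexp_sorted(1)[OF that(2)] that(3) by simp
    ultimately show ?thesis
      using \<pi>[of D] epsilon_inj[OF _ D0_sorted, of D] by auto
  qed
  \<comment> \<open>Undoing the prefactor $z^{-s}$ of \<open>ms\<close>, with $s =$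
    \<open>msh ms\<close>, reads its terms at \<open>k + msh ms\<close>, which is
    \<open>cdeg D0\<close> exactly if \<open>msh ms = msh m0\<close>. So equal leading terms with
    different last index $r_k$ are separated too.\<close>
  define k where "k = cdeg D0 - msh m0"
  have extr: "component \<pi> (k + msh ms) (xcur a :: 'c Lc_basis fseries) = (if a = lead m0 \<and> msh ms = msh m0 then ccoef D0 else 0)"
    if "ms \<in> T" "(c, a) \<in> set (mexp ms)" for ms c a
  proof -
    have "component \<pi> (k + msh ms) (xcur a :: 'c Lc_basis fseries) = (\<Sum>D | map fst D = a. if D = D0 then (if msh ms = msh m0 then ccoef D0 else 0) else 0)"
      unfolding xcur_def component_sum component_pcur
    proof (rule sum.cong[OF refl])
      fix D :: "(nat \<times> 'c) list" assume "D \<in> {D. map fst D = a}"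
      then have "poly \<pi> (epsilon D) = (if D = D0 then 1 else 0)"
        using \<pi>D[OF that] by blast
      then show "(if cdeg D = k + msh ms then ccoef D * poly \<pi> (epsilon D) else 0) =
          (if D = D0 then (if msh ms = msh m0 then ccoef D0 else 0) else 0)"
        by (cases "D = D0") (simp_all add: k_def)
    qed
    also have "\<dots> = (if a = lead m0 \<and> msh ms = msh m0 then ccoef D0 else 0)"
      by (auto simp: sum.delta[OF finite_map_fst] D0(1))
    finally show ?thesis .
  qed
  have mcur: "component \<pi> k (mcur ms :: 'c Lc_basis fseries) = (\<Sum>(c, a)\<leftarrow>mexp ms. c * (if a = lead m0 \<and> msh ms = msh m0 then ccoef D0 else 0))"
    if "ms \<in> T" for ms
    unfolding mcur_def component_zshift component_sum_list case_prod_beta' component_cscale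
  proof (intro arg_cong[of _ _ sum_list] map_cong refl)
    fix x assume "x \<in> set (mexp ms)"
    then show "fst x * component \<pi> (k - - msh ms) (xcur (snd x) :: 'c Lc_basis fseries) =
        fst x * (if snd x = lead m0 \<and> msh ms = msh m0 then ccoef D0 else 0)"
      using extr[OF that, of "fst x" "snd x"] by (simp only: prod.collapse diff_minus_eq_add)
  qed
  have other: "w ms * component \<pi> k (mcur ms :: 'c Lc_basis fseries) = 0" if "ms \<in> T" "ms \<noteq> m0" for ms
  proof (cases "w ms = 0")
    case False
    obtain c rest where lead: "mexp ms = (c, lead ms) # rest"
        "\<forall>(c', a)\<in>set rest. sum_list (lead ms) < sum_list a"
      using mexp_lead[OF admissible_pos[OF T(2)[OF \<open>ms \<in> T\<close>]]] by blast
    \<comment> \<open>By minimality the other terms of \<open>ms\<close> have a sum larger than that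
      of \<open>lead m0\<close>; the leading term itself is excluded by
      \<open>lead_inj\<close>.\<close>
    have no: "\<not> (a = lead m0 \<and> msh ms = msh m0)" if a: "(c', a) \<in> set (mexp ms)" for c' a
    proof
      assume eq: "a = lead m0 \<and> msh ms = msh m0"
      have "(c', a) \<notin> set rest"
        using lead(2) min[OF \<open>ms \<in> T\<close> False] eq by auto
      then have "a = lead ms"
        using a lead(1) by simp
      then show False
        using lead_inj[OF T(2)[OF \<open>ms \<in> T\<close>] T(2)[OF m0(1)]] eq \<open>ms \<noteq> m0\<close> by simp
    qed
    have "(\<Sum>(c, a)\<leftarrow>mexp ms. c * (if a = lead m0 \<and> msh ms = msh m0 then ccoef D0 else 0)) = (\<Sum>x\<leftarrow>mexp ms. 0)"
    proof (intro arg_cong[of _ _ sum_list] map_cong refl)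
      fix x assume x: "x \<in> set (mexp ms)"
      obtain c' a where "x = (c', a)"
        by fastforce
      with x no[of c' a] show "(case x of (c, a) \<Rightarrow> c * (if a = lead m0 \<and> msh ms = msh m0 then ccoef D0 else 0)) = 0"
        by auto
    qed
    then show ?thesis
      by (simp add: mcur[OF that(1)])
  qed simp
  obtain c rest where lead: "mexp m0 = (c, lead m0) # rest" "c \<noteq> 0"
      "\<forall>(c', a)\<in>set rest. sum_list (lead m0) < sum_list a"
    using mexp_lead[OF admissible_pos[OF T(2)[OF m0(1)]]] by blast
  have "(\<Sum>(c, a)\<leftarrow>rest. c * (if a = lead m0 \<and> msh m0 = msh m0 then ccoef D0 else 0)) = (\<Sum>x\<leftarrow>rest. 0)"
  proof (intro arg_cong[of _ _ sum_list] map_cong refl)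
    fix x assume x: "x \<in> set rest"
    obtain c' a where "x = (c', a)"
      by fastforce
    with x lead(3) show "(case x of (c, a) \<Rightarrow> c * (if a = lead m0 \<and> msh m0 = msh m0 then ccoef D0 else 0)) = 0"
      by auto
  qed
  then have "component \<pi> k (mcur m0 :: 'c Lc_basis fseries) = c * ccoef D0"
    by (simp add: mcur[OF m0(1)] lead(1))
  moreover have "w m0 * component \<pi> k (mcur m0 :: 'c Lc_basis fseries) = 0"
  proof -
    let ?h = "\<lambda>ms. w ms * component \<pi> k (mcur ms :: 'c Lc_basis fseries)"
    have "sum ?h T = 0"
      using arg_cong[OF sum0, of "component \<pi> k"] unfolding component_sum component_cscale component_0 .
    moreover have "sum ?h (T - {m0}) = 0"
      by (rule sum.neutral) (use other in blast)
    ultimately show ?thesis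
      using sum.remove[OF T(1) m0(1), of ?h] by simp
  qed
  ultimately show False
    using m0(2) lead(2) c0 by simp
qed

theorem corollary3p11:
  shows "(B_c1 :: 'c::{finite,linorder} Lc_basis fseries poly set) \<subseteq> V_c1 \<and>
         cvec.independent (eval_t1 ` (B_c1 :: 'c Lc_basis fseries poly set))"
proof
  show "(B_c1 :: 'c Lc_basis fseries poly set) \<subseteq> V_c1"
  proof
    fix A :: "'c Lc_basis fseries poly" assume "A \<in> B_c1"
    then obtain ms where A: "A = x_monomial ms"
      by (auto simp: B_c1_def)
    show "A \<in> V_c1"
      unfolding V_c1_def
    proof clarify
      fix V :: "'c Lc_basis fseries poly set"
      assume V: "is_qva_of_currents V" "x_t \<in> V"
      then interpret graded_nonlocal_qva tscale V "tgrade V" cprod one_t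
        by (simp add: is_qva_of_currents_def)
      have "x_m m \<in> V" for m
        unfolding x_m_def by (induction m) (simp_all add: vac_in prd_closed V(2))
      then show "A \<in> V"
        unfolding A x_monomial_def by (induction ms) (auto simp: vac_in prd_closed)
    qed
  qed
next
  let ?I = "{ms. admissible CARD('c) ms}"
  have B: "eval_t1 ` (B_c1 :: 'c Lc_basis fseries poly set) = mcur ` ?I"
  proof -
    have "(B_c1 :: 'c Lc_basis fseries poly set) = x_monomial ` ?I"
      unfolding B_c1_def admissible_iff by blast
    moreover have "eval_t1 (x_monomial ms :: 'c Lc_basis fseries poly) = mcur ms" if "ms \<in> ?I" for ms
      using that by (simp add: x_monomial_eq[OF admissible_neg] eval_t1_monom)
    then have "eval_t1 ` x_monomial ` ?I = (mcur ` ?I :: 'c Lc_basis fseries set)"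
      unfolding image_image by (rule image_cong[OF refl])
    ultimately show ?thesis
      by simp
  qed
  show "cvec.independent (eval_t1 ` (B_c1 :: 'c Lc_basis fseries poly set))"
    unfolding B cvec.dependent_explicit
  proof safe
    fix t u and v :: "'c Lc_basis fseries"
    assume t: "finite t" "t \<subseteq> mcur ` ?I" and sum: "(\<Sum>v\<in>t. cscale (u v) v) = 0" and v: "v \<in> t" "u v \<noteq> 0"
    \<comment> \<open>One index list is chosen for each element, which turns a relation between
      currents into one between distinct lists.\<close>
    obtain T where T: "T \<subseteq> ?I" "inj_on (mcur :: _ \<Rightarrow> 'c Lc_basis fseries) T" "t = mcur ` T"
      using iffD1[OF subset_image_inj t(2)] by auto
    obtain ms where ms: "ms \<in> T" "v = mcur ms"
      using v(1) unfolding T(3) by (rule imageE)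
    have "finite T"
      using t(1) unfolding T(3) finite_image_iff[OF T(2)] .
    moreover have "(\<Sum>ms\<in>T. cscale (u (mcur ms)) (mcur ms)) = (0 :: 'c Lc_basis fseries)"
      using sum unfolding T(3) sum.reindex[OF T(2)] comp_def .
    moreover have "admissible CARD('c) ms" if "ms \<in> T" for ms
      using T(1) that by (rule subsetD[THEN CollectD])
    ultimately have "u (mcur ms) = 0"
      using ms(1) by (intro mcur_independent[of T "\<lambda>ms. u (mcur ms)" ms])
    with v(2) ms(2) show False
      by simp
  qed
qed

end
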